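(* Let $n\ge2$, $k,l\geq 1$ and $i,j\in\{1,\dots,2n\}$. (i) $(\alpha_{n,k,i},\beta_{n,k,i})$ is a consequence of $(\alpha_{n,l,j},\beta_{n,l,j})$ if and only if $2nk+i\geq 2nl+j$. (ii) If $i$ and $j$ are odd, then $(\alpha^*_{n,k,i},\beta^*_{n,k,i})$ is a consequence of $(\alpha^*_{n,l,j},\beta^*_{n,l,j})$ if and only if $2nk+i\geq 2nl+j$. (iii) If $i$ is odd, then $(\alpha^*_{n,k,i},\beta^*_{n,k,i})$ is a consequence of $(\alpha_{n,l,j},\beta_{n,l,j})$ if and only if $2nk+i>2nl+j$. (iv) If $j$ is odd, then $(\alpha_{n,k,i},\beta_{n,k,i})$ is a consequence of $(\alpha^*_{n,l,j},\beta^*_{n,l,j})$ if and only if $2nk+i>2nl+j$.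
   Context: $X$ is a countably infinite set of letters containing distinct letters $x_1,x_2,\dots$. Bi-rooted trees. $\mathfrak B'(X)$ is the set of finite trees (up to isomorphism) with at least two vertices, all vertices labelled by letters of $X$, with an ordered pair of adjacent distinguished vertices (left root, right root). For $\alpha,\beta\in\mathfrak B'(X)$, $\alpha\sqcap\beta$ is the disjoint union of $\alpha$ and $\beta$ with an added edge joining the left root of $\alpha$ to the right root of $\beta$; these two vertices are the left and the right root of $\alpha\sqcap\beta$. A thorn is a degree-one vertex $a$ together with its edge $e$, such that both endpoints of $e$ have the same label; it is essential if $a$ is a root, non-essential otherwise. Reductions: (i) delete a non-essential thorn; (ii) edge-folding: if two distinct vertices with the same label have a common neighbour, merge them (and the two edges to the common neighbour), keeping the label, the merged vertex being a root if one of the merged vertices was. A tree is reduced if no reduction applies; each $\gamma\in\mathfrak B'(X)$ has a unique reduced form $\overline\gamma$. $\mathfrak A(X)$ is the set of reduced trees in $\mathfrak B'(X)$, with operation $\alpha\wedge\beta=\overline{\alpha\sqcap\beta}$; it is the free pseudosemilattice on $X$, with $x\in X$ identified with the single edge both of whose endpoints are labelled $x$. (A pseudosemilattice is a binary algebra satisfying $x\wedge x\approx x$; $(x\wedge y)\wedge(x\wedge z)\approx(x\wedge y)\wedge z$; $((x\wedge y)\wedge(x\wedge z))\wedge(x\wedge w)\approx(x\wedge y)\wedge((x\wedge z)\wedge(x\wedge w))$; and the left-right duals of the last two.) A pair $\sigma\in\mathfrak A(X)\times\mathfrak A(X)$ is a consequence of a pair $\tau$ (or of a set $\tau$ of pairs)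 if it belongs to the fully invariant congruence on $\mathfrak A(X)$ generated by $\tau$. The trees. For $n\ge2$, $k\ge1$, $1\le i\le 2n$: $\alpha_{n,k,i}$ is the path $a_1,a_2,\dots,a_{2nk+i}$ (consecutive vertices adjacent), $a_p$ labelled $x_q$ with $1\le q\le 2n$ and $q\equiv p\pmod{2n}$, with left root $a_1$ and right root $a_2$. $\beta_{n,k,i}$ is obtained from $\alpha_{n,k,i}$ by adding one new vertex labelled $x_{2n}$, adjacent only to $a_1$. $\alpha^*_{n,k,i}$ and $\beta^*_{n,k,i}$ are the same labelled trees as $\alpha_{n,k,i}$ and $\beta_{n,k,i}$ respectively, but with left root $a_2$ and right root $a_1$. All these trees are in $\mathfrak A(X)$. *)

theory Defs
  imports Main "HOL-Library.Countable_Set"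
begin

section \<open>Bi-rooted labelled trees\<close>

text \<open>
  Every finite tree is isomorphic to one whose vertices are natural numbers. An edge is the
  two-element set of its endpoints; values of \<open>lab\<close> outside \<open>verts\<close> are irrelevant.
\<close>

record 'a bitree =
  verts :: "nat set"
  edges :: "nat set set"
  lab :: "nat \<Rightarrow> 'a"
  lroot :: nat
  rroot :: nat

definition simple_graph :: "nat set \<Rightarrow> nat set set \<Rightarrow> bool" where
  "simple_graph V E \<longleftrightarrow> (\<forall>e\<in>E. \<exists>u\<in>V. \<exists>v\<in>V. u \<noteq> v \<and> e = {u, v})"

definition graph_connected :: "nat set \<Rightarrow> nat set set \<Rightarrow> bool" where
  "graph_connected V E \<longleftrightarrow> V \<noteq> {} \<and> (\<forall>u\<in>V. \<forall>v\<in>V. (u, v) \<in> {(a, b). {a, b} \<in> E}\<^sup>*)"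

definition graph_cycle :: "nat set set \<Rightarrow> nat list \<Rightarrow> bool" where
  "graph_cycle E c \<longleftrightarrow> length c \<ge> 3 \<and> distinct c \<and>
     (\<forall>p<length c. {c ! p, c ! (Suc p mod length c)} \<in> E)"

definition is_tree :: "nat set \<Rightarrow> nat set set \<Rightarrow> bool" where
  "is_tree V E \<longleftrightarrow> simple_graph V E \<and> graph_connected V E \<and> (\<nexists>c. graph_cycle E c)"

text \<open>The roots being the endpoints of an edge, there are automatically at least two vertices.\<close>

definition birooted_tree :: "'a bitree \<Rightarrow> bool" where
  "birooted_tree T \<longleftrightarrow> finite (verts T) \<and> is_tree (verts T) (edges T) \<and>
     {lroot T, rroot T} \<in> edges T"

definition bitree_iso :: "'a bitree \<Rightarrow> 'a bitree \<Rightarrow> bool" where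
  "bitree_iso S T \<longleftrightarrow> (\<exists>f. bij_betw f (verts S) (verts T) \<and>
     (\<forall>u\<in>verts S. \<forall>v\<in>verts S. {f u, f v} \<in> edges T \<longleftrightarrow> {u, v} \<in> edges S) \<and>
     (\<forall>u\<in>verts S. lab T (f u) = lab S u) \<and>
     f (lroot S) = lroot T \<and> f (rroot S) = rroot T)"

text \<open>A tree up to isomorphism is represented by its isomorphism class.\<close>

type_synonym 'a bitree_class = "'a bitree set"

definition iso_class :: "'a bitree \<Rightarrow> 'a bitree_class" where
  "iso_class T = {S. birooted_tree S \<and> bitree_iso S T}"

section \<open>Reduction\<close>

text \<open>A thorn is given by its degree-one vertex; it is non-essential if that vertex is no root.\<close>

definition thorn :: "'a bitree \<Rightarrow> nat \<Rightarrow> bool" where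
  "thorn T a \<longleftrightarrow> a \<in> verts T \<and> (\<exists>b. {e \<in> edges T. a \<in> e} = {{a, b}} \<and> lab T a = lab T b)"

definition nonessential_thorn :: "'a bitree \<Rightarrow> nat \<Rightarrow> bool" where
  "nonessential_thorn T a \<longleftrightarrow> thorn T a \<and> a \<noteq> lroot T \<and> a \<noteq> rroot T"

definition delete_vertex :: "nat \<Rightarrow> 'a bitree \<Rightarrow> 'a bitree" where
  "delete_vertex a T = T\<lparr>verts := verts T - {a}, edges := {e \<in> edges T. a \<notin> e}\<rparr>"

definition foldable :: "'a bitree \<Rightarrow> nat \<Rightarrow> nat \<Rightarrow> bool" where
  "foldable T u v \<longleftrightarrow> u \<in> verts T \<and> v \<in> verts T \<and> u \<noteq> v \<and> lab T u = lab T v \<and>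
     (\<exists>w. {u, w} \<in> edges T \<and> {v, w} \<in> edges T)"

text \<open>The vertex \<open>u\<close> is identified with \<open>v\<close>, which keeps the name \<open>v\<close>.\<close>

definition merge :: "nat \<Rightarrow> nat \<Rightarrow> 'a bitree \<Rightarrow> 'a bitree" where
  "merge u v T = (let f = (\<lambda>w. if w = u then v else w) in
     T\<lparr>verts := f ` verts T, edges := (\<lambda>e. f ` e) ` edges T,
       lroot := f (lroot T), rroot := f (rroot T)\<rparr>)"

inductive reduction :: "'a bitree \<Rightarrow> 'a bitree \<Rightarrow> bool" where
  delete_thorn: "nonessential_thorn T a \<Longrightarrow> reduction T (delete_vertex a T)"
| fold_edges: "foldable T u v \<Longrightarrow> reduction T (merge u v T)"

definition reduced :: "'a bitree \<Rightarrow> bool" where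
  "reduced T \<longleftrightarrow> (\<nexists>T'. reduction T T')"

text \<open>The reduced form of a tree exists and is unique up to isomorphism.\<close>

definition reduced_form :: "'a bitree_class \<Rightarrow> 'a bitree_class" where
  "reduced_form \<gamma> = (THE \<delta>. \<exists>S\<in>\<gamma>. \<exists>T. reduction\<^sup>*\<^sup>* S T \<and> reduced T \<and> \<delta> = iso_class T)"

section \<open>The free pseudosemilattice\<close>

definition free_psl :: "'a set \<Rightarrow> 'a bitree_class set" where
  "free_psl X = iso_class ` {T. birooted_tree T \<and> lab T ` verts T \<subseteq> X \<and> reduced T}"

text \<open>The disjoint union is formed by sending the vertices of the two trees to even and odd numbers.\<close>

definition join_bitree :: "'a bitree \<Rightarrow> 'a bitree \<Rightarrow> 'a bitree" where
  "join_bitree S T =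
     \<lparr>verts = (\<lambda>v. 2 * v) ` verts S \<union> (\<lambda>v. 2 * v + 1) ` verts T,
      edges = (\<lambda>e. (\<lambda>v. 2 * v) ` e) ` edges S \<union> (\<lambda>e. (\<lambda>v. 2 * v + 1) ` e) ` edges T \<union>
              {{2 * lroot S, 2 * rroot T + 1}},
      lab = (\<lambda>v. if even v then lab S (v div 2) else lab T (v div 2)),
      lroot = 2 * lroot S,
      rroot = 2 * rroot T + 1\<rparr>"

text \<open>All members of the union below coincide.\<close>

definition join :: "'a bitree_class \<Rightarrow> 'a bitree_class \<Rightarrow> 'a bitree_class" where
  "join \<alpha> \<beta> = (\<Union>S\<in>\<alpha>. \<Union>T\<in>\<beta>. iso_class (join_bitree S T))"

definition meet :: "'a bitree_class \<Rightarrow> 'a bitree_class \<Rightarrow> 'a bitree_class" where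
  "meet \<alpha> \<beta> = reduced_form (join \<alpha> \<beta>)"

section \<open>Consequences\<close>

definition endomorphism :: "'a set \<Rightarrow> ('a bitree_class \<Rightarrow> 'a bitree_class) \<Rightarrow> bool" where
  "endomorphism X \<phi> \<longleftrightarrow> (\<forall>\<alpha>\<in>free_psl X. \<phi> \<alpha> \<in> free_psl X) \<and>
     (\<forall>\<alpha>\<in>free_psl X. \<forall>\<beta>\<in>free_psl X. \<phi> (meet \<alpha> \<beta>) = meet (\<phi> \<alpha>) (\<phi> \<beta>))"

definition congruence :: "'a set \<Rightarrow> 'a bitree_class rel \<Rightarrow> bool" where
  "congruence X \<rho> \<longleftrightarrow> equiv (free_psl X) \<rho> \<and>
     (\<forall>\<alpha> \<alpha>' \<beta> \<beta>'. (\<alpha>, \<alpha>') \<in> \<rho> \<longrightarrow> (\<beta>, \<beta>') \<in> \<rho> \<longrightarrow> (meet \<alpha> \<beta>, meet \<alpha>' \<beta>') \<in> \<rho>)"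

definition fully_invariant_congruence :: "'a set \<Rightarrow> 'a bitree_class rel \<Rightarrow> bool" where
  "fully_invariant_congruence X \<rho> \<longleftrightarrow> congruence X \<rho> \<and>
     (\<forall>\<phi> \<alpha> \<beta>. endomorphism X \<phi> \<longrightarrow> (\<alpha>, \<beta>) \<in> \<rho> \<longrightarrow> (\<phi> \<alpha>, \<phi> \<beta>) \<in> \<rho>)"

definition generated_fic :: "'a set \<Rightarrow> 'a bitree_class rel \<Rightarrow> 'a bitree_class rel" where
  "generated_fic X \<tau> = \<Inter>{\<rho>. fully_invariant_congruence X \<rho> \<and> \<tau> \<subseteq> \<rho>}"

definition consequence ::
  "'a set \<Rightarrow> 'a bitree_class \<times> 'a bitree_class \<Rightarrow> 'a bitree_class \<times> 'a bitree_class \<Rightarrow> bool" where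
  "consequence X \<sigma> \<tau> \<longleftrightarrow> \<sigma> \<in> generated_fic X {\<tau>}"

section \<open>The trees of the statement\<close>

text \<open>
  The vertex \<open>a\<^sub>p\<close> is the number \<open>p\<close>, and \<open>(p - 1) mod (2 * n) + 1\<close> is the
  representative of \<open>p\<close> modulo \<open>2 * n\<close> in the range from 1 to \<open>2 * n\<close>.
\<close>

definition alpha_tree :: "(nat \<Rightarrow> 'a) \<Rightarrow> nat \<Rightarrow> nat \<Rightarrow> nat \<Rightarrow> 'a bitree" where
  "alpha_tree x n k i =
     \<lparr>verts = {1..2 * n * k + i},
      edges = {{p, p + 1} | p. 1 \<le> p \<and> p < 2 * n * k + i},
      lab = (\<lambda>p. x ((p - 1) mod (2 * n) + 1)),
      lroot = 1,
      rroot = 2\<rparr>"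

text \<open>The additional vertex is 0.\<close>

definition beta_tree :: "(nat \<Rightarrow> 'a) \<Rightarrow> nat \<Rightarrow> nat \<Rightarrow> nat \<Rightarrow> 'a bitree" where
  "beta_tree x n k i = (let T = alpha_tree x n k i in
     T\<lparr>verts := insert 0 (verts T), edges := insert {0, 1} (edges T),
       lab := (lab T)(0 := x (2 * n))\<rparr>)"

definition swap_roots :: "'a bitree \<Rightarrow> 'a bitree" where
  "swap_roots T = T\<lparr>lroot := rroot T, rroot := lroot T\<rparr>"

definition alpha :: "(nat \<Rightarrow> 'a) \<Rightarrow> nat \<Rightarrow> nat \<Rightarrow> nat \<Rightarrow> 'a bitree_class" where
  "alpha x n k i = iso_class (alpha_tree x n k i)"

definition beta :: "(nat \<Rightarrow> 'a) \<Rightarrow> nat \<Rightarrow> nat \<Rightarrow> nat \<Rightarrow> 'a bitree_class" where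
  "beta x n k i = iso_class (beta_tree x n k i)"

definition alpha_star :: "(nat \<Rightarrow> 'a) \<Rightarrow> nat \<Rightarrow> nat \<Rightarrow> nat \<Rightarrow> 'a bitree_class" where
  "alpha_star x n k i = iso_class (swap_roots (alpha_tree x n k i))"

definition beta_star :: "(nat \<Rightarrow> 'a) \<Rightarrow> nat \<Rightarrow> nat \<Rightarrow> nat \<Rightarrow> 'a bitree_class" where
  "beta_star x n k i = iso_class (swap_roots (beta_tree x n k i))"

end

theory Submission
  imports Defs
begin

text \<open>Adding to a reduced tree the missing thorns gives a bipartite graph in which two vertices
  with equal labels never have a common neighbour. For every graph \<open>G\<close> of this kind the
  label-preserving maps of a tree into \<open>G\<close> are unaffected by reductions, and the images of the root
  edge form a relation that is computed along \<open>\<sqinter>\<close>. The relations obtained from all \<open>G\<close> determine a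
  reduced tree; hence the reduced form is unique, and identities between meets, as well as the
  existence of endomorphisms, are checked on relations.

  If \<open>M \<ge> m\<close>, the path with \<open>m\<close> vertices is absorbed by the path with \<open>M\<close> vertices and the
  same orientation, and so is the extra vertex. With the opposite orientation the shorter path
  has to start at the second vertex of the longer one. Conversely, for \<open>M < m\<close> consider walks with
  \<open>m\<close> vertices and labels of period \<open>2n\<close> in the path with \<open>M\<close> vertices. In one period such a
  walk moves by \<open>0\<close> or \<open>\<plusminus>2n\<close>. If it returns to its start, its vertex with number \<open>2n\<close>
  already serves as the extra vertex; otherwise it never turns around and needs \<open>m\<close> different
  vertices. For \<open>M = m\<close> odd and opposite orientations it would have to start at an end of the path,
  and both ends lie on the wrong side.\<close>

section \<open>Rooted descriptions of trees\<close>

text \<open>The obstacle is full invariance: to refute a consequence one must control a pair under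
  all endomorphisms, and these are never classified. The price is that such a map may send a letter
  to a relation unrelated to the labels of the graph. What is retained is \<open>monochrome\<close>:
  all left ends have one residue modulo \<open>2 * n\<close>, and so have all right ends. Hence
  walks are periodic only modulo \<open>2 * n\<close>, and the paths must be written as products of
  letters before such maps can be computed on them. For opposite orientations a mere renaming of
  letters is not enough: moving all labels on by one would turn the extra vertex into a copy of the
  first vertex of the longer path. Therefore the last letter becomes a product of two letters. As
  \<open>2 * n\<close> is even, that letter always occurs on the same side, so one order of the
  product fits everywhere.\<close>

definition rooted_tree ::
  "nat set \<Rightarrow> nat set set \<Rightarrow> nat \<Rightarrow> (nat \<Rightarrow> nat) \<Rightarrow> (nat \<Rightarrow> nat) \<Rightarrow> bool" where
  "rooted_tree V E r par d \<longleftrightarrow> r \<in> V \<and>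
     (\<forall>v\<in>V - {r}. par v \<in> V \<and> d v = Suc (d (par v))) \<and> E = (\<lambda>v. {v, par v}) ` (V - {r})"

lemma rtrancl_distinct_path:
  assumes "(u, v) \<in> R\<^sup>*"
  shows "\<exists>p. p \<noteq> [] \<and> distinct p \<and> hd p = u \<and> last p = v \<and>
    (\<forall>i. Suc i < length p \<longrightarrow> (p ! i, p ! Suc i) \<in> R)"
  using assms
proof (induction rule: rtrancl_induct)
  case base
  show ?case by (rule exI[of _ "[u]"]) simp
next
  case (step y z)
  then obtain p where p: "p \<noteq> []" "distinct p" "hd p = u" "last p = y"
    "\<And>i. Suc i < length p \<Longrightarrow> (p ! i, p ! Suc i) \<in> R" by blast
  show ?case
  proof (cases "z \<in> set p")
    case True
    \<comment> \<open>The walk returns to a vertex of the path, so the part of the path after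
      \<open>z\<close> is cut off.\<close>
    then obtain as bs where as: "p = as @ z # bs" by (meson split_list)
    have "(as @ [z]) ! i = p ! i" if "i < length (as @ [z])" for i
      using that as by (auto simp: nth_append less_Suc_eq)
    moreover have "hd (as @ [z]) = u" using p(3) as by (cases as) auto
    ultimately show ?thesis using p as
      by (intro exI[of _ "as @ [z]"]) auto
  next
    case False
    have "((p @ [z]) ! i, (p @ [z]) ! Suc i) \<in> R" if "Suc i < length (p @ [z])" for i
    proof (cases "Suc i < length p")
      case True
      then show ?thesis using p(5) by (simp add: nth_append)
    next
      case False
      then have "i = length p - 1" using that by simp
      then show ?thesis using p(1,4) step(2) by (simp add: nth_append last_conv_nth)
    qed
    then show ?thesis using p False
      by (intro exI[of _ "p @ [z]"]) (auto simp: hd_append)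
  qed
qed

text \<open>A repetition-free path from \<open>u\<close> to \<open>v\<close> that avoids this edge
  has at least three vertices, so the edge would close it to a cycle.\<close>

lemma tree_edge_is_bridge:
  assumes "\<nexists>c. graph_cycle E c" "{u, v} \<in> E" "u \<noteq> v"
  shows "(u, v) \<notin> {(a, b). {a, b} \<in> E - {{u, v}}}\<^sup>*"
proof
  assume "(u, v) \<in> {(a, b). {a, b} \<in> E - {{u, v}}}\<^sup>*"
  from rtrancl_distinct_path[OF this] obtain p where p: "p \<noteq> []" "distinct p" "hd p = u" "last p = v"
    and e: "\<And>i. Suc i < length p \<Longrightarrow> {p ! i, p ! Suc i} \<in> E - {{u, v}}" by auto
  have l2: "length p \<ge> 2"
    using p assms(3) by (cases p; cases "tl p") auto
  have "length p \<noteq> 2"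
  proof
    assume l: "length p = 2"
    then have "p ! 0 = u" "p ! 1 = v" using p by (auto simp: hd_conv_nth last_conv_nth)
    then show False using e[of 0] l by simp
  qed
  then have l3: "length p \<ge> 3" using l2 by simp
  have "{p ! i, p ! (Suc i mod length p)} \<in> E" if "i < length p" for i
  proof (cases "Suc i < length p")
    case True
    then show ?thesis using e[of i] by simp
  next
    case False
    then have "i = length p - 1" using that by simp
    then show ?thesis using p assms(2) l3 by (simp add: hd_conv_nth last_conv_nth insert_commute)
  qed
  then have "graph_cycle E p" using l3 p(2) unfolding graph_cycle_def by blast
  then show False using assms(1) by blast
qed

text \<open>The depth is the distance from \<open>r\<close>, and the parent is a predecessor on a
  shortest path. The parent edges already connect everything, so any further edge would fail to be a
  bridge.\<close>

lemma tree_imp_rooted: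
  assumes "is_tree V E" "r \<in> V"
  shows "\<exists>par d. rooted_tree V E r par d"
proof -
  define R where "R = {(a, b). {a, b} \<in> E}"
  have V: "u \<in> V \<and> v \<in> V \<and> u \<noteq> v" if "{u, v} \<in> E" for u v
    using assms(1) that unfolding is_tree_def simple_graph_def
    by (metis doubleton_eq_iff)
  have symR: "sym R" by (auto simp: sym_def R_def insert_commute)
  define d where "d v = (LEAST k. (r, v) \<in> R ^^ k)" for v
  have ex: "\<exists>k. (r, v) \<in> R ^^ k" if "v \<in> V" for v
    using assms that unfolding is_tree_def graph_connected_def R_def
    by (meson rtrancl_imp_relpow)
  have "\<exists>u. (u, v) \<in> R \<and> d v = Suc (d u)" if v: "v \<in> V" "v \<noteq> r" for v
  proof -
    have *: "(r, v) \<in> R ^^ d v" unfolding d_def using ex[OF v(1)] by (rule LeastI_ex)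
    then obtain k where k: "d v = Suc k" using v(2) by (cases "d v") auto
    then obtain u where u: "(r, u) \<in> R ^^ k" "(u, v) \<in> R" using * by auto
    have "d u \<le> k" unfolding d_def using u(1) by (rule Least_le)
    moreover have "(r, u) \<in> R ^^ d u" unfolding d_def using u(1) by (rule LeastI)
    then have "(r, v) \<in> R ^^ Suc (d u)" using u(2) by auto
    then have "d v \<le> Suc (d u)" unfolding d_def[of v] by (rule Least_le)
    ultimately show ?thesis using k u by auto
  qed
  then obtain par where par: "\<And>v. v \<in> V \<Longrightarrow> v \<noteq> r \<Longrightarrow> (par v, v) \<in> R \<and> d v = Suc (d (par v))"
    by metis
  let ?P = "(\<lambda>v. {v, par v}) ` (V - {r})"
  have sub: "?P \<subseteq> E" using par by (auto simp: R_def insert_commute)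
  have conn: "(v, r) \<in> {(a, b). {a, b} \<in> ?P}\<^sup>*" if "v \<in> V" for v
    using that
  proof (induction "d v" arbitrary: v rule: less_induct)
    case less
    show ?case
    proof (cases "v = r")
      case False
      then have p: "(par v, v) \<in> R" "d v = Suc (d (par v))" using par less.prems by auto
      then have "par v \<in> V" using V by (auto simp: R_def)
      then have "(par v, r) \<in> {(a, b). {a, b} \<in> ?P}\<^sup>*" using less(1) p by simp
      moreover have "(v, par v) \<in> {(a, b). {a, b} \<in> ?P}" using False less.prems by auto
      ultimately show ?thesis by (meson converse_rtrancl_into_rtrancl)
    qed simp
  qed
  have "E \<subseteq> ?P"
  proof (rule ccontr)
    assume "\<not> E \<subseteq> ?P"
    then obtain e where e: "e \<in> E" "e \<notin> ?P" by blast
    then obtain u v where uv: "u \<in> V" "v \<in> V" "u \<noteq> v" "e = {u, v}"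
      using assms(1) unfolding is_tree_def simple_graph_def by metis
    let ?R = "{(a, b). {a, b} \<in> ?P}"
    have "sym ?R" by (auto simp: sym_def insert_commute)
    then have "(r, v) \<in> ?R\<^sup>*" using conn[OF uv(2)] by (meson sym_rtrancl symD)
    then have "(u, v) \<in> ?R\<^sup>*" using conn[OF uv(1)] by (meson rtrancl_trans)
    moreover have "?R \<subseteq> {(a, b). {a, b} \<in> E - {{u, v}}}" using sub e uv by auto
    ultimately have "(u, v) \<in> {(a, b). {a, b} \<in> E - {{u, v}}}\<^sup>*"
      by (meson in_mono rtrancl_mono)
    then show False
      using tree_edge_is_bridge[of E u v] assms(1) e uv unfolding is_tree_def by blast
  qed
  then have "E = ?P" using sub by blast
  moreover have "par v \<in> V \<and> d v = Suc (d (par v))" if "v \<in> V" "v \<noteq> r" for v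
    using par[OF that] V[of "par v" v] by (simp add: R_def)
  ultimately have "rooted_tree V E r par d"
    unfolding rooted_tree_def using assms(2) by blast
  then show ?thesis by blast
qed

text \<open>On a cycle, both neighbours of a vertex of maximal depth would have to be its parent.
  Thanks to this, new trees are verified below by giving \<open>par\<close> and \<open>d\<close>,
  without any talk of cycles.\<close>

lemma rooted_imp_tree:
  assumes "rooted_tree V E r par d"
  shows "is_tree V E"
proof -
  have r: "r \<in> V" and par: "\<And>v. v \<in> V \<Longrightarrow> v \<noteq> r \<Longrightarrow> par v \<in> V \<and> d v = Suc (d (par v))"
    and E: "E = (\<lambda>v. {v, par v}) ` (V - {r})"
    using assms unfolding rooted_tree_def by auto
  have simple: "simple_graph V E"
    unfolding simple_graph_def
  proof
    fix e assume "e \<in> E"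
    then obtain v where "v \<in> V" "v \<noteq> r" "e = {v, par v}" using E by auto
    then show "\<exists>u\<in>V. \<exists>v\<in>V. u \<noteq> v \<and> e = {u, v}" using par[of v]
      by (metis n_not_Suc_n)
  qed
  let ?R = "{(a, b). {a, b} \<in> E}"
  have conn: "(v, r) \<in> ?R\<^sup>*" if "v \<in> V" for v
    using that
  proof (induction "d v" arbitrary: v rule: less_induct)
    case less
    show ?case
    proof (cases "v = r")
      case False
      then have "(par v, r) \<in> ?R\<^sup>*" using less par by simp
      moreover have "(v, par v) \<in> ?R" using False less.prems E by auto
      ultimately show ?thesis by (meson converse_rtrancl_into_rtrancl)
    qed simp
  qed
  have "sym ?R" by (auto simp: sym_def insert_commute)
  then have "(r, v) \<in> ?R\<^sup>*" if "v \<in> V" for v using conn[OF that] by (meson sym_rtrancl symD)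
  then have connected: "graph_connected V E"
    unfolding graph_connected_def using conn r by (meson empty_iff rtrancl_trans)
  have "False" if c: "graph_cycle E c" for c
  proof -
    have l: "length c \<ge> 3" and dist: "distinct c"
      and e: "\<And>p. p < length c \<Longrightarrow> {c ! p, c ! (Suc p mod length c)} \<in> E"
      using c unfolding graph_cycle_def by auto
    define m where "m = Max ((\<lambda>p. d (c ! p)) ` {..<length c})"
    have "m \<in> (\<lambda>p. d (c ! p)) ` {..<length c}" unfolding m_def
      using l by (intro Max_in) (auto simp: lessThan_empty_iff)
    then obtain p where p: "p < length c" "d (c ! p) = m" by auto
    have le: "d (c ! q) \<le> d (c ! p)" if "q < length c" for q
      using p that unfolding m_def by simp
    have *: "c ! q = par (c ! p)" if that': "q < length c" "{c ! p, c ! q} \<in> E" for q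
    proof -
      obtain v where v: "v \<in> V" "v \<noteq> r" "{c ! p, c ! q} = {v, par v}" using that'(2) E by auto
      then consider "c ! p = v" "c ! q = par v" | "c ! q = v" "c ! p = par v"
        by (auto simp: doubleton_eq_iff)
      then show ?thesis using par[OF v(1,2)] le[OF that'(1)] by cases auto
    qed
    define q1 where "q1 = Suc p mod length c"
    define q2 where "q2 = (if p = 0 then length c - 1 else p - 1)"
    have q: "q1 < length c" "q2 < length c" using l p
      by (auto simp: q1_def q2_def mod_Suc)
    have "Suc q2 mod length c = p" using p l by (auto simp: q2_def)
    then have "c ! q2 = par (c ! p)" using * e[of q2] q by (simp add: insert_commute)
    moreover have "c ! q1 = par (c ! p)" using * e[of p] q p by (simp add: q1_def)
    ultimately have "c ! q1 = c ! q2" by simp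
    then have "q1 = q2" using nth_eq_iff_index_eq[OF dist q] by blast
    then show False using l p by (auto simp: q1_def q2_def mod_Suc split: if_splits)
  qed
  then show ?thesis using simple connected unfolding is_tree_def by blast
qed

lemma birootedD:
  assumes "birooted_tree T"
  shows "finite (verts T)" "is_tree (verts T) (edges T)" "{lroot T, rroot T} \<in> edges T"
  using assms unfolding birooted_tree_def by auto

lemma birooted_edge:
  assumes "birooted_tree T" "{u, v} \<in> edges T"
  shows "u \<in> verts T" "v \<in> verts T" "u \<noteq> v"
  using assms unfolding birooted_tree_def is_tree_def simple_graph_def
  by (metis doubleton_eq_iff)+

lemma birooted_edgeE:
  assumes "birooted_tree T" "e \<in> edges T"
  obtains u v where "u \<in> verts T" "v \<in> verts T" "u \<noteq> v" "e = {u, v}"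
  using assms unfolding birooted_tree_def is_tree_def simple_graph_def by blast

lemma birooted_roots:
  assumes "birooted_tree T"
  shows "lroot T \<in> verts T" "rroot T \<in> verts T" "lroot T \<noteq> rroot T"
  using birooted_edge[OF assms birootedD(3)[OF assms]] by auto

lemma birooted_induct [consumes 2, case_names root step]:
  assumes "birooted_tree T" "v \<in> verts T"
    and "P (lroot T)"
    and "\<And>u v. {u, v} \<in> edges T \<Longrightarrow> P u \<Longrightarrow> P v"
  shows "P v"
proof -
  have "(lroot T, v) \<in> {(a, b). {a, b} \<in> edges T}\<^sup>*"
    using assms(1,2) birooted_roots[OF assms(1)]
    unfolding birooted_tree_def is_tree_def graph_connected_def by blast
  then show ?thesis by (induction rule: rtrancl_induct) (use assms(3,4) in auto)
qed

lemma birooted_treeI: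
  assumes "finite (verts T)" "rooted_tree (verts T) (edges T) r par d" "{lroot T, rroot T} \<in> edges T"
  shows "birooted_tree T"
  using assms rooted_imp_tree unfolding birooted_tree_def by blast

lemma birooted_rooting:
  assumes "birooted_tree T" "r \<in> verts T"
  obtains par d where "rooted_tree (verts T) (edges T) r par d"
  using tree_imp_rooted[OF birootedD(2)[OF assms(1)] assms(2)] by blast

section \<open>Reductions and joins of trees\<close>

lemma birooted_delete_vertex:
  assumes T: "birooted_tree T" and a: "nonessential_thorn T a"
  shows "birooted_tree (delete_vertex a T)"
proof -
  obtain b where b: "{e \<in> edges T. a \<in> e} = {{a, b}}" "a \<noteq> lroot T" "a \<noteq> rroot T" "a \<in> verts T"
    using a unfolding nonessential_thorn_def thorn_def by blast
  then have ab: "{a, b} \<in> edges T" by blast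
  note bv = birooted_edge[OF T ab]
  \<comment> \<open>With the neighbour of the thorn as root, no other vertex has \<open>a\<close> as
    its parent, so the parent function survives the deletion.\<close>
  obtain par d where p: "rooted_tree (verts T) (edges T) b par d"
    using birooted_rooting[OF T bv(2)] by blast
  then have p': "b \<in> verts T" "\<And>v. v \<in> verts T \<Longrightarrow> v \<noteq> b \<Longrightarrow> par v \<in> verts T \<and> d v = Suc (d (par v))"
    "edges T = (\<lambda>v. {v, par v}) ` (verts T - {b})" unfolding rooted_tree_def by auto
  have pa: "par v \<noteq> a" if "v \<in> verts T" "v \<noteq> b" "v \<noteq> a" for v
  proof
    assume "par v = a"
    then have "{v, a} \<in> edges T" using that p'(3) by auto
    then have "{v, a} \<in> {e \<in> edges T. a \<in> e}" by blast
    then show False using b(1) that by (auto simp: doubleton_eq_iff)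
  qed
  have "{e \<in> edges T. a \<notin> e} = (\<lambda>v. {v, par v}) ` (verts T - {a} - {b})"
    using pa p'(3) by auto
  then have "rooted_tree (verts T - {a}) {e \<in> edges T. a \<notin> e} b par d"
    unfolding rooted_tree_def using p' pa bv by auto
  then show ?thesis
    using birootedD[OF T] b
    by (intro birooted_treeI[where r=b and par=par and d=d]) (auto simp: delete_vertex_def)
qed

lemma birooted_merge:
  assumes T: "birooted_tree T" and uv: "foldable T u v"
  shows "birooted_tree (merge u v T)"
proof -
  obtain w where w: "{u, w} \<in> edges T" "{v, w} \<in> edges T"
    and uv': "u \<noteq> v" using uv unfolding foldable_def by blast
  note wv = birooted_edge[OF T w(1)] birooted_edge[OF T w(2)]
  \<comment> \<open>With the common neighbour as root, \<open>u\<close> and \<open>v\<close> are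
    children of equal depth; the depth survives, and only parents equal to \<open>u\<close> are
    redirected.\<close>
  obtain par d where p: "rooted_tree (verts T) (edges T) w par d"
    using birooted_rooting[OF T wv(2)] by blast
  then have p': "\<And>v. v \<in> verts T \<Longrightarrow> v \<noteq> w \<Longrightarrow> par v \<in> verts T \<and> d v = Suc (d (par v))"
    "edges T = (\<lambda>v. {v, par v}) ` (verts T - {w})" unfolding rooted_tree_def by auto
  have ch: "par z = w" if "{z, w} \<in> edges T" for z
    using that p'(2) by (auto simp: doubleton_eq_iff)
  have pu: "par u = w" "par v = w" using ch w by auto
  then have du: "d u = d v" using p'(1) wv by metis
  define f where "f = (\<lambda>z. if z = u then v else z)"
  have V: "f ` verts T = verts T - {u}" using wv uv' by (auto simp: f_def)
  have m: "merge u v T = T\<lparr>verts := f ` verts T, edges := (\<lambda>e. f ` e) ` edges T,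
       lroot := f (lroot T), rroot := f (rroot T)\<rparr>"
    unfolding merge_def Let_def f_def by simp
  have df: "d (f z) = d z" for z using du by (simp add: f_def)
  have "(\<lambda>e. f ` e) ` edges T = (\<lambda>z. {z, f (par z)}) ` (f ` verts T - {w})"
  proof (intro equalityI subsetI)
    fix e assume "e \<in> (\<lambda>e. f ` e) ` edges T"
    then obtain z where z: "z \<in> verts T" "z \<noteq> w" "e = {f z, f (par z)}" using p'(2) by auto
    then have "e = {f z, f (par (f z))}" "f z \<noteq> w" using pu wv by (auto simp: f_def)
    then show "e \<in> (\<lambda>z. {z, f (par z)}) ` (f ` verts T - {w})" using z by auto
  next
    fix e assume "e \<in> (\<lambda>z. {z, f (par z)}) ` (f ` verts T - {w})"
    then obtain z where z: "z \<in> verts T" "z \<noteq> u" "z \<noteq> w" "e = {z, f (par z)}" using V by auto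
    then have "e = f ` {z, par z}" by (auto simp: f_def)
    then show "e \<in> (\<lambda>e. f ` e) ` edges T" using z p'(2) by blast
  qed
  moreover have "w \<in> f ` verts T" using V wv by auto
  moreover have "f (par z) \<in> f ` verts T" "d z = Suc (d (f (par z)))"
    if "z \<in> f ` verts T" "z \<noteq> w" for z
  proof -
    have "z \<in> verts T" using that(1) V by blast
    then have "par z \<in> verts T \<and> d z = Suc (d (par z))" using p'(1) that(2) by blast
    then show "f (par z) \<in> f ` verts T" "d z = Suc (d (f (par z)))" using df by auto
  qed
  ultimately have "rooted_tree (f ` verts T) ((\<lambda>e. f ` e) ` edges T) w (\<lambda>z. f (par z)) d"
    unfolding rooted_tree_def by (intro conjI ballI) simp_all
  moreover have "{f (lroot T), f (rroot T)} = f ` {lroot T, rroot T}" by simp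
  then have "{f (lroot T), f (rroot T)} \<in> (\<lambda>e. f ` e) ` edges T"
    using birootedD(3)[OF T] by blast
  ultimately show ?thesis unfolding m
    using birootedD(1)[OF T]
    by (intro birooted_treeI[where r=w and par="\<lambda>z. f (par z)" and d=d]) auto
qed

lemma reduction_birooted:
  assumes "reduction S T" "birooted_tree S"
  shows "birooted_tree T"
  using assms by cases (auto intro: birooted_delete_vertex birooted_merge)

lemma reductions_birooted:
  assumes "reduction\<^sup>*\<^sup>* S T" "birooted_tree S"
  shows "birooted_tree T"
  using assms by (induction rule: rtranclp_induct) (auto intro: reduction_birooted)

lemma reduction_card_less:
  assumes "reduction S T" "birooted_tree S"
  shows "card (verts T) < card (verts S)"
  using assms(1)
proof cases
  case (delete_thorn a)
  then have "verts T \<subseteq> verts S - {a}" "a \<in> verts S"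
    by (simp_all add: delete_vertex_def nonessential_thorn_def thorn_def)
  then show ?thesis using birootedD(1)[OF assms(2)]
    by (meson card_Diff1_less card_mono finite_Diff le_less_trans)
next
  case (fold_edges u v)
  then have "verts T \<subseteq> verts S - {u}" "u \<in> verts S"
    by (auto simp: merge_def foldable_def Let_def)
  then show ?thesis using birootedD(1)[OF assms(2)]
    by (meson card_Diff1_less card_mono finite_Diff le_less_trans)
qed

lemma reduction_labels:
  assumes "reduction S T"
  shows "lab T = lab S" "verts T \<subseteq> verts S"
  using assms by (cases; auto simp: delete_vertex_def merge_def foldable_def Let_def)+

lemma reductions_labels:
  assumes "reduction\<^sup>*\<^sup>* S T"
  shows "lab T = lab S" "verts T \<subseteq> verts S"
  using assms by (induction rule: rtranclp_induct) (auto dest: reduction_labels)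

lemma ex_reduced:
  assumes "birooted_tree S"
  shows "\<exists>R. reduction\<^sup>*\<^sup>* S R \<and> reduced R \<and> birooted_tree R"
  using assms
proof (induction "card (verts S)" arbitrary: S rule: less_induct)
  case less
  show ?case
  proof (cases "reduced S")
    case False
    then obtain T where T: "reduction S T" unfolding reduced_def by blast
    then obtain R where "reduction\<^sup>*\<^sup>* T R" "reduced R" "birooted_tree R"
      using less reduction_card_less reduction_birooted by blast
    then show ?thesis using T by (meson converse_rtranclp_into_rtranclp)
  qed (use less in blast)
qed

lemma reduced_iff:
  "reduced T \<longleftrightarrow> (\<forall>a. \<not> nonessential_thorn T a) \<and> (\<forall>u v. \<not> foldable T u v)"
  unfolding reduced_def reduction.simps by blast

lemma birooted_join_bitree:
  assumes S: "birooted_tree S" and T: "birooted_tree T"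
  shows "birooted_tree (join_bitree S T)"
proof -
  note rS = birooted_roots[OF S] and rT = birooted_roots[OF T]
  obtain p d where p: "rooted_tree (verts S) (edges S) (lroot S) p d"
    using birooted_rooting[OF S rS(1)] by blast
  obtain q e where q: "rooted_tree (verts T) (edges T) (rroot T) q e"
    using birooted_rooting[OF T rT(2)] by blast
  have p': "\<And>v. v \<in> verts S \<Longrightarrow> v \<noteq> lroot S \<Longrightarrow> p v \<in> verts S \<and> d v = Suc (d (p v))"
    "edges S = (\<lambda>v. {v, p v}) ` (verts S - {lroot S})" using p unfolding rooted_tree_def by auto
  have q': "\<And>v. v \<in> verts T \<Longrightarrow> v \<noteq> rroot T \<Longrightarrow> q v \<in> verts T \<and> e v = Suc (e (q v))"
    "edges T = (\<lambda>v. {v, q v}) ` (verts T - {rroot T})" using q unfolding rooted_tree_def by auto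
  \<comment> \<open>The second tree, rooted at its right root, is hung by the added edge below the
    left root of the first.\<close>
  define par where "par v = (if even v then 2 * p (v div 2)
    else if v div 2 = rroot T then 2 * lroot S else 2 * q (v div 2) + 1)" for v
  define dep where "dep v = (if even v then d (v div 2)
    else Suc (d (lroot S)) + e (v div 2) - e (rroot T))" for v
  \<comment> \<open>\<open>rooted_tree\<close> leaves the depth of the root open, hence the offset
    \<open>e (rroot T)\<close> in \<open>dep\<close>; this bound makes the subtraction on
    \<open>nat\<close> exact.\<close>
  have ge: "e (rroot T) \<le> e v" if "v \<in> verts T" for v
    using that
  proof (induction "e v" arbitrary: v rule: less_induct)
    case less
    show ?case
    proof (cases "v = rroot T")
      case False
      then have "q v \<in> verts T" "e v = Suc (e (q v))" using q'(1) less.prems by auto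
      then show ?thesis using less.hyps[of "q v"] by simp
    qed simp
  qed
  let ?J = "join_bitree S T"
  have V: "verts ?J - {lroot ?J} = (\<lambda>v. 2 * v) ` (verts S - {lroot S}) \<union>
      ((\<lambda>v. 2 * v + 1) ` (verts T - {rroot T}) \<union> {2 * rroot T + 1})"
  proof -
    have odd: "2 * lroot S \<noteq> Suc (2 * v)" "Suc (2 * v) \<noteq> 2 * lroot S" for v by presburger+
    show ?thesis using rS rT odd unfolding join_bitree_def by (auto simp: image_iff)
  qed
  have E: "edges ?J = (\<lambda>v. {v, par v}) ` (verts ?J - {lroot ?J})"
  proof -
    have "(\<lambda>v. {v, par v}) ` (\<lambda>v. 2 * v + 1) ` (verts T - {rroot T}) =
        (\<lambda>v. {2 * v + 1, 2 * q v + 1}) ` (verts T - {rroot T})"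
      unfolding image_image by (intro image_cong) (auto simp: par_def)
    then show ?thesis unfolding V image_Un unfolding join_bitree_def p'(2) q'(2)
      by (simp add: image_image par_def insert_commute Un_assoc)
  qed
  moreover have "par v \<in> verts ?J \<and> dep v = Suc (dep (par v))" if "v \<in> verts ?J - {lroot ?J}" for v
    using that unfolding V
  proof (elim UnE imageE)
    fix z assume "v = 2 * z" "z \<in> verts S - {lroot S}"
    then show ?thesis using p'(1)[of z] by (auto simp: par_def dep_def join_bitree_def)
  next
    fix z assume z: "v = 2 * z + 1" "z \<in> verts T - {rroot T}"
    then show ?thesis using q'(1)[of z] ge[of "q z"]
      by (auto simp: par_def dep_def join_bitree_def)
  next
    assume "v \<in> {2 * rroot T + 1}"
    then show ?thesis using rS by (auto simp: par_def dep_def join_bitree_def)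
  qed
  moreover have "lroot ?J \<in> verts ?J" using rS by (simp add: join_bitree_def)
  ultimately have "rooted_tree (verts ?J) (edges ?J) (lroot ?J) par dep"
    unfolding rooted_tree_def by blast
  then show ?thesis
    using birootedD(1)[OF S] birootedD(1)[OF T]
    by (intro birooted_treeI[where r="lroot ?J" and par=par and d=dep])
      (simp_all add: join_bitree_def)
qed

lemma birooted_swap_roots: "birooted_tree T \<Longrightarrow> birooted_tree (swap_roots T)"
  unfolding birooted_tree_def swap_roots_def by (simp add: insert_commute)

lemma reduced_swap_roots: "reduced T \<Longrightarrow> reduced (swap_roots T)"
  unfolding reduced_iff nonessential_thorn_def thorn_def foldable_def swap_roots_def
  by (simp; blast)

definition two_coloring :: "'a bitree \<Rightarrow> (nat \<Rightarrow> bool) \<Rightarrow> bool" where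
  "two_coloring T side \<longleftrightarrow> side (lroot T) \<and> (\<forall>u v. {u, v} \<in> edges T \<longrightarrow> side u \<noteq> side v)"

lemma ex_two_coloring:
  assumes "birooted_tree T"
  shows "\<exists>side. two_coloring T side"
proof -
  obtain par d where "rooted_tree (verts T) (edges T) (lroot T) par d"
    using birooted_rooting[OF assms birooted_roots(1)[OF assms]] by blast
  then have p: "\<And>v. v \<in> verts T \<Longrightarrow> v \<noteq> lroot T \<Longrightarrow> d v = Suc (d (par v))"
    "edges T = (\<lambda>v. {v, par v}) ` (verts T - {lroot T})" unfolding rooted_tree_def by auto
  have "even (d u + d (lroot T)) \<noteq> even (d v + d (lroot T))" if "{u, v} \<in> edges T" for u v
    using that p by (auto simp: doubleton_eq_iff)
  then show ?thesis
    unfolding two_coloring_def by (intro exI[of _ "\<lambda>v. even (d v + d (lroot T))"]) simp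
qed

section \<open>Isomorphisms\<close>

lemma bitree_iso_refl: "bitree_iso T T"
  unfolding bitree_iso_def by (rule exI[of _ id]) simp

lemma bitree_iso_sym:
  assumes "bitree_iso S T" "lroot S \<in> verts S" "rroot S \<in> verts S"
  shows "bitree_iso T S"
proof -
  obtain g where g: "bij_betw g (verts S) (verts T)"
    and ge: "\<And>u v. u \<in> verts S \<Longrightarrow> v \<in> verts S \<Longrightarrow> {g u, g v} \<in> edges T \<longleftrightarrow> {u, v} \<in> edges S"
    and gl: "\<And>u. u \<in> verts S \<Longrightarrow> lab T (g u) = lab S u"
    and gr: "g (lroot S) = lroot T" "g (rroot S) = rroot T"
    using assms(1) unfolding bitree_iso_def by blast
  define h where "h = inv_into (verts S) g"
  have gh: "g (h v) = v" "h v \<in> verts S" if "v \<in> verts T" for v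
    using g that unfolding h_def bij_betw_def by (auto simp: f_inv_into_f inv_into_into)
  have hg: "h (g v) = v" if "v \<in> verts S" for v
    using g that unfolding h_def bij_betw_def by simp
  have "bij_betw h (verts T) (verts S)" unfolding h_def by (rule bij_betw_inv_into[OF g])
  moreover have "{h u, h v} \<in> edges S \<longleftrightarrow> {u, v} \<in> edges T" if "u \<in> verts T" "v \<in> verts T" for u v
    using ge[of "h u" "h v"] gh that by simp
  moreover have "lab S (h u) = lab T u" if "u \<in> verts T" for u
    using gl[of "h u"] gh that by simp
  moreover have "h (lroot T) = lroot S" "h (rroot T) = rroot S" using gr hg assms(2,3) by metis+
  ultimately show ?thesis unfolding bitree_iso_def by blast
qed

lemma bitree_iso_trans:
  assumes "bitree_iso S T" "bitree_iso T U"
  shows "bitree_iso S U"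
proof -
  obtain f where f: "bij_betw f (verts S) (verts T)"
    and fe: "\<And>u v. u \<in> verts S \<Longrightarrow> v \<in> verts S \<Longrightarrow> {f u, f v} \<in> edges T \<longleftrightarrow> {u, v} \<in> edges S"
    and fl: "\<And>u. u \<in> verts S \<Longrightarrow> lab T (f u) = lab S u"
    and fr: "f (lroot S) = lroot T" "f (rroot S) = rroot T"
    using assms(1) unfolding bitree_iso_def by blast
  obtain g where g: "bij_betw g (verts T) (verts U)"
    and ge: "\<And>u v. u \<in> verts T \<Longrightarrow> v \<in> verts T \<Longrightarrow> {g u, g v} \<in> edges U \<longleftrightarrow> {u, v} \<in> edges T"
    and gl: "\<And>u. u \<in> verts T \<Longrightarrow> lab U (g u) = lab T u"
    and gr: "g (lroot T) = lroot U" "g (rroot T) = rroot U"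
    using assms(2) unfolding bitree_iso_def by blast
  have fv: "f v \<in> verts T" if "v \<in> verts S" for v using f that by (auto simp: bij_betw_def)
  show ?thesis unfolding bitree_iso_def
    by (rule exI[of _ "g \<circ> f"])
      (use bij_betw_trans[OF f g] fe ge fl gl fr gr fv in auto)
qed

lemma bitree_iso_labels:
  assumes "bitree_iso S T"
  shows "lab S ` verts S = lab T ` verts T"
proof -
  obtain f where "bij_betw f (verts S) (verts T)" "\<forall>u\<in>verts S. lab T (f u) = lab S u"
    using assms unfolding bitree_iso_def by blast
  then have "verts T = f ` verts S" "\<forall>u\<in>verts S. lab T (f u) = lab S u"
    by (auto simp: bij_betw_def)
  then show ?thesis by (auto simp: image_image)
qed

section \<open>Evaluation of trees in labelled graphs\<close>

text \<open>Read as a bipartite graph whose vertices carry labels, a saturated folded tree is one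
  in which every vertex labelled \<open>y\<close> has exactly one neighbour labelled \<open>y\<close>, and at most one
  neighbour of each other label. Labels need not be unique: \<open>D y\<close> collects the
  vertices on which \<open>y\<close> may be placed.\<close>

definition folded_graph :: "'g rel \<Rightarrow> ('a \<Rightarrow> 'g set) \<Rightarrow> bool" where
  "folded_graph E D \<longleftrightarrow> sym E \<and>
     (\<forall>y a b c. a \<in> D y \<longrightarrow> b \<in> D y \<longrightarrow> (a, c) \<in> E \<longrightarrow> (b, c) \<in> E \<longrightarrow> a = b) \<and>
     (\<forall>y. \<forall>a\<in>D y. \<exists>b\<in>D y. (a, b) \<in> E)"

definition placement :: "'g rel \<Rightarrow> ('a \<Rightarrow> 'g set) \<Rightarrow> 'a bitree \<Rightarrow> (nat \<Rightarrow> 'g) \<Rightarrow> bool" where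
  "placement E D T f \<longleftrightarrow> (\<forall>v\<in>verts T. f v \<in> D (lab T v)) \<and>
     (\<forall>u v. {u, v} \<in> edges T \<longrightarrow> (f u, f v) \<in> E)"

definition tree_rel :: "'g rel \<Rightarrow> ('a \<Rightarrow> 'g set) \<Rightarrow> 'a bitree \<Rightarrow> 'g rel" where
  "tree_rel E D T = {(f (lroot T), f (rroot T)) | f. placement E D T f}"

text \<open>In \<open>join_bitree\<close> only the left root of the first tree and the right root of
  the second remain roots; hence only a domain and a range enter.\<close>

definition rel_meet :: "('g \<times> 'h) set \<Rightarrow> ('g \<times> 'h) set \<Rightarrow> ('g \<times> 'h) set \<Rightarrow> ('g \<times> 'h) set" where
  "rel_meet E A B = {(a, d) \<in> E. a \<in> Domain A \<and> d \<in> Range B}"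

lemma folded_graphD:
  assumes "folded_graph E D"
  shows "(a, b) \<in> E \<Longrightarrow> (b, a) \<in> E"
    and "a \<in> D y \<Longrightarrow> b \<in> D y \<Longrightarrow> (a, c) \<in> E \<Longrightarrow> (b, c) \<in> E \<Longrightarrow> a = b"
    and "a \<in> D y \<Longrightarrow> \<exists>b\<in>D y. (a, b) \<in> E"
  using assms unfolding folded_graph_def sym_def by blast+

lemma placementD:
  assumes "placement E D T f"
  shows "v \<in> verts T \<Longrightarrow> f v \<in> D (lab T v)" "{u, v} \<in> edges T \<Longrightarrow> (f u, f v) \<in> E"
  using assms unfolding placement_def by auto

lemma placementI:
  assumes "\<And>v. v \<in> verts T \<Longrightarrow> f v \<in> D (lab T v)" "\<And>u v. {u, v} \<in> edges T \<Longrightarrow> (f u, f v) \<in> E"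
  shows "placement E D T f"
  using assms unfolding placement_def by auto

lemma tree_relI: "placement E D T f \<Longrightarrow> (f (lroot T), f (rroot T)) \<in> tree_rel E D T"
  unfolding tree_rel_def by blast

lemma tree_relE:
  assumes "p \<in> tree_rel E D T"
  obtains f where "placement E D T f" "p = (f (lroot T), f (rroot T))"
  using assms unfolding tree_rel_def by blast

text \<open>A placement of the smaller tree extends to the thorn because every vertex of
  \<open>D y\<close> has a neighbour in \<open>D y\<close>.\<close>

lemma tree_rel_delete_thorn:
  assumes G: "folded_graph E D" and T: "birooted_tree T" and a: "nonessential_thorn T a"
  shows "tree_rel E D (delete_vertex a T) = tree_rel E D T"
proof (intro equalityI subsetI)
  obtain b where b: "{e \<in> edges T. a \<in> e} = {{a, b}}" "lab T a = lab T b"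
    "a \<noteq> lroot T" "a \<noteq> rroot T" "a \<in> verts T"
    using a unfolding nonessential_thorn_def thorn_def by blast
  then have ab: "{a, b} \<in> edges T" by blast
  note bv = birooted_edge[OF T ab]
  fix p
  show "p \<in> tree_rel E D (delete_vertex a T)" if "p \<in> tree_rel E D T"
    using that
  proof (elim tree_relE)
    fix f assume f: "placement E D T f" "p = (f (lroot T), f (rroot T))"
    then have "placement E D (delete_vertex a T) f"
      unfolding placement_def delete_vertex_def by auto
    then show ?thesis using tree_relI f(2) by (fastforce simp: delete_vertex_def)
  qed
  show "p \<in> tree_rel E D T" if "p \<in> tree_rel E D (delete_vertex a T)"
    using that
  proof (elim tree_relE)
    fix f assume f: "placement E D (delete_vertex a T) f"
      "p = (f (lroot (delete_vertex a T)), f (rroot (delete_vertex a T)))"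
    have fv: "f v \<in> D (lab T v)" if "v \<in> verts T" "v \<noteq> a" for v
      using placementD(1)[OF f(1), of v] that by (simp add: delete_vertex_def)
    obtain c where c: "c \<in> D (lab T a)" "(f b, c) \<in> E"
      using folded_graphD(3)[OF G fv[OF bv(2)]] bv(3) b(2) by metis
    have "placement E D T (f(a := c))"
    proof (rule placementI)
      fix u v assume uv: "{u, v} \<in> edges T"
      show "((f(a := c)) u, (f(a := c)) v) \<in> E"
      proof (cases "a \<in> {u, v}")
        case True
        then have "{u, v} \<in> {e \<in> edges T. a \<in> e}" using uv by simp
        then have "{u, v} = {a, b}" unfolding b(1) by simp
        then show ?thesis using c(2) folded_graphD(1)[OF G] bv(3)
          by (auto simp: doubleton_eq_iff)
      next
        case False
        then show ?thesis using placementD(2)[OF f(1), of u v] uv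
          by (auto simp: delete_vertex_def)
      qed
    qed (use fv c in auto)
    then show ?thesis using tree_relI[of E D T "f(a := c)"] f(2) b(3,4)
      by (simp add: delete_vertex_def)
  qed
qed

text \<open>The images of \<open>u\<close> and \<open>v\<close> lie in the same \<open>D y\<close>
  and have a common neighbour, so every placement already identifies them.\<close>

lemma tree_rel_merge:
  assumes G: "folded_graph E D" and T: "birooted_tree T" and uv: "foldable T u v"
  shows "tree_rel E D (merge u v T) = tree_rel E D T"
proof (intro equalityI subsetI)
  obtain w where w: "{u, w} \<in> edges T" "{v, w} \<in> edges T"
    and uv': "u \<noteq> v" "lab T u = lab T v" "u \<in> verts T" "v \<in> verts T"
    using uv unfolding foldable_def by blast
  define g where "g = (\<lambda>z. if z = u then v else z)"
  have m: "merge u v T = T\<lparr>verts := g ` verts T, edges := (\<lambda>e. g ` e) ` edges T,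
       lroot := g (lroot T), rroot := g (rroot T)\<rparr>"
    unfolding merge_def Let_def g_def by simp
  fix p
  show "p \<in> tree_rel E D (merge u v T)" if "p \<in> tree_rel E D T"
    using that
  proof (elim tree_relE)
    fix f assume f: "placement E D T f" "p = (f (lroot T), f (rroot T))"
    have "f u = f v"
      using folded_graphD(2)[OF G, of "f u" "lab T v" "f v" "f w"] placementD[OF f(1)] w uv' by metis
    then have fg: "f (g z) = f z" for z by (simp add: g_def)
    have "placement E D (merge u v T) f"
    proof (rule placementI)
      fix z assume "z \<in> verts (merge u v T)"
      then have "z \<in> verts T" using uv' by (auto simp: m g_def)
      then show "f z \<in> D (lab (merge u v T) z)" using placementD(1)[OF f(1)] by (simp add: m)
    next
      fix x y assume "{x, y} \<in> edges (merge u v T)"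
      then obtain e where e: "e \<in> edges T" "{x, y} = g ` e" by (auto simp: m)
      obtain q r where "e = {q, r}" using birooted_edgeE[OF T e(1)] by metis
      then have "(f q, f r) \<in> E" "{x, y} = {g q, g r}" using e placementD(2)[OF f(1)] by auto
      then show "(f x, f y) \<in> E"
        using fg folded_graphD(1)[OF G] by (auto simp: doubleton_eq_iff)
    qed
    then show ?thesis using tree_relI f(2) fg by (fastforce simp: m)
  qed
  show "p \<in> tree_rel E D T" if "p \<in> tree_rel E D (merge u v T)"
    using that
  proof (elim tree_relE)
    fix f assume f: "placement E D (merge u v T) f"
      "p = (f (lroot (merge u v T)), f (rroot (merge u v T)))"
    have "placement E D T (\<lambda>z. f (g z))"
    proof (rule placementI)
      fix z assume "z \<in> verts T"
      then have "f (g z) \<in> D (lab T (g z))" using placementD(1)[OF f(1), of "g z"] by (simp add: m)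
      then show "f (g z) \<in> D (lab T z)" using uv' by (auto simp: g_def split: if_splits)
    next
      fix x y assume "{x, y} \<in> edges T"
      then have "g ` {x, y} \<in> edges (merge u v T)"
        using imageI[of "{x, y}" "edges T" "\<lambda>e. g ` e"] by (simp add: m)
      then show "(f (g x), f (g y)) \<in> E" using placementD(2)[OF f(1), of "g x" "g y"] by simp
    qed
    then show ?thesis using tree_relI[of E D T "\<lambda>z. f (g z)"] f(2) by (simp add: m)
  qed
qed

lemma tree_rel_reduction:
  assumes "folded_graph E D" "birooted_tree S" "reduction S T"
  shows "tree_rel E D T = tree_rel E D S"
  using assms(3,1,2) by cases (auto simp: tree_rel_delete_thorn tree_rel_merge)

lemma tree_rel_reductions:
  assumes "reduction\<^sup>*\<^sup>* S T" "folded_graph E D" "birooted_tree S"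
  shows "tree_rel E D T = tree_rel E D S"
  using assms(1)
proof (induction rule: rtranclp_induct)
  case (step T U)
  then show ?case
    using tree_rel_reduction[OF assms(2) reductions_birooted[OF step(1) assms(3)] step(2)] by simp
qed simp

lemma tree_rel_iso_subset:
  assumes S: "birooted_tree S" and "bitree_iso S T"
  shows "tree_rel E D T \<subseteq> tree_rel E D S"
proof
  obtain g where g: "bij_betw g (verts S) (verts T)"
    and ge: "\<And>u v. u \<in> verts S \<Longrightarrow> v \<in> verts S \<Longrightarrow> {g u, g v} \<in> edges T \<longleftrightarrow> {u, v} \<in> edges S"
    and gl: "\<And>u. u \<in> verts S \<Longrightarrow> lab T (g u) = lab S u"
    and gr: "g (lroot S) = lroot T" "g (rroot S) = rroot T"
    using assms(2) unfolding bitree_iso_def by blast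
  have gv: "g v \<in> verts T" if "v \<in> verts S" for v using g that by (auto simp: bij_betw_def)
  fix p assume "p \<in> tree_rel E D T"
  then obtain f where f: "placement E D T f" "p = (f (lroot T), f (rroot T))"
    by (elim tree_relE)
  have "placement E D S (\<lambda>v. f (g v))"
  proof (rule placementI)
    fix v assume "v \<in> verts S"
    then show "f (g v) \<in> D (lab S v)" using placementD(1)[OF f(1), of "g v"] gl[of v] gv by simp
  next
    fix u v assume uv: "{u, v} \<in> edges S"
    then show "(f (g u), f (g v)) \<in> E"
      using placementD(2)[OF f(1), of "g u" "g v"] ge[of u v] birooted_edge[OF S uv] by simp
  qed
  from tree_relI[OF this] show "p \<in> tree_rel E D S" using f(2) gr by simp
qed

lemma tree_rel_iso:
  assumes "birooted_tree S" "birooted_tree T" "bitree_iso S T"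
  shows "tree_rel E D S = tree_rel E D T"
  using tree_rel_iso_subset assms bitree_iso_sym[OF assms(3) birooted_roots(1,2)[OF assms(1)]] by blast

text \<open>A placement of the joined tree is a pair of placements tied together only by the added
  edge.\<close>

lemma tree_rel_join_bitree:
  assumes S: "birooted_tree S" and T: "birooted_tree T" and "sym E"
  shows "tree_rel E D (join_bitree S T) = rel_meet E (tree_rel E D S) (tree_rel E D T)"
proof (intro equalityI subsetI)
  let ?J = "join_bitree S T"
  fix p assume "p \<in> tree_rel E D ?J"
  then obtain f where f: "placement E D ?J f" "p = (f (lroot ?J), f (rroot ?J))"
    by (elim tree_relE)
  have e: "(f u, f v) \<in> E" if "{u, v} \<in> edges ?J" for u v using placementD(2)[OF f(1) that] .
  have 1: "placement E D S (\<lambda>v. f (2 * v))"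
  proof (rule placementI)
    fix v assume "v \<in> verts S"
    then show "f (2 * v) \<in> D (lab S v)" using placementD(1)[OF f(1), of "2 * v"]
      by (simp add: join_bitree_def)
  next
    fix u v assume "{u, v} \<in> edges S"
    then have "(\<lambda>v. 2 * v) ` {u, v} \<in> edges ?J" by (simp only: join_bitree_def bitree.simps) blast
    then show "(f (2 * u), f (2 * v)) \<in> E" using e by simp
  qed
  have 2: "placement E D T (\<lambda>v. f (2 * v + 1))"
  proof (rule placementI)
    fix v assume "v \<in> verts T"
    then show "f (2 * v + 1) \<in> D (lab T v)" using placementD(1)[OF f(1), of "2 * v + 1"]
      by (simp add: join_bitree_def)
  next
    fix u v assume "{u, v} \<in> edges T"
    then have "(\<lambda>v. 2 * v + 1) ` {u, v} \<in> edges ?J"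
      by (simp only: join_bitree_def bitree.simps) blast
    then show "(f (2 * u + 1), f (2 * v + 1)) \<in> E" using e by simp
  qed
  have "{lroot ?J, rroot ?J} \<in> edges ?J" by (simp add: join_bitree_def)
  then have "p \<in> E" using e f(2) by simp
  then show "p \<in> rel_meet E (tree_rel E D S) (tree_rel E D T)"
    using tree_relI[OF 1] tree_relI[OF 2] f(2)
    unfolding rel_meet_def by (auto simp: join_bitree_def intro: DomainI RangeI)
next
  let ?J = "join_bitree S T"
  fix p assume "p \<in> rel_meet E (tree_rel E D S) (tree_rel E D T)"
  then obtain a b c d where p: "p = (a, d)" "(a, d) \<in> E" "(a, b) \<in> tree_rel E D S"
    "(c, d) \<in> tree_rel E D T" unfolding rel_meet_def by auto
  obtain f where f: "placement E D S f" "a = f (lroot S)" using p(3) by (auto elim: tree_relE)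
  obtain g where g: "placement E D T g" "d = g (rroot T)" using p(4) by (auto elim: tree_relE)
  define h where "h v = (if even v then f (v div 2) else g (v div 2))" for v
  have "placement E D ?J h"
  proof (rule placementI)
    fix v assume "v \<in> verts ?J"
    then show "h v \<in> D (lab ?J v)" using placementD(1)[OF f(1)] placementD(1)[OF g(1)]
      by (auto simp: join_bitree_def h_def)
  next
    fix u v assume uv: "{u, v} \<in> edges ?J"
    then consider e where "e \<in> edges S" "{u, v} = (\<lambda>v. 2 * v) ` e"
      | e where "e \<in> edges T" "{u, v} = (\<lambda>v. 2 * v + 1) ` e"
      | "{u, v} = {2 * lroot S, 2 * rroot T + 1}"
      by (auto simp: join_bitree_def)
    then show "(h u, h v) \<in> E"
    proof cases
      case 1
      then obtain q r where qr: "e = {q, r}" using birooted_edgeE[OF S] by metis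
      then have "(f q, f r) \<in> E" using 1(1) placementD(2)[OF f(1), of q r] by simp
      moreover from this have "(f r, f q) \<in> E" by (rule symD[OF assms(3)])
      ultimately show ?thesis using 1(2) qr
        by (auto simp: h_def doubleton_eq_iff)
    next
      case 2
      then obtain q r where qr: "e = {q, r}" using birooted_edgeE[OF T] by metis
      then have "(g q, g r) \<in> E" using 2(1) placementD(2)[OF g(1), of q r] by simp
      moreover from this have "(g r, g q) \<in> E" by (rule symD[OF assms(3)])
      ultimately show ?thesis using 2(2) qr
        by (auto simp: h_def doubleton_eq_iff)
    next
      case 3
      have "(d, a) \<in> E" using p(2) by (rule symD[OF assms(3)])
      then show ?thesis using 3 p(2) f(2) g(2)
        by (auto simp: h_def doubleton_eq_iff)
    qed
  qed
  from tree_relI[OF this] show "p \<in> tree_rel E D ?J"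
    using p(1) f(2) g(2) by (simp add: join_bitree_def h_def)
qed

lemma tree_rel_swap_roots: "tree_rel E D (swap_roots T) = (tree_rel E D T)\<inverse>"
  unfolding tree_rel_def placement_def swap_roots_def by auto

section \<open>Completeness of the evaluations\<close>

text \<open>The graph of a reduced tree with the missing thorns added: \<open>(v, True)\<close> is a thorn at \<open>v\<close>.\<close>

definition thornless :: "'a bitree \<Rightarrow> nat \<Rightarrow> bool" where
  "thornless T v \<longleftrightarrow> v \<in> verts T \<and> (\<forall>w. {v, w} \<in> edges T \<longrightarrow> lab T w \<noteq> lab T v)"

definition sat_rel :: "'a bitree \<Rightarrow> (nat \<times> bool) rel" where
  "sat_rel T = {((u, False), (v, False)) | u v. {u, v} \<in> edges T} \<union>
     {((v, False), (v, True)) | v. thornless T v} \<union> {((v, True), (v, False)) | v. thornless T v}"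

definition sat_lab :: "'a bitree \<Rightarrow> 'a \<Rightarrow> (nat \<times> bool) set" where
  "sat_lab T y = {(v, b). v \<in> verts T \<and> lab T v = y \<and> (b \<longrightarrow> thornless T v)}"

lemma reduced_fold:
  assumes "birooted_tree T" "reduced T" "{u, w} \<in> edges T" "{v, w} \<in> edges T" "lab T u = lab T v"
  shows "u = v"
  using assms birooted_edge[OF assms(1,3)] birooted_edge[OF assms(1,4)]
  unfolding reduced_iff foldable_def by blast

text \<open>Two equal labels around a vertex are excluded by reducedness, and a thorn is added only
  where no neighbour has the label of the vertex.\<close>

lemma folded_graph_sat:
  assumes T: "birooted_tree T" and red: "reduced T"
  shows "folded_graph (sat_rel T) (sat_lab T)"
proof -
  have "sym (sat_rel T)" by (auto simp: sym_def sat_rel_def insert_commute)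
  moreover have "a = b" if ab: "a \<in> sat_lab T y" "b \<in> sat_lab T y"
    "(a, c) \<in> sat_rel T" "(b, c) \<in> sat_rel T" for a b c y
  proof (cases "snd c")
    case True
    then show ?thesis using ab by (auto simp: sat_rel_def)
  next
    case False
    then obtain w where c: "c = (w, False)" by (metis prod.collapse)
    show ?thesis using ab reduced_fold[OF T red]
      unfolding c sat_rel_def sat_lab_def thornless_def
      by (auto simp: insert_commute)
  qed
  moreover have "\<exists>b\<in>sat_lab T y. (a, b) \<in> sat_rel T" if a: "a \<in> sat_lab T y" for a y
  proof (cases "snd a")
    case True
    then show ?thesis using a by (intro bexI[of _ "(fst a, False)"]) (auto simp: sat_lab_def sat_rel_def)
  next
    case False
    then obtain v where v: "a = (v, False)" by (metis prod.collapse)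
    show ?thesis
    proof (cases "thornless T v")
      case True
      then show ?thesis using a v
        by (intro bexI[of _ "(v, True)"]) (auto simp: sat_lab_def sat_rel_def)
    next
      case False
      then obtain w where w: "{v, w} \<in> edges T" "lab T w = lab T v"
        using a v by (auto simp: sat_lab_def thornless_def)
      then show ?thesis using a v birooted_edge[OF T w(1)]
        by (intro bexI[of _ "(w, False)"]) (auto simp: sat_lab_def sat_rel_def)
    qed
  qed
  ultimately show ?thesis unfolding folded_graph_def by blast
qed

section \<open>Homomorphisms between reduced trees\<close>

definition tree_hom :: "'a bitree \<Rightarrow> 'a bitree \<Rightarrow> (nat \<Rightarrow> nat) \<Rightarrow> bool" where
  "tree_hom S T f \<longleftrightarrow> f (lroot S) = lroot T \<and> f (rroot S) = rroot T \<and>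
     (\<forall>v\<in>verts S. f v \<in> verts T \<and> lab T (f v) = lab S v) \<and>
     (\<forall>u v. {u, v} \<in> edges S \<longrightarrow> {f u, f v} \<in> edges T)"

text \<open>All neighbours of a vertex sent to \<open>(v, True)\<close> go to
  \<open>(v, False)\<close> and thus carry its own label. Since \<open>S\<close> cannot be folded
  there is only one, so the vertex is a non-essential thorn of \<open>S\<close>, against
  reducedness.\<close>

lemma sat_placement_avoids_thorns:
  assumes S: "birooted_tree S" "reduced S" and f: "placement (sat_rel T) (sat_lab T) S f"
    and u: "u \<in> verts S" "u \<noteq> lroot S" "u \<noteq> rroot S"
  shows "\<not> snd (f u)"
proof
  assume "snd (f u)"
  then obtain v where v: "f u = (v, True)" by (metis prod.collapse)
  have lab: "lab S u = lab T v" using placementD(1)[OF f u(1)] v by (simp add: sat_lab_def)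
  have nb: "lab S w = lab S u" if "{u, w} \<in> edges S" for w
  proof -
    have "f w = (v, False)" using placementD(2)[OF f that] v by (auto simp: sat_rel_def)
    then show ?thesis using placementD(1)[OF f birooted_edge(2)[OF S(1) that]] lab
      by (simp add: sat_lab_def)
  qed
  have "\<exists>w. {u, w} \<in> edges S"
  proof (rule ccontr)
    assume no: "\<nexists>w. {u, w} \<in> edges S"
    have "u \<noteq> z" if "z \<in> verts S" for z
      using S(1) that
    proof (induction rule: birooted_induct)
      case root
      then show ?case using u(2) .
    next
      case (step w z)
      then show ?case using no by (metis insert_commute)
    qed
    then show False using u(1) by blast
  qed
  then obtain w where w: "{u, w} \<in> edges S" by blast
  have "e = {u, w}" if e: "e \<in> edges S" "u \<in> e" for e
  proof -
    obtain z where z: "e = {u, z}" using birooted_edgeE[OF S(1) e(1)] e(2) by blast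
    then have "z = w" using reduced_fold[OF S, of z u w] e(1) w nb by (simp add: insert_commute)
    then show ?thesis using z by simp
  qed
  then have "{e \<in> edges S. u \<in> e} = {{u, w}}" using w by blast
  then have "nonessential_thorn S u"
    unfolding nonessential_thorn_def thorn_def using u nb[OF w] by auto
  then show False using S(2) unfolding reduced_iff by blast
qed

text \<open>The identity placement of \<open>T\<close> contributes a pair of unsaturated roots; a
  placement of \<open>S\<close> with the same pair avoids all added thorns.\<close>

lemma tree_rel_imp_hom:
  assumes S: "birooted_tree S" "reduced S" and T: "birooted_tree T" "reduced T"
    and eq: "tree_rel (sat_rel T) (sat_lab T) S = tree_rel (sat_rel T) (sat_lab T) T"
  shows "\<exists>f. tree_hom S T f"
proof -
  have "placement (sat_rel T) (sat_lab T) T (\<lambda>v. (v, False))"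
    by (rule placementI) (auto simp: sat_rel_def sat_lab_def)
  then have "((lroot T, False), (rroot T, False)) \<in> tree_rel (sat_rel T) (sat_lab T) S"
    using tree_relI eq by fastforce
  then obtain f where f: "placement (sat_rel T) (sat_lab T) S f"
    "f (lroot S) = (lroot T, False)" "f (rroot S) = (rroot T, False)"
    by (auto elim: tree_relE)
  have nt: "\<not> snd (f u)" if "u \<in> verts S" for u
    using sat_placement_avoids_thorns[OF S f(1) that] f(2,3) by fastforce
  have "tree_hom S T (\<lambda>v. fst (f v))"
    unfolding tree_hom_def
  proof (intro conjI ballI allI impI)
    fix v assume v: "v \<in> verts S"
    show "fst (f v) \<in> verts T" "lab T (fst (f v)) = lab S v"
      using placementD(1)[OF f(1) v] by (auto simp: sat_lab_def)
  next
    fix u v assume uv: "{u, v} \<in> edges S"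
    show "{fst (f u), fst (f v)} \<in> edges T"
      using placementD(2)[OF f(1) uv] nt[OF birooted_edge(1)[OF S(1) uv]]
        nt[OF birooted_edge(2)[OF S(1) uv]] by (auto simp: sat_rel_def)
  qed (use f in auto)
  then show ?thesis by blast
qed

text \<open>Starting from the fixed left root, each edge forces the next vertex: it and its image
  are neighbours of one vertex and have equal labels.\<close>

lemma tree_hom_comp_id:
  assumes S: "birooted_tree S" "reduced S" and f: "tree_hom S T f" and g: "tree_hom T S g"
    and v: "v \<in> verts S"
  shows "g (f v) = v"
  using S(1) v
proof (induction rule: birooted_induct)
  case root
  then show ?case using f g unfolding tree_hom_def by simp
next
  case (step u v)
  have v: "v \<in> verts S" using birooted_edge[OF S(1) step(1)] by simp
  have "{g (f u), g (f v)} \<in> edges S" using f g step(1) unfolding tree_hom_def by blast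
  then have "{g (f v), u} \<in> edges S" using step(2) by (simp add: insert_commute)
  moreover have "{v, u} \<in> edges S" using step(1) by (simp add: insert_commute)
  moreover have "lab S (g (f v)) = lab S v" using f g v unfolding tree_hom_def by simp
  ultimately show ?case using reduced_fold[OF S] by blast
qed

lemma tree_homs_imp_iso:
  assumes S: "birooted_tree S" "reduced S" and T: "birooted_tree T" "reduced T"
    and f: "tree_hom S T f" and g: "tree_hom T S g"
  shows "bitree_iso S T"
proof -
  have gf: "g (f v) = v" if "v \<in> verts S" for v using tree_hom_comp_id[OF S f g that] .
  have fg: "f (g v) = v" if "v \<in> verts T" for v using tree_hom_comp_id[OF T g f that] .
  have "bij_betw f (verts S) (verts T)"
    by (rule bij_betw_byWitness[where f' = g]) (use f g gf fg in \<open>auto simp: tree_hom_def\<close>)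
  moreover have "{f u, f v} \<in> edges T \<longleftrightarrow> {u, v} \<in> edges S" if "u \<in> verts S" "v \<in> verts S" for u v
    using f g gf[OF that(1)] gf[OF that(2)] unfolding tree_hom_def by metis
  ultimately show ?thesis using f unfolding bitree_iso_def tree_hom_def by blast
qed

text \<open>Only the saturations of \<open>S\<close> and \<open>T\<close> are tested, which is why
  graphs on \<open>nat \<times> bool\<close> suffice.\<close>

theorem reduced_iso_if_tree_rel_eq:
  assumes S: "birooted_tree S" "reduced S" and T: "birooted_tree T" "reduced T"
    and eq: "\<And>(E :: (nat \<times> bool) rel) D. folded_graph E D \<Longrightarrow> tree_rel E D S = tree_rel E D T"
  shows "bitree_iso S T"
  using tree_homs_imp_iso[OF S T] tree_rel_imp_hom[OF S T eq[OF folded_graph_sat[OF T]]]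
    tree_rel_imp_hom[OF T S eq[OF folded_graph_sat[OF S], symmetric]] by blast

section \<open>Classes of trees\<close>

lemma iso_class_eq:
  assumes "birooted_tree S" "birooted_tree T" "bitree_iso S T"
  shows "iso_class S = iso_class T"
  using bitree_iso_trans assms bitree_iso_sym[OF assms(3)] birooted_roots(1,2)[OF assms(1)]
  unfolding iso_class_def by blast

lemma iso_class_self: "birooted_tree T \<Longrightarrow> T \<in> iso_class T"
  unfolding iso_class_def using bitree_iso_refl by blast

lemma iso_classD:
  assumes "S \<in> iso_class T"
  shows "birooted_tree S" "bitree_iso S T"
  using assms unfolding iso_class_def by auto

text \<open>Instead of confluence of the reductions: two reduced results evaluate alike in every
  graph, hence are isomorphic, and this is the uniqueness that \<open>THE\<close> asks for.\<close>

lemma reduced_form_ex: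
  assumes ne: "\<gamma> \<noteq> {}" and bt: "\<And>S. S \<in> \<gamma> \<Longrightarrow> birooted_tree S"
    and eq: "\<And>S T (E :: (nat \<times> bool) rel) D. S \<in> \<gamma> \<Longrightarrow> T \<in> \<gamma> \<Longrightarrow> folded_graph E D \<Longrightarrow>
      tree_rel E D S = tree_rel E D T"
  obtains S R where "S \<in> \<gamma>" "reduction\<^sup>*\<^sup>* S R" "reduced R" "birooted_tree R"
    "reduced_form \<gamma> = iso_class R"
proof -
  obtain S where S: "S \<in> \<gamma>" using ne by blast
  obtain R where R: "reduction\<^sup>*\<^sup>* S R" "reduced R" "birooted_tree R"
    using ex_reduced[OF bt[OF S]] by blast
  have "reduced_form \<gamma> = iso_class R"
    unfolding reduced_form_def
  proof (rule the_equality)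
    show "\<exists>S\<in>\<gamma>. \<exists>T. reduction\<^sup>*\<^sup>* S T \<and> reduced T \<and> iso_class R = iso_class T"
      using S R by blast
  next
    fix \<delta> assume "\<exists>S\<in>\<gamma>. \<exists>T. reduction\<^sup>*\<^sup>* S T \<and> reduced T \<and> \<delta> = iso_class T"
    then obtain S' R' where S': "S' \<in> \<gamma>" and R': "reduction\<^sup>*\<^sup>* S' R'" "reduced R'"
      and \<delta>: "\<delta> = iso_class R'" by blast
    have bR': "birooted_tree R'" using reductions_birooted[OF R'(1) bt[OF S']] .
    have "tree_rel E D R' = tree_rel E D R" if "folded_graph E D" for E :: "(nat \<times> bool) rel" and D
      using tree_rel_reductions[OF R'(1) that bt[OF S']] tree_rel_reductions[OF R(1) that bt[OF S]]
        eq[OF S' S that] by simp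
    then show "\<delta> = iso_class R"
      unfolding \<delta> by (intro iso_class_eq bR' R reduced_iso_if_tree_rel_eq R')
  qed
  then show thesis using that S R by blast
qed

text \<open>All trees of an isomorphism class evaluate alike; the union avoids choosing one of
  them.\<close>

definition class_rel :: "'g rel \<Rightarrow> ('a \<Rightarrow> 'g set) \<Rightarrow> 'a bitree_class \<Rightarrow> 'g rel" where
  "class_rel E D \<gamma> = (\<Union>T\<in>\<gamma>. tree_rel E D T)"

lemma class_rel_iso_class:
  assumes "birooted_tree T"
  shows "class_rel E D (iso_class T) = tree_rel E D T"
  using iso_class_self[OF assms] tree_rel_iso[OF iso_classD(1) assms iso_classD(2)]
  unfolding class_rel_def by blast

lemma free_pslE:
  assumes "\<gamma> \<in> free_psl X"
  obtains T where "birooted_tree T" "reduced T" "lab T ` verts T \<subseteq> X" "\<gamma> = iso_class T"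
  using assms unfolding free_psl_def by blast

lemma free_pslI:
  assumes "birooted_tree T" "reduced T" "lab T ` verts T \<subseteq> X"
  shows "iso_class T \<in> free_psl X"
  using assms unfolding free_psl_def by blast

text \<open>This turns equations in the free pseudosemilattice into computations with
  relations.\<close>

lemma class_rel_complete:
  assumes "\<gamma> \<in> free_psl X" "\<delta> \<in> free_psl X"
    and eq: "\<And>(E :: (nat \<times> bool) rel) D. folded_graph E D \<Longrightarrow> class_rel E D \<gamma> = class_rel E D \<delta>"
  shows "\<gamma> = \<delta>"
proof -
  obtain S where S: "birooted_tree S" "reduced S" "\<gamma> = iso_class S" using free_pslE[OF assms(1)] .
  obtain T where T: "birooted_tree T" "reduced T" "\<delta> = iso_class T" using free_pslE[OF assms(2)] .
  have "bitree_iso S T"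
    by (rule reduced_iso_if_tree_rel_eq)
      (use S T eq in \<open>simp_all add: class_rel_iso_class\<close>)
  then show ?thesis using iso_class_eq S T by blast
qed

lemma join_birooted_labels:
  assumes "\<alpha> \<in> free_psl X" "\<beta> \<in> free_psl X" "U \<in> join \<alpha> \<beta>"
  shows "birooted_tree U" "lab U ` verts U \<subseteq> X"
    "sym E \<Longrightarrow> tree_rel E D U = rel_meet E (class_rel E D \<alpha>) (class_rel E D \<beta>)"
proof -
  obtain S0 where S0: "birooted_tree S0" "lab S0 ` verts S0 \<subseteq> X" "\<alpha> = iso_class S0"
    using free_pslE[OF assms(1)] by metis
  obtain T0 where T0: "birooted_tree T0" "lab T0 ` verts T0 \<subseteq> X" "\<beta> = iso_class T0"
    using free_pslE[OF assms(2)] by metis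
  obtain S T where ST: "S \<in> \<alpha>" "T \<in> \<beta>" "U \<in> iso_class (join_bitree S T)"
    using assms(3) unfolding join_def by blast
  have S: "birooted_tree S" "bitree_iso S S0" using iso_classD ST(1) S0(3) by blast+
  have T: "birooted_tree T" "bitree_iso T T0" using iso_classD ST(2) T0(3) by blast+
  note J = birooted_join_bitree[OF S(1) T(1)]
  show U: "birooted_tree U" using iso_classD ST(3) by blast
  have "lab U ` verts U = lab (join_bitree S T) ` verts (join_bitree S T)"
    using bitree_iso_labels iso_classD(2)[OF ST(3)] .
  also have "\<dots> = lab S ` verts S \<union> lab T ` verts T"
    unfolding join_bitree_def bitree.simps image_Un image_image by simp
  finally show "lab U ` verts U \<subseteq> X" using bitree_iso_labels[OF S(2)] bitree_iso_labels[OF T(2)] S0 T0 by simp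
  show "tree_rel E D U = rel_meet E (class_rel E D \<alpha>) (class_rel E D \<beta>)" if "sym E"
    using tree_rel_iso[OF U J iso_classD(2)[OF ST(3)], of E D]
      tree_rel_join_bitree[OF S(1) T(1) that, of D]
      class_rel_iso_class[OF S0(1), of E D] class_rel_iso_class[OF T0(1), of E D]
      tree_rel_iso[OF S(1) S0(1) S(2), of E D] tree_rel_iso[OF T(1) T0(1) T(2), of E D]
      S0(3) T0(3) by simp
qed

lemma meet_ex:
  assumes "\<alpha> \<in> free_psl X" "\<beta> \<in> free_psl X"
  obtains U R where "U \<in> join \<alpha> \<beta>" "reduction\<^sup>*\<^sup>* U R" "reduced R" "birooted_tree R"
    "meet \<alpha> \<beta> = iso_class R"
proof -
  note J = join_birooted_labels[OF assms]
  have ne: "join \<alpha> \<beta> \<noteq> {}"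
  proof -
    obtain S where S: "birooted_tree S" "\<alpha> = iso_class S" using free_pslE[OF assms(1)] .
    obtain T where T: "birooted_tree T" "\<beta> = iso_class T" using free_pslE[OF assms(2)] .
    show ?thesis unfolding join_def
      using S T iso_class_self birooted_join_bitree by blast
  qed
  show thesis
  proof (rule reduced_form_ex[OF ne J(1)])
    show "tree_rel E D S = tree_rel E D T" if "S \<in> join \<alpha> \<beta>" "T \<in> join \<alpha> \<beta>" "folded_graph E D"
      for S T and E :: "(nat \<times> bool) rel" and D
    proof -
      have "sym E" using that(3) unfolding folded_graph_def by blast
      then show ?thesis using J(3)[OF that(1), of E D] J(3)[OF that(2), of E D] by simp
    qed
  qed (use that in \<open>auto simp: meet_def\<close>)
qed

lemma meet_in_free_psl:
  assumes "\<alpha> \<in> free_psl X" "\<beta> \<in> free_psl X"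
  shows "meet \<alpha> \<beta> \<in> free_psl X"
proof -
  obtain U R where U: "U \<in> join \<alpha> \<beta>" and R: "reduction\<^sup>*\<^sup>* U R" "reduced R" "birooted_tree R"
    "meet \<alpha> \<beta> = iso_class R" using meet_ex[OF assms] .
  then show ?thesis
    using free_pslI[of R X] join_birooted_labels(2)[OF assms U] reductions_labels[OF R(1)] by auto
qed

lemma class_rel_meet:
  assumes "folded_graph E D" "\<alpha> \<in> free_psl X" "\<beta> \<in> free_psl X"
  shows "class_rel E D (meet \<alpha> \<beta>) = rel_meet E (class_rel E D \<alpha>) (class_rel E D \<beta>)"
proof -
  obtain U R where U: "U \<in> join \<alpha> \<beta>" and R: "reduction\<^sup>*\<^sup>* U R" "reduced R" "birooted_tree R"
    "meet \<alpha> \<beta> = iso_class R" using meet_ex[OF assms(2,3)] .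
  show ?thesis
    using class_rel_iso_class[OF R(3), of E D]
      tree_rel_reductions[OF R(1) assms(1) join_birooted_labels(1)[OF assms(2,3) U]]
      join_birooted_labels(3)[OF assms(2,3) U, of E D] assms(1) R(4)
    unfolding folded_graph_def by simp
qed

section \<open>Relational morphisms and words\<close>

text \<open>Nothing is demanded of letters, so composition with endomorphisms is possible;
  \<open>E\<close> may be asymmetric, so that it can lead from left vertices to right vertices
  only.\<close>

definition rel_morphism :: "'a set \<Rightarrow> 'g rel \<Rightarrow> ('a bitree_class \<Rightarrow> 'g rel) \<Rightarrow> bool" where
  "rel_morphism X E h \<longleftrightarrow>
     (\<forall>\<alpha>\<in>free_psl X. \<forall>\<beta>\<in>free_psl X. h (meet \<alpha> \<beta>) = rel_meet E (h \<alpha>) (h \<beta>))"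

text \<open>Both orders of the roots are treated at once: \<open>s\<close> tells from which root a
  pair is read.\<close>

definition orient :: "bool \<Rightarrow> 'g rel \<Rightarrow> 'g rel" where
  "orient s R = (if s then R else R\<inverse>)"

definition side_meet :: "bool \<Rightarrow> 'a bitree_class \<Rightarrow> 'a bitree_class \<Rightarrow> 'a bitree_class" where
  "side_meet s \<alpha> \<beta> = (if s then meet \<alpha> \<beta> else meet \<beta> \<alpha>)"

definition letter :: "'a \<Rightarrow> 'a bitree_class" where
  "letter y = iso_class \<lparr>verts = {0, 1}, edges = {{0, 1}}, lab = (\<lambda>_. y), lroot = 0, rroot = 1\<rparr>"

text \<open>The product changes side at each letter: with \<open>True\<close>, the letters
  \<open>a b c d\<close> give \<open>a \<and> ((c \<and> d) \<and> b)\<close>, where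
  \<open>\<and>\<close> stands for \<open>meet\<close>. Unless labels fold, this is the path
  \<open>a b c d\<close> rooted at its first edge. The value at the empty word is a default.\<close>

fun word :: "bool \<Rightarrow> 'a list \<Rightarrow> 'a bitree_class" where
  "word s [] = {}"
| "word s [y] = letter y"
| "word s (y # z # ys) = side_meet s (letter y) (word (\<not> s) (z # ys))"

lemma rel_morphism_class_rel: "folded_graph E D \<Longrightarrow> rel_morphism X E (class_rel E D)"
  unfolding rel_morphism_def using class_rel_meet by blast

lemma Range_orient: "Range (orient s R) = Domain (orient (\<not> s) R)"
  by (simp add: orient_def)

lemma orient_Not: "orient (\<not> s) R = (orient s R)\<inverse>"
  by (simp add: orient_def)

lemma orient_sym: "sym E \<Longrightarrow> orient s E = E"
  by (auto simp: orient_def sym_def)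

lemma orient_eq_iff: "orient s A = orient s B \<longleftrightarrow> A = B"
  by (auto simp: orient_def)

lemma Domain_rel_meet: "Domain (rel_meet E A B) = {a \<in> Domain A. \<exists>d\<in>Range B. (a, d) \<in> E}"
  unfolding rel_meet_def by auto

lemma side_meet_in_free_psl:
  "\<alpha> \<in> free_psl X \<Longrightarrow> \<beta> \<in> free_psl X \<Longrightarrow> side_meet s \<alpha> \<beta> \<in> free_psl X"
  by (simp add: side_meet_def meet_in_free_psl)

lemma orient_side_meet:
  assumes "rel_morphism X E h" "\<alpha> \<in> free_psl X" "\<beta> \<in> free_psl X"
  shows "orient s (h (side_meet s \<alpha> \<beta>)) =
    rel_meet (orient s E) (orient s (h \<alpha>)) (orient s (h \<beta>))"
proof -
  have "h (meet \<alpha> \<beta>) = rel_meet E (h \<alpha>) (h \<beta>)" "h (meet \<beta> \<alpha>) = rel_meet E (h \<beta>) (h \<alpha>)"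
    using assms unfolding rel_morphism_def by blast+
  then show ?thesis by (auto simp: orient_def side_meet_def rel_meet_def)
qed

lemma edge_tree:
  fixes y :: 'a
  defines "T \<equiv> \<lparr>verts = {0, 1}, edges = {{0, 1}}, lab = (\<lambda>_. y), lroot = 0, rroot = 1\<rparr> :: 'a bitree"
  shows "birooted_tree T" "reduced T" "sym E \<Longrightarrow> tree_rel E D T = {(a, b) \<in> E. a \<in> D y \<and> b \<in> D y}"
proof -
  have "rooted_tree {0, 1} {{0, 1}} 0 (\<lambda>_. 0) (\<lambda>v. v)"
    unfolding rooted_tree_def by auto
  then show "birooted_tree T"
    by (intro birooted_treeI[where r=0 and par="\<lambda>_. 0" and d="\<lambda>v. v"]) (auto simp: T_def)
  show "reduced T"
    unfolding reduced_iff T_def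
    by (auto simp: nonessential_thorn_def thorn_def foldable_def doubleton_eq_iff)
  show "tree_rel E D T = {(a, b) \<in> E. a \<in> D y \<and> b \<in> D y}" if "sym E"
  proof (intro equalityI subsetI)
    fix p assume "p \<in> tree_rel E D T"
    then show "p \<in> {(a, b) \<in> E. a \<in> D y \<and> b \<in> D y}"
      by (auto simp: tree_rel_def placement_def T_def)
  next
    fix p assume "p \<in> {(a, b) \<in> E. a \<in> D y \<and> b \<in> D y}"
    then obtain a b where p: "p = (a, b)" "(a, b) \<in> E" "a \<in> D y" "b \<in> D y" by blast
    have "(b, a) \<in> E" using that p(2) by (rule symD)
    then have "placement E D T ((\<lambda>_. b)(0 := a))"
      using p by (intro placementI) (auto simp: T_def doubleton_eq_iff)
    from tree_relI[OF this] show "p \<in> tree_rel E D T" using p(1) by (simp add: T_def)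
  qed
qed

lemma letter_in_free_psl: "y \<in> X \<Longrightarrow> letter y \<in> free_psl X"
  unfolding letter_def by (rule free_pslI[OF edge_tree(1,2)]) simp

lemma class_rel_letter: "sym E \<Longrightarrow> class_rel E D (letter y) = {(a, b) \<in> E. a \<in> D y \<and> b \<in> D y}"
  unfolding letter_def class_rel_iso_class[OF edge_tree(1)] by (rule edge_tree(3))

lemma Domain_class_rel_letter:
  assumes "folded_graph E D"
  shows "Domain (orient s (class_rel E D (letter y))) = D y"
proof -
  have "sym E" using assms unfolding folded_graph_def by blast
  then have "class_rel E D (letter y) = {(a, b) \<in> E. a \<in> D y \<and> b \<in> D y}"
    by (rule class_rel_letter)
  then show ?thesis
    using folded_graphD(1,3)[OF assms] by (auto simp: orient_def) blast+
qed

lemma word_in_free_psl: "ys \<noteq> [] \<Longrightarrow> set ys \<subseteq> X \<Longrightarrow> word s ys \<in> free_psl X"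
  by (induction s ys rule: word.induct)
    (simp_all add: letter_in_free_psl side_meet_in_free_psl)

text \<open>Position \<open>q\<close> is a left vertex iff \<open>even q = s\<close>. Multiplication
  by a letter keeps only one end of the relation of the letter, hence the domains.\<close>

definition word_walk ::
  "'g rel \<Rightarrow> ('a bitree_class \<Rightarrow> 'g rel) \<Rightarrow> bool \<Rightarrow> 'a list \<Rightarrow> (nat \<Rightarrow> 'g) \<Rightarrow> bool" where
  "word_walk E h s ys f \<longleftrightarrow>
     (\<forall>q<length ys. f q \<in> Domain (orient (even q = s) (h (letter (ys ! q))))) \<and>
     (\<forall>q. Suc q < length ys \<longrightarrow> (f q, f (Suc q)) \<in> orient (even q = s) E)"

lemma word_walk_Cons:
  "word_walk E h s (y # z # ys) f \<longleftrightarrow> f 0 \<in> Domain (orient s (h (letter y))) \<and>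
     (f 0, f 1) \<in> orient s E \<and> word_walk E h (\<not> s) (z # ys) (\<lambda>q. f (Suc q))"
proof -
  have "(even (Suc q) = s) = (even q = (\<not> s))" for q by auto
  then show ?thesis
    unfolding word_walk_def list.size add_Suc_right add_0_right Suc_less_eq All_less_Suc2
    by auto
qed

lemma word_walk_case_nat:
  "word_walk E h s (y # z # ys) (case_nat a f) \<longleftrightarrow> a \<in> Domain (orient s (h (letter y))) \<and>
     (a, f 0) \<in> orient s E \<and> word_walk E h (\<not> s) (z # ys) f"
  by (simp add: word_walk_Cons)

text \<open>The recursion of \<open>word\<close> switches sides, and a range on one side is a domain
  on the other; \<open>case_nat\<close> prolongs a walk at its front.\<close>

lemma Domain_word:
  assumes "rel_morphism X E h" "ys \<noteq> []" "set ys \<subseteq> X"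
  shows "Domain (orient s (h (word s ys))) = {f 0 | f. word_walk E h s ys f}"
  using assms(2,3)
proof (induction s ys rule: word.induct)
  case (2 s y)
  have "a \<in> {f 0 | f. word_walk E h s [y] f}" if "a \<in> Domain (orient s (h (letter y)))" for a
    using that by (auto simp: word_walk_def intro!: exI[of _ "\<lambda>_. a"])
  then show ?case by (auto simp: word_walk_def)
next
  case (3 s y z ys)
  have "orient s (h (word s (y # z # ys))) =
      rel_meet (orient s E) (orient s (h (letter y))) (orient s (h (word (\<not> s) (z # ys))))"
    using 3(3) by (simp add: orient_side_meet[OF assms(1)] letter_in_free_psl word_in_free_psl)
  then have "Domain (orient s (h (word s (y # z # ys)))) = {a \<in> Domain (orient s (h (letter y))).
      \<exists>d\<in>{f 0 | f. word_walk E h (\<not> s) (z # ys) f}. (a, d) \<in> orient s E}"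
    using 3 by (simp add: Domain_rel_meet Range_orient)
  also have "\<dots> = {f 0 | f. word_walk E h s (y # z # ys) f}"
  proof (intro equalityI subsetI)
    fix a assume "a \<in> {a \<in> Domain (orient s (h (letter y))).
      \<exists>d\<in>{f 0 | f. word_walk E h (\<not> s) (z # ys) f}. (a, d) \<in> orient s E}"
    then obtain f where "a \<in> Domain (orient s (h (letter y)))" "word_walk E h (\<not> s) (z # ys) f"
      "(a, f 0) \<in> orient s E" by blast
    then have "word_walk E h s (y # z # ys) (case_nat a f)" by (simp add: word_walk_case_nat)
    then show "a \<in> {f 0 | f. word_walk E h s (y # z # ys) f}"
      by (intro CollectI exI[of _ "case_nat a f"]) simp
  next
    fix a assume "a \<in> {f 0 | f. word_walk E h s (y # z # ys) f}"
    then obtain f where f: "a = f 0" "word_walk E h s (y # z # ys) f" by blast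
    then show "a \<in> {a \<in> Domain (orient s (h (letter y))).
      \<exists>d\<in>{f 0 | f. word_walk E h (\<not> s) (z # ys) f}. (a, d) \<in> orient s E}"
      by (fastforce simp: word_walk_Cons)
  qed
  finally show ?case .
qed simp

lemma orient_word:
  assumes "rel_morphism X E h" "set ys \<subseteq> X" "length ys \<ge> 2"
  shows "orient s (h (word s ys)) = {(f 0, f 1) | f. word_walk E h s ys f}"
proof -
  obtain y z zs where ys: "ys = y # z # zs"
    using assms(3) by (metis Suc_le_length_iff numeral_2_eq_2)
  have "orient s (h (word s ys)) =
      rel_meet (orient s E) (orient s (h (letter y))) (orient s (h (word (\<not> s) (z # zs))))"
    using assms(2) unfolding ys
    by (simp add: orient_side_meet[OF assms(1)] letter_in_free_psl word_in_free_psl)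
  also have "\<dots> = {(a, d) \<in> orient s E. a \<in> Domain (orient s (h (letter y))) \<and>
      d \<in> {f 0 | f. word_walk E h (\<not> s) (z # zs) f}}"
    unfolding rel_meet_def Range_orient using assms(2) unfolding ys
    by (subst Domain_word[OF assms(1)]) auto
  also have "\<dots> = {(f 0, f 1) | f. word_walk E h s ys f}"
  proof (intro equalityI subsetI)
    fix p assume "p \<in> {(a, d) \<in> orient s E. a \<in> Domain (orient s (h (letter y))) \<and>
      d \<in> {f 0 | f. word_walk E h (\<not> s) (z # zs) f}}"
    then obtain a f where "p = (a, f 0)" "a \<in> Domain (orient s (h (letter y)))"
      "word_walk E h (\<not> s) (z # zs) f" "(a, f 0) \<in> orient s E" by blast
    then have "word_walk E h s ys (case_nat a f)" "p = (case_nat a f 0, case_nat a f 1)"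
      unfolding ys by (simp_all add: word_walk_case_nat)
    then show "p \<in> {(f 0, f 1) | f. word_walk E h s ys f}" by blast
  next
    fix p assume "p \<in> {(f 0, f 1) | f. word_walk E h s ys f}"
    then show "p \<in> {(a, d) \<in> orient s E. a \<in> Domain (orient s (h (letter y))) \<and>
      d \<in> {f 0 | f. word_walk E h (\<not> s) (z # zs) f}}"
      unfolding ys by (fastforce simp: word_walk_Cons)
  qed
  finally show ?thesis .
qed

section \<open>Bipartite graphs\<close>

text \<open>\<open>folded_graph\<close> wants a symmetric relation and one placement of labels.
  Doubling the nodes makes room for an arbitrary relation from left to right vertices and for
  separate placements \<open>L\<close> and \<open>R\<close>.\<close>

definition bip_rel :: "'g rel \<Rightarrow> ('g \<times> bool) rel" where
  "bip_rel E = (\<lambda>(a, b). ((a, True), (b, False))) ` E \<union> (\<lambda>(a, b). ((b, False), (a, True))) ` E"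

definition bip_lab :: "('a \<Rightarrow> 'g set) \<Rightarrow> ('a \<Rightarrow> 'g set) \<Rightarrow> 'a \<Rightarrow> ('g \<times> bool) set" where
  "bip_lab L R y = L y \<times> {True} \<union> R y \<times> {False}"

definition bip_proj :: "('g \<times> bool) rel \<Rightarrow> 'g rel" where
  "bip_proj P = {(a, b). ((a, True), (b, False)) \<in> P}"

lemma bip_rel_simps [simp]:
  "((a, True), (b, False)) \<in> bip_rel E \<longleftrightarrow> (a, b) \<in> E"
  "((b, False), (a, True)) \<in> bip_rel E \<longleftrightarrow> (a, b) \<in> E"
  "((a, s), (b, s)) \<notin> bip_rel E"
  by (auto simp: bip_rel_def)

lemma bip_relE:
  assumes "(p, q) \<in> bip_rel E"
  obtains a b where "p = (a, True)" "q = (b, False)" "(a, b) \<in> E"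
    | a b where "p = (b, False)" "q = (a, True)" "(a, b) \<in> E"
  using assms unfolding bip_rel_def by auto

lemma bip_lab_simps [simp]:
  "(a, True) \<in> bip_lab L R y \<longleftrightarrow> a \<in> L y"
  "(a, False) \<in> bip_lab L R y \<longleftrightarrow> a \<in> R y"
  by (auto simp: bip_lab_def)

lemma folded_graph_bip:
  assumes "\<And>y a b c. a \<in> L y \<Longrightarrow> b \<in> L y \<Longrightarrow> (a, c) \<in> E \<Longrightarrow> (b, c) \<in> E \<Longrightarrow> a = b"
    and "\<And>y a b c. a \<in> R y \<Longrightarrow> b \<in> R y \<Longrightarrow> (c, a) \<in> E \<Longrightarrow> (c, b) \<in> E \<Longrightarrow> a = b"
    and "\<And>y a. a \<in> L y \<Longrightarrow> \<exists>b\<in>R y. (a, b) \<in> E"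
    and "\<And>y a. a \<in> R y \<Longrightarrow> \<exists>b\<in>L y. (b, a) \<in> E"
  shows "folded_graph (bip_rel E) (bip_lab L R)"
  unfolding folded_graph_def
proof (intro conjI allI impI ballI)
  show "sym (bip_rel E)" by (auto simp: sym_def elim!: bip_relE)
next
  fix y a b c
  assume "a \<in> bip_lab L R y" "b \<in> bip_lab L R y" "(a, c) \<in> bip_rel E" "(b, c) \<in> bip_rel E"
  then show "a = b" using assms(1,2) by (elim bip_relE) auto
next
  fix y a assume a: "a \<in> bip_lab L R y"
  obtain a' s where s: "a = (a', s)" by (cases a)
  show "\<exists>b\<in>bip_lab L R y. (a, b) \<in> bip_rel E"
  proof (cases s)
    case True
    then obtain b where "b \<in> R y" "(a', b) \<in> E" using a s assms(3) by auto
    then show ?thesis using s True by (intro bexI[of _ "(b, False)"]) simp_all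
  next
    case False
    then obtain b where "b \<in> L y" "(b, a') \<in> E" using a s assms(4) by auto
    then show ?thesis using s False by (intro bexI[of _ "(b, True)"]) simp_all
  qed
qed

lemma class_rel_subset:
  assumes "\<gamma> \<in> free_psl X"
  shows "class_rel E D \<gamma> \<subseteq> E"
proof -
  obtain T where T: "birooted_tree T" "\<gamma> = iso_class T" using free_pslE[OF assms] .
  show ?thesis unfolding T(2) class_rel_iso_class[OF T(1)]
    using birootedD(3)[OF T(1)] by (auto elim!: tree_relE dest: placementD(2))
qed

text \<open>An edge starting in a left copy ends in a right copy, so \<open>bip_proj\<close> loses
  no pair that puts a left copy into the domain of \<open>A\<close> or a right copy into the range
  of \<open>B\<close>.\<close>

lemma bip_proj_rel_meet:
  assumes "A \<subseteq> bip_rel E" "B \<subseteq> bip_rel E"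
  shows "bip_proj (rel_meet (bip_rel E) A B) = rel_meet E (bip_proj A) (bip_proj B)"
proof -
  have "(a, True) \<in> Domain A \<longleftrightarrow> a \<in> Domain (bip_proj A)" for a
    using assms(1) by (fastforce simp: bip_proj_def elim: bip_relE)
  moreover have "(d, False) \<in> Range B \<longleftrightarrow> d \<in> Range (bip_proj B)" for d
    using assms(2) by (fastforce simp: bip_proj_def elim: bip_relE)
  ultimately show ?thesis by (auto simp: rel_meet_def bip_proj_def)
qed

lemma rel_morphism_bip:
  assumes "folded_graph (bip_rel E) (bip_lab L R)"
  shows "rel_morphism X E (\<lambda>\<gamma>. bip_proj (class_rel (bip_rel E) (bip_lab L R) \<gamma>))"
  unfolding rel_morphism_def
  using class_rel_meet[OF assms] bip_proj_rel_meet class_rel_subset by metis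

section \<open>Substituting products of two letters\<close>

text \<open>Each letter \<open>y\<close> is replaced by the edge with left label \<open>l y\<close> and right label \<open>r y\<close>:
  every vertex acquires a new neighbour.\<close>

definition subst_tree ::
  "('a \<Rightarrow> 'a) \<Rightarrow> ('a \<Rightarrow> 'a) \<Rightarrow> (nat \<Rightarrow> bool) \<Rightarrow> 'a bitree \<Rightarrow> 'a bitree" where
  "subst_tree l r side T =
     \<lparr>verts = (\<lambda>v. 2 * v) ` verts T \<union> (\<lambda>v. 2 * v + 1) ` verts T,
      edges = (\<lambda>e. (\<lambda>v. 2 * v) ` e) ` edges T \<union> (\<lambda>v. {2 * v, 2 * v + 1}) ` verts T,
      lab = (\<lambda>v. (if even v = side (v div 2) then l else r) (lab T (v div 2))),
      lroot = 2 * lroot T,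
      rroot = 2 * rroot T\<rparr>"

lemma birooted_subst_tree:
  assumes T: "birooted_tree T"
  shows "birooted_tree (subst_tree l r side T)"
proof -
  let ?J = "subst_tree l r side T"
  note rT = birooted_roots[OF T]
  obtain p d where p: "rooted_tree (verts T) (edges T) (lroot T) p d"
    using birooted_rooting[OF T rT(1)] by blast
  have p': "\<And>v. v \<in> verts T \<Longrightarrow> v \<noteq> lroot T \<Longrightarrow> p v \<in> verts T \<and> d v = Suc (d (p v))"
    "edges T = (\<lambda>v. {v, p v}) ` (verts T - {lroot T})" using p unfolding rooted_tree_def by auto
  define par where "par v = (if even v then 2 * p (v div 2) else v - 1)" for v
  define dep where "dep v = (if even v then d (v div 2) else Suc (d (v div 2)))" for v
  have V: "verts ?J - {lroot ?J} = (\<lambda>v. 2 * v) ` (verts T - {lroot T}) \<union> (\<lambda>v. 2 * v + 1) ` verts T"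
  proof -
    have odd: "2 * lroot T \<noteq> Suc (2 * v)" "Suc (2 * v) \<noteq> 2 * lroot T" for v by presburger+
    show ?thesis using rT odd unfolding subst_tree_def by (auto simp: image_iff)
  qed
  have "edges ?J = (\<lambda>v. {v, par v}) ` (verts ?J - {lroot ?J})"
    unfolding V image_Un unfolding subst_tree_def p'(2)
    by (simp add: image_image par_def insert_commute)
  moreover have "par v \<in> verts ?J \<and> dep v = Suc (dep (par v))" if "v \<in> verts ?J - {lroot ?J}" for v
    using that unfolding V
  proof (elim UnE imageE)
    fix z assume "v = 2 * z" "z \<in> verts T - {lroot T}"
    then show ?thesis using p'(1)[of z] by (auto simp: par_def dep_def subst_tree_def)
  next
    fix z assume "v = 2 * z + 1" "z \<in> verts T"
    then show ?thesis by (auto simp: par_def dep_def subst_tree_def)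
  qed
  moreover have "lroot ?J \<in> verts ?J" using rT by (simp add: subst_tree_def)
  ultimately have "rooted_tree (verts ?J) (edges ?J) (lroot ?J) par dep"
    unfolding rooted_tree_def by blast
  moreover have "(\<lambda>v. 2 * v) ` {lroot T, rroot T} \<in> edges ?J"
    unfolding subst_tree_def using birootedD(3)[OF T] by (simp only: bitree.simps) blast
  ultimately show ?thesis
    using birootedD(1)[OF T]
    by (intro birooted_treeI[where r="lroot ?J" and par=par and d=dep])
      (simp_all add: subst_tree_def)
qed

context
  fixes E :: "'g rel" and D :: "'a \<Rightarrow> 'g set" and l r :: "'a \<Rightarrow> 'a"
  assumes G: "folded_graph E D"
begin

text \<open>The places of a left vertex that leave room for its new neighbour, whose place is then
  unique by folding.\<close>

definition subst_left :: "'a \<Rightarrow> 'g set" where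
  "subst_left y = {a \<in> D (l y). \<exists>b\<in>D (r y). (a, b) \<in> E}"

definition subst_right :: "'a \<Rightarrow> 'g set" where
  "subst_right y = {b \<in> D (r y). \<exists>a\<in>D (l y). (a, b) \<in> E}"

lemma folded_graph_subst: "folded_graph (bip_rel E) (bip_lab subst_left subst_right)"
proof (rule folded_graph_bip)
  fix y a b c
  show "a = b" if "a \<in> subst_left y" "b \<in> subst_left y" "(a, c) \<in> E" "(b, c) \<in> E"
    using that folded_graphD(2)[OF G] unfolding subst_left_def by blast
  show "a = b" if "a \<in> subst_right y" "b \<in> subst_right y" "(c, a) \<in> E" "(c, b) \<in> E"
    using that folded_graphD(1,2)[OF G] unfolding subst_right_def by blast
  show "\<exists>b\<in>subst_right y. (a, b) \<in> E" if "a \<in> subst_left y"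
    using that unfolding subst_left_def subst_right_def by blast
  show "\<exists>b\<in>subst_left y. (b, a) \<in> E" if "a \<in> subst_right y"
    using that unfolding subst_left_def subst_right_def by blast
qed

text \<open>Substituting in the tree amounts to changing the graph: the new neighbours are absorbed
  into the sets on which a vertex may be placed.\<close>

lemma tree_rel_subst:
  assumes T: "birooted_tree T" and side: "two_coloring T side"
  shows "tree_rel E D (subst_tree l r side T) =
    bip_proj (tree_rel (bip_rel E) (bip_lab subst_left subst_right) T)"
proof -
  let ?J = "subst_tree l r side T" and ?E = "bip_rel E" and ?D = "bip_lab subst_left subst_right"
  have sr: "side (lroot T)" "\<not> side (rroot T)" and se: "\<And>u v. {u, v} \<in> edges T \<Longrightarrow> side u \<noteq> side v"
    using side birootedD(3)[OF T] unfolding two_coloring_def by blast+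
  show ?thesis
  proof (intro equalityI subsetI)
    fix p assume "p \<in> tree_rel E D ?J"
    then obtain f where f: "placement E D ?J f" "p = (f (lroot ?J), f (rroot ?J))"
      by (elim tree_relE)
    have pend: "(f (2 * v), f (2 * v + 1)) \<in> E" if "v \<in> verts T" for v
      using placementD(2)[OF f(1), of "2 * v" "2 * v + 1"] that by (simp add: subst_tree_def)
    have lab: "f (2 * v) \<in> D ((if side v then l else r) (lab T v))"
      "f (2 * v + 1) \<in> D ((if side v then r else l) (lab T v))" if "v \<in> verts T" for v
      using placementD(1)[OF f(1), of "2 * v"] placementD(1)[OF f(1), of "2 * v + 1"] that
      by (auto simp: subst_tree_def)
    have "placement ?E ?D T (\<lambda>v. (f (2 * v), side v))"
    proof (rule placementI)
      fix v assume v: "v \<in> verts T"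
      show "(f (2 * v), side v) \<in> ?D (lab T v)"
        using lab[OF v] pend[OF v] folded_graphD(1)[OF G pend[OF v]]
        by (cases "side v") (auto simp: subst_left_def subst_right_def)
    next
      fix u v assume uv: "{u, v} \<in> edges T"
      then have "(\<lambda>v. 2 * v) ` {u, v} \<in> edges ?J"
        unfolding subst_tree_def by (simp only: bitree.simps) blast
      then have "(f (2 * u), f (2 * v)) \<in> E" using placementD(2)[OF f(1)] by simp
      then show "((f (2 * u), side u), (f (2 * v), side v)) \<in> ?E"
        using se[OF uv] folded_graphD(1)[OF G] by (cases "side u"; cases "side v") simp_all
    qed
    from tree_relI[OF this] show "p \<in> bip_proj (tree_rel ?E ?D T)"
      using f(2) sr by (simp add: bip_proj_def subst_tree_def)
  next
    fix p assume "p \<in> bip_proj (tree_rel ?E ?D T)"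
    then obtain a b f where p: "p = (a, b)" and f: "placement ?E ?D T f"
      "(a, True) = f (lroot T)" "(b, False) = f (rroot T)"
      unfolding bip_proj_def by (auto elim!: tree_relE)
    \<comment> \<open>The left root goes to a left copy, and every edge changes both the copy and
      the colour.\<close>
    have sf: "snd (f v) = side v" if "v \<in> verts T" for v
      using T that
    proof (induction rule: birooted_induct)
      case root
      then show ?case using f(2) sr(1) by (metis snd_conv)
    next
      case (step u v)
      then show ?case using placementD(2)[OF f(1) step(1)] se[OF step(1)]
        by (auto elim!: bip_relE)
    qed
    have "\<exists>c. c \<in> D ((if side v then r else l) (lab T v)) \<and> (fst (f v), c) \<in> E" if v: "v \<in> verts T" for v
    proof -
      have "(fst (f v), side v) \<in> ?D (lab T v)" using placementD(1)[OF f(1) v] sf[OF v]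
        by (cases "f v") (simp only: fst_conv snd_conv)
      then show ?thesis using folded_graphD(1)[OF G]
        by (cases "side v") (auto simp: subst_left_def subst_right_def)
    qed
    then obtain c where c: "\<And>v. v \<in> verts T \<Longrightarrow> c v \<in> D ((if side v then r else l) (lab T v))"
      "\<And>v. v \<in> verts T \<Longrightarrow> (fst (f v), c v) \<in> E" by metis
    define g where "g v = (if even v then fst (f (v div 2)) else c (v div 2))" for v
    have "placement E D ?J g"
    proof (rule placementI)
      fix v assume "v \<in> verts ?J"
      then obtain z where z: "z \<in> verts T" "v = 2 * z \<or> v = 2 * z + 1"
        by (auto simp: subst_tree_def)
      have "(fst (f z), side z) \<in> ?D (lab T z)" using placementD(1)[OF f(1) z(1)] sf[OF z(1)]
        by (cases "f z") (simp only: fst_conv snd_conv)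
      then have "fst (f z) \<in> D ((if side z then l else r) (lab T z))"
        by (cases "side z") (auto simp: subst_left_def subst_right_def)
      then show "g v \<in> D (lab ?J v)" using z c(1)[OF z(1)]
        by (auto simp: subst_tree_def g_def)
    next
      fix u v assume "{u, v} \<in> edges ?J"
      then consider e where "e \<in> edges T" "{u, v} = (\<lambda>v. 2 * v) ` e"
        | z where "z \<in> verts T" "{u, v} = {2 * z, 2 * z + 1}"
        by (auto simp: subst_tree_def)
      then show "(g u, g v) \<in> E"
      proof cases
        case 1
        then obtain y z where yz: "e = {y, z}" using birooted_edgeE[OF T] by metis
        then have *: "(f y, f z) \<in> ?E" using placementD(2)[OF f(1)] 1(1) by blast
        have "(fst (f y), fst (f z)) \<in> E \<and> (fst (f z), fst (f y)) \<in> E"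
          using * folded_graphD(1)[OF G] by (cases rule: bip_relE) auto
        then show ?thesis using 1(2) yz by (auto simp: g_def doubleton_eq_iff)
      next
        case 2
        have "(fst (f z), c z) \<in> E" "(c z, fst (f z)) \<in> E"
          using c(2)[OF 2(1)] folded_graphD(1)[OF G] by blast+
        then show ?thesis using 2(2) by (auto simp: g_def doubleton_eq_iff)
      qed
    qed
    moreover have "g (lroot ?J) = a" "g (rroot ?J) = b"
      using f(2,3)[symmetric] by (simp_all add: subst_tree_def g_def)
    ultimately show "p \<in> tree_rel E D ?J" using p tree_relI by fastforce
  qed
qed

end

text \<open>The representative, its colouring and the reduced result are chosen arbitrarily; by
  \<open>class_rel_subst_class\<close> the relations of the result do not depend on the
  choice.\<close>

definition subst_class :: "('a \<Rightarrow> 'a) \<Rightarrow> ('a \<Rightarrow> 'a) \<Rightarrow> 'a bitree_class \<Rightarrow> 'a bitree_class" where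
  "subst_class l r \<gamma> = iso_class (SOME R. \<exists>T side. \<gamma> = iso_class T \<and> birooted_tree T \<and>
     two_coloring T side \<and> reduction\<^sup>*\<^sup>* (subst_tree l r side T) R \<and> reduced R)"

lemma subst_classE:
  assumes "\<gamma> \<in> free_psl X"
  obtains R T side where "\<gamma> = iso_class T" "birooted_tree T" "two_coloring T side"
    "reduction\<^sup>*\<^sup>* (subst_tree l r side T) R" "reduced R" "subst_class l r \<gamma> = iso_class R"
proof -
  obtain T where T: "birooted_tree T" "\<gamma> = iso_class T" using free_pslE[OF assms] .
  obtain side where side: "two_coloring T side" using ex_two_coloring[OF T(1)] by blast
  obtain R where R: "reduction\<^sup>*\<^sup>* (subst_tree l r side T) R" "reduced R"
    using ex_reduced[OF birooted_subst_tree[OF T(1)]] by blast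
  let ?P = "\<lambda>R. \<exists>T side. \<gamma> = iso_class T \<and> birooted_tree T \<and>
     two_coloring T side \<and> reduction\<^sup>*\<^sup>* (subst_tree l r side T) R \<and> reduced R"
  have "?P (SOME R. ?P R)" by (rule someI[of ?P R]) (use T side R in blast)
  then show thesis using that unfolding subst_class_def by blast
qed

lemma iso_class_labels:
  assumes "iso_class T \<in> free_psl X" "birooted_tree T"
  shows "lab T ` verts T \<subseteq> X"
proof -
  obtain S where S: "birooted_tree S" "lab S ` verts S \<subseteq> X" "iso_class T = iso_class S"
    using free_pslE[OF assms(1)] by metis
  then have iso: "bitree_iso T S" using iso_class_self[OF assms(2)] iso_classD(2) by blast
  show ?thesis using bitree_iso_labels[OF iso] S(2) by simp
qed

lemma subst_class_in_free_psl:
  assumes "l ` X \<subseteq> X" "r ` X \<subseteq> X" "\<gamma> \<in> free_psl X"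
  shows "subst_class l r \<gamma> \<in> free_psl X"
proof -
  obtain R T side where R: "\<gamma> = iso_class T" "birooted_tree T"
    "reduction\<^sup>*\<^sup>* (subst_tree l r side T) R" "reduced R" "subst_class l r \<gamma> = iso_class R"
    using subst_classE[OF assms(3)] by metis
  have "lab T ` verts T \<subseteq> X" using iso_class_labels assms(3) R by blast
  then have "lab (subst_tree l r side T) ` verts (subst_tree l r side T) \<subseteq> X"
    using assms(1,2) by (auto simp: subst_tree_def image_subset_iff)
  then have "lab R ` verts R \<subseteq> X" using reductions_labels[OF R(3)] by auto
  then show ?thesis
    unfolding R(5) using R(4) reductions_birooted[OF R(3) birooted_subst_tree[OF R(2)]]
    by (intro free_pslI)
qed

lemma class_rel_subst_class:
  assumes G: "folded_graph E D" and "\<gamma> \<in> free_psl X"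
  shows "class_rel E D (subst_class l r \<gamma>) =
    bip_proj (class_rel (bip_rel E) (bip_lab (subst_left E D l r) (subst_right E D l r)) \<gamma>)"
proof -
  obtain R T side where R: "\<gamma> = iso_class T" "birooted_tree T" "two_coloring T side"
    "reduction\<^sup>*\<^sup>* (subst_tree l r side T) R" "reduced R" "subst_class l r \<gamma> = iso_class R"
    using subst_classE[OF assms(2)] by metis
  note J = birooted_subst_tree[OF R(2), of l r side]
  show ?thesis
    unfolding R(6) class_rel_iso_class[OF reductions_birooted[OF R(4) J]]
    unfolding R(1) class_rel_iso_class[OF R(2)] tree_rel_reductions[OF R(4) G J]
    by (rule tree_rel_subst[OF G R(2,3)])
qed

text \<open>Evaluating a substituted class is evaluating the original class in the changed graph,
  where \<open>meet\<close> becomes \<open>rel_meet\<close>; no product of substituted trees has to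
  be reduced.\<close>

lemma endomorphism_subst_class:
  assumes X: "l ` X \<subseteq> X" "r ` X \<subseteq> X"
  shows "endomorphism X (subst_class l r)"
  unfolding endomorphism_def
proof (intro conjI ballI)
  fix \<alpha> \<beta> assume ab: "\<alpha> \<in> free_psl X" "\<beta> \<in> free_psl X"
  note S = subst_class_in_free_psl[OF X]
  show "subst_class l r (meet \<alpha> \<beta>) = meet (subst_class l r \<alpha>) (subst_class l r \<beta>)"
  proof (rule class_rel_complete[OF S[OF meet_in_free_psl[OF ab]] meet_in_free_psl[OF S[OF ab(1)] S[OF ab(2)]]])
    fix E :: "(nat \<times> bool) rel" and D
    assume G: "folded_graph E (D :: 'a \<Rightarrow> _)"
    show "class_rel E D (subst_class l r (meet \<alpha> \<beta>)) =
        class_rel E D (meet (subst_class l r \<alpha>) (subst_class l r \<beta>))"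
      using rel_morphism_bip[OF folded_graph_subst[OF G], of X l r] ab
      unfolding class_rel_meet[OF G S[OF ab(1)] S[OF ab(2)]] rel_morphism_def
        class_rel_subst_class[OF G ab(1)] class_rel_subst_class[OF G ab(2)]
        class_rel_subst_class[OF G meet_in_free_psl[OF ab]] by blast
  qed
qed (use subst_class_in_free_psl[OF X] in blast)

lemma subst_class_letter:
  assumes X: "l ` X \<subseteq> X" "r ` X \<subseteq> X" and y: "y \<in> X"
  shows "subst_class l r (letter y) = meet (letter (l y)) (letter (r y))"
proof (rule class_rel_complete)
  have L: "letter (l y) \<in> free_psl X" "letter (r y) \<in> free_psl X"
    using X y by (auto intro!: letter_in_free_psl)
  then show "meet (letter (l y)) (letter (r y)) \<in> free_psl X" by (rule meet_in_free_psl)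
  show "subst_class l r (letter y) \<in> free_psl X"
    by (intro subst_class_in_free_psl X letter_in_free_psl y)
  fix E :: "(nat \<times> bool) rel" and D
  assume G: "folded_graph E (D :: 'a \<Rightarrow> _)"
  have s: "sym (bip_rel E)" using folded_graph_subst[OF G] unfolding folded_graph_def by blast
  have "class_rel E D (subst_class l r (letter y)) = {(a, b) \<in> E. a \<in> D (l y) \<and> b \<in> D (r y)}"
    unfolding class_rel_subst_class[OF G letter_in_free_psl[OF y]] class_rel_letter[OF s]
    by (auto simp: bip_proj_def subst_left_def[OF G] subst_right_def[OF G])
  also have "\<dots> = class_rel E D (meet (letter (l y)) (letter (r y)))"
    using Domain_class_rel_letter[OF G, of True "l y"] Domain_class_rel_letter[OF G, of False "r y"]
    unfolding class_rel_meet[OF G L] rel_meet_def by (simp add: orient_def)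
  finally show "class_rel E D (subst_class l r (letter y)) =
    class_rel E D (meet (letter (l y)) (letter (r y)))" .
qed

section \<open>Consequences\<close>

lemma consequenceI:
  assumes "\<And>\<rho>. fully_invariant_congruence X \<rho> \<Longrightarrow> \<tau> \<in> \<rho> \<Longrightarrow> \<sigma> \<in> \<rho>"
  shows "consequence X \<sigma> \<tau>"
  using assms unfolding consequence_def generated_fic_def by blast

lemma congruence_side_meet:
  assumes "congruence X \<rho>" "(\<alpha>, \<alpha>') \<in> \<rho>" "\<beta> \<in> free_psl X"
  shows "(side_meet s \<alpha> \<beta>, side_meet s \<alpha>' \<beta>) \<in> \<rho>"
proof -
  have "(\<beta>, \<beta>) \<in> \<rho>" using assms(1,3) unfolding congruence_def equiv_def refl_on_def by blast
  then show ?thesis using assms(1,2) unfolding congruence_def side_meet_def by simp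
qed

text \<open>The identities valid under all relational morphisms into \<open>E\<close> with values in
  \<open>K\<close> form a fully invariant congruence. It contains the pair
  \<open>(\<gamma>, \<delta>)\<close>, and the single morphism \<open>h\<close> keeps
  \<open>(\<alpha>, \<beta>)\<close> out.\<close>

lemma not_consequenceI:
  fixes E :: "'g rel"
  assumes free: "\<gamma> \<in> free_psl X" "\<delta> \<in> free_psl X"
    and h: "rel_morphism X E h" "h ` free_psl X \<subseteq> K" "h \<alpha> \<noteq> h \<beta>"
    and eq: "\<And>h. rel_morphism X E h \<Longrightarrow> h ` free_psl X \<subseteq> K \<Longrightarrow> h \<gamma> = h \<delta>"
  shows "\<not> consequence X (\<alpha>, \<beta>) (\<gamma>, \<delta>)"
proof
  define \<rho> where "\<rho> = {(\<epsilon>, \<zeta>). \<epsilon> \<in> free_psl X \<and> \<zeta> \<in> free_psl X \<and>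
    (\<forall>h. rel_morphism X E h \<longrightarrow> h ` free_psl X \<subseteq> K \<longrightarrow> h \<epsilon> = h \<zeta>)}"
  have "equiv (free_psl X) \<rho>"
    unfolding equiv_def refl_on_def sym_def trans_def \<rho>_def by auto
  moreover have "(meet \<epsilon> \<zeta>, meet \<epsilon>' \<zeta>') \<in> \<rho>" if "(\<epsilon>, \<epsilon>') \<in> \<rho>" "(\<zeta>, \<zeta>') \<in> \<rho>" for \<epsilon> \<epsilon>' \<zeta> \<zeta>'
  proof -
    have f: "\<epsilon> \<in> free_psl X" "\<epsilon>' \<in> free_psl X" "\<zeta> \<in> free_psl X" "\<zeta>' \<in> free_psl X"
      using that unfolding \<rho>_def by simp_all
    have "h (meet \<epsilon> \<zeta>) = h (meet \<epsilon>' \<zeta>')" if "rel_morphism X E h" "h ` free_psl X \<subseteq> K" for h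
    proof -
      have "h \<epsilon> = h \<epsilon>'" "h \<zeta> = h \<zeta>'"
        using that \<open>(\<epsilon>, \<epsilon>') \<in> \<rho>\<close> \<open>(\<zeta>, \<zeta>') \<in> \<rho>\<close> unfolding \<rho>_def by simp_all
      then show ?thesis using that(1) f unfolding rel_morphism_def by simp
    qed
    then show ?thesis unfolding \<rho>_def using f by (simp add: meet_in_free_psl)
  qed
  ultimately have cong: "congruence X \<rho>" unfolding congruence_def by blast
  have "(\<phi> \<epsilon>, \<phi> \<zeta>) \<in> \<rho>" if "endomorphism X \<phi>" "(\<epsilon>, \<zeta>) \<in> \<rho>" for \<phi> \<epsilon> \<zeta>
  proof -
    have ez: "\<epsilon> \<in> free_psl X" "\<zeta> \<in> free_psl X" using that(2) unfolding \<rho>_def by auto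
    have "h (\<phi> \<epsilon>) = h (\<phi> \<zeta>)" if "rel_morphism X E h" "h ` free_psl X \<subseteq> K" for h
    proof -
      have "rel_morphism X E (h \<circ> \<phi>)" "(h \<circ> \<phi>) ` free_psl X \<subseteq> K"
        using that \<open>endomorphism X \<phi>\<close> unfolding rel_morphism_def endomorphism_def image_subset_iff
        by simp_all
      then have "(h \<circ> \<phi>) \<epsilon> = (h \<circ> \<phi>) \<zeta>" using \<open>(\<epsilon>, \<zeta>) \<in> \<rho>\<close> unfolding \<rho>_def by blast
      then show ?thesis by simp
    qed
    then show ?thesis using ez that(1) unfolding \<rho>_def endomorphism_def by blast
  qed
  then have "fully_invariant_congruence X \<rho>"
    using cong unfolding fully_invariant_congruence_def by blast
  moreover have "(\<gamma>, \<delta>) \<in> \<rho>" using free eq unfolding \<rho>_def by blast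
  moreover assume "consequence X (\<alpha>, \<beta>) (\<gamma>, \<delta>)"
  ultimately have "(\<alpha>, \<beta>) \<in> \<rho>" unfolding consequence_def generated_fic_def by blast
  then show False using h unfolding \<rho>_def by blast
qed

section \<open>Periodic walks on the integers\<close>

lemma unit_steps_bound:
  fixes g :: "nat \<Rightarrow> int"
  assumes "\<And>q. Suc q < m \<Longrightarrow> \<bar>g (Suc q) - g q\<bar> \<le> 1" "p \<le> q" "q < m"
  shows "\<bar>g q - g p\<bar> \<le> int (q - p)"
  using assms(2,3)
proof (induction q rule: dec_induct)
  case (step q)
  then show ?case using assms(1)[of q] by (simp add: Suc_diff_le)
qed simp

text \<open>Steps of size 0 must be allowed, because a path vertex and its thorn will share a node.
  They are ruled out once the walk has moved by a full period.\<close>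

lemma periodic_walk_straight:
  fixes g :: "nat \<Rightarrow> int"
  assumes steps: "\<And>q. Suc q < m \<Longrightarrow> \<bar>g (Suc q) - g q\<bar> \<le> 1"
    and period: "\<And>q. q + N < m \<Longrightarrow> int N dvd g (q + N) - g q"
    and N: "3 \<le> N" "N < m" and moved: "g N \<noteq> g 0"
  shows "(\<forall>q<m. g q = g 0 + int q) \<or> (\<forall>q<m. g q = g 0 - int q)"
proof -
  obtain e where e: "g N - g 0 = int N * e" using period[of 0] N(2) by (auto elim: dvdE)
  have "int N * \<bar>e\<bar> \<le> int N"
    using unit_steps_bound[of m g 0 N, OF steps] N e by (simp add: abs_mult)
  then have "\<bar>e\<bar> \<le> 1" using N(1) by (simp add: mult_le_cancel_left1)
  then have e1: "e = 1 \<or> e = -1" using e moved by (cases "e = 0") auto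
  then have ee: "e * e = 1" "\<bar>e\<bar> = 1" by auto
  \<comment> \<open>Measured from the start in the direction of motion, the walk gets from 0 to
    \<open>N\<close> in \<open>N\<close> steps of size at most 1, so each of them advances by
    1.\<close>
  define f where "f q = e * (g q - g 0)" for q
  have fN: "f N = int N" "f 0 = 0" using e ee by (auto simp: f_def)
  have fd: "f p - f q = e * (g p - g q)" for p q by (simp add: f_def algebra_simps)
  have fsteps: "\<bar>f (Suc q) - f q\<bar> \<le> 1" if "Suc q < m" for q
    using steps[OF that] ee(2) by (simp add: fd abs_mult)
  have "f q = int q" if "q < m" for q
    using that
  proof (induction q rule: less_induct)
    case (less q)
    show ?case
    proof (cases "q \<le> N")
      case True
      then show ?thesis
        using unit_steps_bound[of m f 0 q, OF fsteps] unit_steps_bound[of m f q N, OF fsteps]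
          fN N less.prems by (simp add: of_nat_diff)
    next
      case False
      then obtain r where r: "q = Suc r" "N \<le> r" by (cases q) auto
      have fr: "f r = int r" "f (q - N) = int (q - N)" using less r N by auto
      have "int N dvd f q - f (q - N)"
        using period[of "q - N"] less.prems False unfolding fd by simp
      then have "int N dvd f q - int q + int N" using fr(2) False by (simp add: of_nat_diff algebra_simps)
      then have "int N dvd f q - int q" by (simp add: dvd_add_left_iff)
      \<comment> \<open>One step from \<open>f r = r\<close> leaves \<open>f q\<close> within
        distance 2 of \<open>q\<close>; this is where \<open>3 \<le> N\<close> enters.\<close>
      moreover have "\<bar>f q - int q\<bar> < int N" using fsteps[of r] less.prems fr(1) r(1) N(1) by simp
      ultimately show ?thesis using zdvd_not_zless[of "\<bar>f q - int q\<bar>" "int N"] by fastforce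
    qed
  qed
  then have "e * (e * (g q - g 0)) = e * int q" if "q < m" for q using that by (simp add: f_def)
  then have "g q - g 0 = e * int q" if "q < m" for q using that ee(1) by (simp add: mult.assoc[symmetric])
  then show ?thesis using e1 by fastforce
qed

section \<open>The paths\<close>

locale cyclic_labels =
  fixes X :: "'a set" and x :: "nat \<Rightarrow> 'a" and n :: nat
  assumes inj: "inj_on x {1..}" and letters: "x ` {1..} \<subseteq> X" and n: "2 \<le> n"
begin

text \<open>Positions on the paths are counted from 0 here, from 1 in the trees.\<close>

definition cyc :: "nat \<Rightarrow> 'a" where
  "cyc q = x (q mod (2 * n) + 1)"

definition labels :: "nat \<Rightarrow> 'a list" where
  "labels m = map cyc [0..<m]"

definition path_tree :: "nat \<Rightarrow> 'a bitree" where
  "path_tree m = \<lparr>verts = {1..m}, edges = {{p, p + 1} | p. 1 \<le> p \<and> p < m},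
     lab = (\<lambda>p. cyc (p - 1)), lroot = 1, rroot = 2\<rparr>"

definition ext_path_tree :: "nat \<Rightarrow> 'a bitree" where
  "ext_path_tree m = (path_tree m)\<lparr>verts := insert 0 {1..m},
     edges := insert {0, 1} {{p, p + 1} | p. 1 \<le> p \<and> p < m},
     lab := (\<lambda>p. cyc (p - 1))(0 := cyc (2 * n - 1))\<rparr>"

text \<open>The parameter \<open>s\<close> tells whether the first vertex of the path is the left root.\<close>

definition path_class :: "bool \<Rightarrow> nat \<Rightarrow> 'a bitree_class" where
  "path_class s m = iso_class (if s then path_tree m else swap_roots (path_tree m))"

definition ext_path_class :: "bool \<Rightarrow> nat \<Rightarrow> 'a bitree_class" where
  "ext_path_class s m = iso_class (if s then ext_path_tree m else swap_roots (ext_path_tree m))"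

lemma cyc_eq_iff: "cyc p = cyc q \<longleftrightarrow> p mod (2 * n) = q mod (2 * n)"
  using inj_onD[OF inj, of "p mod (2 * n) + 1" "q mod (2 * n) + 1"] unfolding cyc_def by auto

lemma cyc_eq_iff_dvd: "cyc p = cyc q \<longleftrightarrow> int (2 * n) dvd int p - int q"
  unfolding cyc_eq_iff by (metis mod_eq_dvd_iff of_nat_eq_iff zmod_int)

lemma cyc_neq: "p < q \<Longrightarrow> q < p + 2 * n \<Longrightarrow> cyc p \<noteq> cyc q"
  unfolding cyc_eq_iff_dvd using zdvd_not_zless[of "int q - int p" "int (2 * n)"]
  by (auto simp: dvd_diff_commute)

lemma cyc_in: "cyc q \<in> X"
  using letters unfolding cyc_def by auto

lemma cyc_periodic: "cyc (q + 2 * n) = cyc q"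
  by (simp add: cyc_eq_iff)

lemma length_labels [simp]: "length (labels m) = m"
  by (simp add: labels_def)

lemma nth_labels [simp]: "q < m \<Longrightarrow> labels m ! q = cyc q"
  by (simp add: labels_def)

lemma set_labels: "set (labels m) \<subseteq> X"
  using cyc_in by (auto simp: labels_def)

lemma alpha_eq: "alpha x n k i = path_class True (2 * n * k + i)"
  "alpha_star x n k i = path_class False (2 * n * k + i)"
  by (simp_all add: alpha_def alpha_star_def path_class_def alpha_tree_def path_tree_def cyc_def)

lemma beta_eq: "beta x n k i = ext_path_class True (2 * n * k + i)"
  "beta_star x n k i = ext_path_class False (2 * n * k + i)"
proof -
  have "beta_tree x n k i = ext_path_tree (2 * n * k + i)"
    using n by (simp add: beta_tree_def ext_path_tree_def alpha_tree_def path_tree_def cyc_def Let_def)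
  then show "beta x n k i = ext_path_class True (2 * n * k + i)"
    "beta_star x n k i = ext_path_class False (2 * n * k + i)"
    by (simp_all add: beta_def beta_star_def ext_path_class_def)
qed

section \<open>The paths as reduced trees\<close>

lemma birooted_path_tree:
  assumes "2 \<le> m"
  shows "birooted_tree (path_tree m)"
proof (rule birooted_treeI[where r=1 and par="\<lambda>p. p - 1" and d="\<lambda>p. p"])
  have "{{p, p + 1} | p. 1 \<le> p \<and> p < m} = (\<lambda>p. {p, p - 1}) ` ({1..m} - {1})"
  proof (intro equalityI subsetI)
    fix e assume "e \<in> {{p, p + 1} | p. 1 \<le> p \<and> p < m}"
    then obtain p where "e = {p, p + 1}" "1 \<le> p" "p < m" by blast
    then show "e \<in> (\<lambda>p. {p, p - 1}) ` ({1..m} - {1})"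
      by (intro image_eqI[of _ _ "p + 1"]) auto
  next
    fix e assume "e \<in> (\<lambda>p. {p, p - 1}) ` ({1..m} - {1})"
    then obtain p where p: "e = {p, p - 1}" "p \<in> {1..m}" "p \<noteq> 1" by blast
    then have "e = {p - 1, p - 1 + 1}" "1 \<le> p - 1" "p - 1 < m" by auto
    then show "e \<in> {{p, p + 1} | p. 1 \<le> p \<and> p < m}" by blast
  qed
  then show "rooted_tree (verts (path_tree m)) (edges (path_tree m)) 1 (\<lambda>p. p - 1) (\<lambda>p. p)"
    using assms unfolding rooted_tree_def path_tree_def by auto
  show "{lroot (path_tree m), rroot (path_tree m)} \<in> edges (path_tree m)"
    using assms unfolding path_tree_def by force
qed (simp add: path_tree_def)

lemma birooted_ext_path_tree:
  assumes "2 \<le> m"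
  shows "birooted_tree (ext_path_tree m)"
proof -
  obtain par d where "rooted_tree (verts (path_tree m)) (edges (path_tree m)) 1 par d"
    using birooted_rooting[OF birooted_path_tree[OF assms], of 1] assms
    by (auto simp: path_tree_def)
  then have p: "\<And>v. v \<in> {1..m} \<Longrightarrow> v \<noteq> 1 \<Longrightarrow> par v \<in> {1..m} \<and> d v = Suc (d (par v))"
    "edges (path_tree m) = (\<lambda>v. {v, par v}) ` ({1..m} - {1})"
    unfolding rooted_tree_def path_tree_def by auto
  let ?par = "par(0 := 1)" and ?d = "d(0 := Suc (d 1))"
  have "insert 0 {1..m} - {1} = insert 0 ({1..m} - {1})" by auto
  then have "insert {0, 1} (edges (path_tree m)) = (\<lambda>v. {v, ?par v}) ` (insert 0 {1..m} - {1})"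
    unfolding p(2) by auto
  moreover have "?par v \<in> insert 0 {1..m} \<and> ?d v = Suc (?d (?par v))"
    if "v \<in> insert 0 {1..m} - {1}" for v
    using p(1)[of v] that assms by auto
  ultimately have "rooted_tree (insert 0 {1..m}) (insert {0, 1} (edges (path_tree m))) 1 ?par ?d"
    unfolding rooted_tree_def using assms by simp
  moreover have "{1, 2} \<in> edges (path_tree m)"
    using birootedD(3)[OF birooted_path_tree[OF assms]] by (simp add: path_tree_def)
  ultimately show ?thesis
    by (intro birooted_treeI[where r=1 and par="?par" and d="?d"])
      (simp_all add: ext_path_tree_def path_tree_def)
qed

text \<open>Labels of vertices at distance 1 or 2 differ because \<open>2 * n \<ge> 4\<close>, so
  there is neither a thorn nor a fold. Adding \<open>2 * n - 1\<close> stands for subtracting 1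
  modulo \<open>2 * n\<close>; this also covers the extra vertex 0, where subtraction on
  \<open>nat\<close> would be cut off.\<close>

lemma reduced_if_path_like:
  assumes edge: "\<And>e. e \<in> edges T \<Longrightarrow> \<exists>p. e = {p, p + 1}"
    and lab: "\<And>v. v \<in> verts T \<Longrightarrow> lab T v = cyc (v + (2 * n - 1))"
    and T: "birooted_tree T"
  shows "reduced T"
  unfolding reduced_iff
proof (intro conjI allI notI)
  have nb: "v = w + 1 \<or> w = v + 1" if "{v, w} \<in> edges T" for v w
    using edge[OF that] by (auto simp: doubleton_eq_iff)
  have lab_eq: "v = w" if "v \<in> verts T" "w \<in> verts T" "lab T v = lab T w" "v < w + 3" "w < v + 3" for v w
  proof -
    have c: "cyc (v + (2 * n - 1)) = cyc (w + (2 * n - 1))" using that lab by metis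
    have "\<not> v < w"
    proof
      assume "v < w"
      then have "v + (2 * n - 1) < w + (2 * n - 1)" "w + (2 * n - 1) < v + (2 * n - 1) + 2 * n"
        using that n by linarith+
      then show False using cyc_neq c by blast
    qed
    moreover have "\<not> w < v"
    proof
      assume "w < v"
      then have "w + (2 * n - 1) < v + (2 * n - 1)" "v + (2 * n - 1) < w + (2 * n - 1) + 2 * n"
        using that n by linarith+
      then show False using cyc_neq c by metis
    qed
    ultimately show ?thesis by simp
  qed
  show False if "nonessential_thorn T a" for a
  proof -
    obtain b where b: "{e \<in> edges T. a \<in> e} = {{a, b}}" "lab T a = lab T b"
      using \<open>nonessential_thorn T a\<close> unfolding nonessential_thorn_def thorn_def by blast
    then have ab: "{a, b} \<in> edges T" by blast
    then show False using lab_eq[of a b] b(2) nb[OF ab] birooted_edge[OF T ab] by auto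
  qed
  show False if "foldable T u v" for u v
  proof -
    obtain w where w: "{u, w} \<in> edges T" "{v, w} \<in> edges T" and uv: "u \<in> verts T" "v \<in> verts T"
      "u \<noteq> v" "lab T u = lab T v" using \<open>foldable T u v\<close> unfolding foldable_def by blast
    then show False using lab_eq[of u v] nb[OF w(1)] nb[OF w(2)] by auto
  qed
qed

lemma cyc_shift: "1 \<le> v \<Longrightarrow> cyc (v + (2 * n - 1)) = cyc (v - 1)"
proof -
  assume "1 \<le> v"
  then have "v + (2 * n - 1) = v - 1 + 2 * n" using n by simp
  then show ?thesis by (metis cyc_periodic)
qed

lemma lab_path_tree: "v \<in> verts (path_tree m) \<Longrightarrow> lab (path_tree m) v = cyc (v + (2 * n - 1))"
  using cyc_shift by (simp add: path_tree_def)

lemma lab_ext_path_tree: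
  "v \<in> verts (ext_path_tree m) \<Longrightarrow> lab (ext_path_tree m) v = cyc (v + (2 * n - 1))"
  using cyc_shift by (auto simp: ext_path_tree_def path_tree_def)

lemma reduced_path_tree: "2 \<le> m \<Longrightarrow> reduced (path_tree m)"
  by (rule reduced_if_path_like[OF _ lab_path_tree birooted_path_tree]) (auto simp: path_tree_def)

lemma reduced_ext_path_tree: "2 \<le> m \<Longrightarrow> reduced (ext_path_tree m)"
  by (rule reduced_if_path_like[OF _ lab_ext_path_tree birooted_ext_path_tree])
    (auto simp: ext_path_tree_def path_tree_def)

lemma root_choice_in_free_psl:
  assumes "birooted_tree T" "reduced T" "lab T ` verts T \<subseteq> X"
  shows "iso_class (if s then T else swap_roots T) \<in> free_psl X"
  using free_pslI[OF assms] free_pslI[OF birooted_swap_roots reduced_swap_roots, OF assms(1,2)] assms(3)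
  by (simp add: swap_roots_def)

lemma path_class_in: "2 \<le> m \<Longrightarrow> path_class s m \<in> free_psl X"
  unfolding path_class_def
  by (intro root_choice_in_free_psl birooted_path_tree reduced_path_tree)
    (auto simp: path_tree_def cyc_in)

lemma ext_path_class_in: "2 \<le> m \<Longrightarrow> ext_path_class s m \<in> free_psl X"
  unfolding ext_path_class_def
  by (intro root_choice_in_free_psl birooted_ext_path_tree reduced_ext_path_tree)
    (auto simp: ext_path_tree_def path_tree_def cyc_in)

lemma orient_class_rel_root_choice:
  assumes "birooted_tree T"
  shows "orient s (class_rel E D (iso_class (if s then T else swap_roots T))) = tree_rel E D T"
  using class_rel_iso_class[OF assms, of E D]
    class_rel_iso_class[OF birooted_swap_roots[OF assms], of E D]
  by (simp add: orient_def tree_rel_swap_roots)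

section \<open>Evaluation of the paths along walks\<close>

definition path_walk :: "'g rel \<Rightarrow> ('a \<Rightarrow> 'g set) \<Rightarrow> nat \<Rightarrow> (nat \<Rightarrow> 'g) \<Rightarrow> bool" where
  "path_walk E D m f \<longleftrightarrow>
     (\<forall>q<m. f q \<in> D (cyc q)) \<and> (\<forall>q. Suc q < m \<longrightarrow> (f q, f (Suc q)) \<in> E)"

lemma word_walk_class_rel:
  assumes "folded_graph E D"
  shows "word_walk E (class_rel E D) s (labels m) f \<longleftrightarrow> path_walk E D m f"
proof -
  have "sym E" using assms unfolding folded_graph_def by blast
  then show ?thesis
    unfolding word_walk_def path_walk_def
    by (simp add: Domain_class_rel_letter[OF assms] orient_sym)
qed

lemma placement_path_tree:
  assumes "sym E"
  shows "placement E D (path_tree m) f \<longleftrightarrow> path_walk E D m (\<lambda>q. f (Suc q))"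
proof
  assume f: "placement E D (path_tree m) f"
  show "path_walk E D m (\<lambda>q. f (Suc q))"
    unfolding path_walk_def
  proof (intro conjI allI impI)
    fix q assume "q < m"
    then show "f (Suc q) \<in> D (cyc q)" using placementD(1)[OF f, of "Suc q"]
      by (simp add: path_tree_def)
  next
    fix q assume "Suc q < m"
    then have "{Suc q, Suc (Suc q)} \<in> edges (path_tree m)" by (auto simp: path_tree_def)
    then show "(f (Suc q), f (Suc (Suc q))) \<in> E" by (rule placementD(2)[OF f])
  qed
next
  assume f: "path_walk E D m (\<lambda>q. f (Suc q))"
  show "placement E D (path_tree m) f"
  proof (rule placementI)
    fix v assume "v \<in> verts (path_tree m)"
    then obtain q where "v = Suc q" "q < m" by (cases v) (auto simp: path_tree_def)
    then show "f v \<in> D (lab (path_tree m) v)" using f by (simp add: path_tree_def path_walk_def)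
  next
    fix u v assume "{u, v} \<in> edges (path_tree m)"
    then obtain p where p: "{u, v} = {p, p + 1}" "1 \<le> p" "p < m" by (auto simp: path_tree_def)
    then obtain q where "p = Suc q" by (cases p) auto
    then have "(f p, f (p + 1)) \<in> E" using f p by (simp add: path_walk_def)
    then show "(f u, f v) \<in> E" using p(1) symD[OF assms] by (auto simp: doubleton_eq_iff)
  qed
qed

lemma tree_rel_path_tree:
  assumes "sym E"
  shows "tree_rel E D (path_tree m) = {(f 0, f 1) | f. path_walk E D m f}"
proof (intro equalityI subsetI)
  fix p assume "p \<in> tree_rel E D (path_tree m)"
  then obtain f where "placement E D (path_tree m) f" "p = (f 1, f 2)"
    by (auto elim!: tree_relE simp: path_tree_def)
  then show "p \<in> {(f 0, f 1) | f. path_walk E D m f}"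
    unfolding placement_path_tree[OF assms]
    by (intro CollectI exI[of _ "\<lambda>q. f (Suc q)"]) (simp add: numeral_2_eq_2)
next
  fix p assume "p \<in> {(f 0, f 1) | f. path_walk E D m f}"
  then obtain f where f: "p = (f 0, f 1)" "path_walk E D m f" by blast
  then have "placement E D (path_tree m) (\<lambda>q. f (q - 1))"
    by (simp add: placement_path_tree[OF assms])
  from tree_relI[OF this] show "p \<in> tree_rel E D (path_tree m)"
    using f(1) by (simp add: path_tree_def)
qed

lemma tree_rel_ext_path_tree:
  assumes "sym E" "2 \<le> m"
  shows "tree_rel E D (ext_path_tree m) =
    {(f 0, f 1) | f. path_walk E D m f \<and> (\<exists>c\<in>D (cyc (2 * n - 1)). (f 0, c) \<in> E)}"
proof -
  \<comment> \<open>Vertex 0 is the extra vertex here, whereas position 0 of a walk is vertex 1;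
    hence the shift by \<open>Suc\<close> and the use of \<open>case_nat\<close> below.\<close>
  have pl: "placement E D (ext_path_tree m) f \<longleftrightarrow> placement E D (path_tree m) f \<and>
      f 0 \<in> D (cyc (2 * n - 1)) \<and> (f 1, f 0) \<in> E" for f
  proof -
    have "(f 0, f 1) \<in> E \<longleftrightarrow> (f 1, f 0) \<in> E" using symD[OF assms(1)] by blast
    then have "(\<forall>u v. {u, v} = {0, 1} \<longrightarrow> (f u, f v) \<in> E) \<longleftrightarrow> (f 1, f 0) \<in> E"
      by (auto simp: doubleton_eq_iff)
    moreover have "(\<forall>u v. {u, v} \<in> edges (ext_path_tree m) \<longrightarrow> (f u, f v) \<in> E) \<longleftrightarrow>
        (\<forall>u v. {u, v} = {0, 1} \<longrightarrow> (f u, f v) \<in> E) \<and>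
        (\<forall>u v. {u, v} \<in> edges (path_tree m) \<longrightarrow> (f u, f v) \<in> E)"
    proof -
      have "edges (ext_path_tree m) = insert {0, 1} (edges (path_tree m))"
        by (simp add: ext_path_tree_def path_tree_def)
      then have "{u, v} \<in> edges (ext_path_tree m) \<longleftrightarrow>
          {u, v} = {0, 1} \<or> {u, v} \<in> edges (path_tree m)" for u v by (simp only: insert_iff)
      then show ?thesis by metis
    qed
    moreover have "(\<forall>v\<in>verts (ext_path_tree m). f v \<in> D (lab (ext_path_tree m) v)) \<longleftrightarrow>
        (\<forall>v\<in>verts (path_tree m). f v \<in> D (lab (path_tree m) v)) \<and> f 0 \<in> D (cyc (2 * n - 1))"
      by (auto simp: ext_path_tree_def path_tree_def)
    ultimately show ?thesis unfolding placement_def by blast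
  qed
  show ?thesis
  proof (intro equalityI subsetI)
    fix p assume "p \<in> tree_rel E D (ext_path_tree m)"
    then obtain f where f: "placement E D (ext_path_tree m) f" "p = (f 1, f 2)"
      by (auto elim!: tree_relE simp: path_tree_def ext_path_tree_def)
    then show "p \<in> {(f 0, f 1) | f. path_walk E D m f \<and> (\<exists>c\<in>D (cyc (2 * n - 1)). (f 0, c) \<in> E)}"
      unfolding pl placement_path_tree[OF assms(1)]
      by (intro CollectI exI[of _ "\<lambda>q. f (Suc q)"]) (auto simp: numeral_2_eq_2)
  next
    fix p assume "p \<in> {(f 0, f 1) | f. path_walk E D m f \<and> (\<exists>c\<in>D (cyc (2 * n - 1)). (f 0, c) \<in> E)}"
    then obtain f c where f: "p = (f 0, f 1)" "path_walk E D m f" "c \<in> D (cyc (2 * n - 1))"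
      "(f 0, c) \<in> E" by blast
    then have "placement E D (ext_path_tree m) (case_nat c f)"
      unfolding pl placement_path_tree[OF assms(1)] by simp
    from tree_relI[OF this] show "p \<in> tree_rel E D (ext_path_tree m)"
      using f(1) by (simp add: path_tree_def ext_path_tree_def numeral_2_eq_2)
  qed
qed

lemma orient_class_rel_path:
  assumes "folded_graph E D" "2 \<le> m"
  shows "orient s (class_rel E D (path_class s m)) = {(f 0, f 1) | f. path_walk E D m f}"
    and "orient s (class_rel E D (ext_path_class s m)) =
      {(f 0, f 1) | f. path_walk E D m f \<and> (\<exists>c\<in>D (cyc (2 * n - 1)). (f 0, c) \<in> E)}"
proof -
  have E: "sym E" using assms(1) unfolding folded_graph_def by blast
  show "orient s (class_rel E D (path_class s m)) = {(f 0, f 1) | f. path_walk E D m f}"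
    unfolding path_class_def orient_class_rel_root_choice[OF birooted_path_tree[OF assms(2)]]
    by (rule tree_rel_path_tree[OF E])
  show "orient s (class_rel E D (ext_path_class s m)) =
      {(f 0, f 1) | f. path_walk E D m f \<and> (\<exists>c\<in>D (cyc (2 * n - 1)). (f 0, c) \<in> E)}"
    unfolding ext_path_class_def orient_class_rel_root_choice[OF birooted_ext_path_tree[OF assms(2)]]
    by (rule tree_rel_ext_path_tree[OF E assms(2)])
qed

text \<open>A relational morphism other than an evaluation can be computed only through products;
  this form makes its value on the path depend on its values on letters alone.\<close>

lemma path_class_word:
  assumes "2 \<le> m"
  shows "path_class s m = word s (labels m)"
proof (rule class_rel_complete[OF path_class_in[OF assms]])
  show "word s (labels m) \<in> free_psl X"
    using assms set_labels by (intro word_in_free_psl) (auto simp: labels_def)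
  fix E :: "(nat \<times> bool) rel" and D :: "'a \<Rightarrow> _"
  assume G: "folded_graph E D"
  have "orient s (class_rel E D (path_class s m)) = orient s (class_rel E D (word s (labels m)))"
    unfolding orient_class_rel_path(1)[OF G assms]
    using orient_word[OF rel_morphism_class_rel[OF G] set_labels, of m s] assms
    unfolding word_walk_class_rel[OF G] by simp
  then show "class_rel E D (path_class s m) = class_rel E D (word s (labels m))"
    by (simp add: orient_eq_iff)
qed

lemma orient_path_class:
  assumes "rel_morphism X E h" "2 \<le> m"
  shows "orient s (h (path_class s m)) = {(f 0, f 1) | f. word_walk E h s (labels m) f}"
  unfolding path_class_word[OF assms(2)] using assms(2)
  by (intro orient_word[OF assms(1) set_labels]) simp

text \<open>Multiplying the first letter by the last label hangs the extra vertex on the first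
  vertex of the path.\<close>

definition ext_word :: "bool \<Rightarrow> nat \<Rightarrow> 'a bitree_class" where
  "ext_word s m = side_meet s (side_meet s (letter (cyc 0)) (letter (cyc (2 * n - 1))))
     (word (\<not> s) (tl (labels m)))"

lemma orient_ext_word:
  assumes h: "rel_morphism X E h" and m: "2 \<le> m"
  shows "ext_word s m \<in> free_psl X"
    and "orient s (h (ext_word s m)) = {(f 0, f 1) | f. word_walk E h s (labels m) f \<and>
      (\<exists>c\<in>Domain (orient (\<not> s) (h (letter (cyc (2 * n - 1))))). (f 0, c) \<in> orient s E)}"
proof -
  have L: "labels m = cyc 0 # cyc 1 # map cyc [2..<m]"
    using m by (simp add: labels_def upt_conv_Cons numeral_2_eq_2)
  define w where "w = word (\<not> s) (cyc 1 # map cyc [2..<m])"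
  have w: "w \<in> free_psl X" unfolding w_def using cyc_in by (intro word_in_free_psl) auto
  note free = letter_in_free_psl[OF cyc_in]
  have ext: "ext_word s m = side_meet s (side_meet s (letter (cyc 0)) (letter (cyc (2 * n - 1)))) w"
    unfolding ext_word_def L w_def by simp
  show "ext_word s m \<in> free_psl X"
    unfolding ext by (intro side_meet_in_free_psl free w)
  have "orient s (h (ext_word s m)) = {(a, d) \<in> orient s (h (word s (labels m))).
      \<exists>c\<in>Domain (orient (\<not> s) (h (letter (cyc (2 * n - 1))))). (a, c) \<in> orient s E}"
    unfolding ext L word.simps w_def[symmetric]
      orient_side_meet[OF h side_meet_in_free_psl[OF free free] w]
      orient_side_meet[OF h free free] orient_side_meet[OF h free w]
    by (auto simp: rel_meet_def Range_orient[symmetric])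
  then show "orient s (h (ext_word s m)) = {(f 0, f 1) | f. word_walk E h s (labels m) f \<and>
      (\<exists>c\<in>Domain (orient (\<not> s) (h (letter (cyc (2 * n - 1))))). (f 0, c) \<in> orient s E)}"
    using orient_word[OF h set_labels, of m s] m by auto
qed

lemma ext_path_class_word:
  assumes "2 \<le> m"
  shows "ext_path_class s m = ext_word s m"
proof (rule class_rel_complete[OF ext_path_class_in[OF assms]])
  show "ext_word s m \<in> free_psl X"
    \<comment> \<open>Membership was stated in the presence of some relational morphism; the empty
      one serves.\<close>
    using orient_ext_word(1)[OF _ assms, of "{}" "\<lambda>_. {}"]
    by (simp add: rel_morphism_def rel_meet_def)
  fix E :: "(nat \<times> bool) rel" and D :: "'a \<Rightarrow> _"
  assume G: "folded_graph E D"
  have E: "sym E" using G unfolding folded_graph_def by blast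
  have "orient s (class_rel E D (ext_path_class s m)) = orient s (class_rel E D (ext_word s m))"
    unfolding orient_class_rel_path(2)[OF G assms]
      orient_ext_word(2)[OF rel_morphism_class_rel[OF G] assms]
      word_walk_class_rel[OF G] Domain_class_rel_letter[OF G] orient_sym[OF E] ..
  then show "class_rel E D (ext_path_class s m) = class_rel E D (ext_word s m)"
    by (simp add: orient_eq_iff)
qed

lemma orient_ext_path_class:
  assumes "rel_morphism X E h" "2 \<le> m"
  shows "orient s (h (ext_path_class s m)) = {(f 0, f 1) | f. word_walk E h s (labels m) f \<and>
      (\<exists>c\<in>Domain (orient (\<not> s) (h (letter (cyc (2 * n - 1))))). (f 0, c) \<in> orient s E)}"
  unfolding ext_path_class_word[OF assms(2)] by (rule orient_ext_word(2)[OF assms])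

section \<open>The positive direction\<close>

lemma path_walk_mono: "path_walk E D M f \<Longrightarrow> m \<le> M \<Longrightarrow> path_walk E D m f"
  unfolding path_walk_def by auto

text \<open>A short and a long walk contributing to one pair start at vertices of
  \<open>D (cyc 0)\<close> with a common neighbour, so by folding they start at the same vertex.
  \<open>P\<close> carries the condition for the extra vertex.\<close>

lemma rel_meet_path_walks:
  assumes G: "folded_graph E D" and m: "2 \<le> m" "m \<le> M"
  shows "rel_meet E {(f 0, f 1) | f. path_walk E D m f \<and> P (f 0)} {(f 0, f 1) | f. path_walk E D M f} =
    {(f 0, f 1) | f. path_walk E D M f \<and> P (f 0)}"
proof (intro equalityI subsetI)
  fix p assume "p \<in> rel_meet E {(f 0, f 1) | f. path_walk E D m f \<and> P (f 0)}
    {(f 0, f 1) | f. path_walk E D M f}"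
  then obtain f g where fg: "p = (f 0, g 1)" "(f 0, g 1) \<in> E" "path_walk E D m f" "P (f 0)"
    "path_walk E D M g" unfolding rel_meet_def by auto
  have "f 0 \<in> D (cyc 0)" "g 0 \<in> D (cyc 0)" "(g 0, g 1) \<in> E"
    using fg(3,5) m unfolding path_walk_def by auto
  then have "f 0 = g 0" using folded_graphD(2)[OF G _ _ fg(2)] by blast
  then show "p \<in> {(f 0, f 1) | f. path_walk E D M f \<and> P (f 0)}" using fg by auto
next
  fix p assume "p \<in> {(f 0, f 1) | f. path_walk E D M f \<and> P (f 0)}"
  then obtain f where f: "p = (f 0, f 1)" "path_walk E D M f" "P (f 0)" by blast
  moreover have "path_walk E D m f" "(f 0, f 1) \<in> E"
    using path_walk_mono[OF f(2) m(2)] f(2) m unfolding path_walk_def by auto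
  ultimately show "p \<in> rel_meet E {(f 0, f 1) | f. path_walk E D m f \<and> P (f 0)}
    {(f 0, f 1) | f. path_walk E D M f}"
    unfolding rel_meet_def by (auto intro: DomainI RangeI)
qed

lemma side_meet_path_class:
  assumes m: "2 \<le> m" "m \<le> M"
  shows "side_meet s (path_class s m) (path_class s M) = path_class s M"
    and "side_meet s (ext_path_class s m) (path_class s M) = ext_path_class s M"
proof -
  have M: "2 \<le> M" using m by simp
  note free = path_class_in[OF m(1), of s] path_class_in[OF M, of s]
    ext_path_class_in[OF m(1), of s] ext_path_class_in[OF M, of s]
  show "side_meet s (path_class s m) (path_class s M) = path_class s M"
  proof (rule class_rel_complete[OF side_meet_in_free_psl[OF free(1,2)] free(2)])
    fix E :: "(nat \<times> bool) rel" and D :: "'a \<Rightarrow> _"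
    assume G: "folded_graph E D"
    then have E: "sym E" unfolding folded_graph_def by blast
    have "orient s (class_rel E D (side_meet s (path_class s m) (path_class s M))) =
        orient s (class_rel E D (path_class s M))"
      unfolding orient_side_meet[OF rel_morphism_class_rel[OF G] free(1,2)]
        orient_class_rel_path[OF G m(1)] orient_class_rel_path[OF G M] orient_sym[OF E]
      using rel_meet_path_walks[OF G m, of "\<lambda>_. True"] by simp
    then show "class_rel E D (side_meet s (path_class s m) (path_class s M)) =
        class_rel E D (path_class s M)" by (simp add: orient_eq_iff)
  qed
  show "side_meet s (ext_path_class s m) (path_class s M) = ext_path_class s M"
  proof (rule class_rel_complete[OF side_meet_in_free_psl[OF free(3,2)] free(4)])
    fix E :: "(nat \<times> bool) rel" and D :: "'a \<Rightarrow> _"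
    assume G: "folded_graph E D"
    then have E: "sym E" unfolding folded_graph_def by blast
    have "orient s (class_rel E D (side_meet s (ext_path_class s m) (path_class s M))) =
        orient s (class_rel E D (ext_path_class s M))"
      unfolding orient_side_meet[OF rel_morphism_class_rel[OF G] free(3,2)]
        orient_class_rel_path[OF G m(1)] orient_class_rel_path[OF G M] orient_sym[OF E]
      by (rule rel_meet_path_walks[OF G m])
    then show "class_rel E D (side_meet s (ext_path_class s m) (path_class s M)) =
        class_rel E D (ext_path_class s M)" by (simp add: orient_eq_iff)
  qed
qed

text \<open>Both members of the shorter pair are multiplied by the longer path, and congruence gives
  the longer pair.\<close>

lemma consequence_same_side:
  assumes m: "2 \<le> m" "m \<le> M"
  shows "consequence X (path_class s M, ext_path_class s M) (path_class s m, ext_path_class s m)"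
proof (rule consequenceI)
  fix \<rho>
  assume "fully_invariant_congruence X \<rho>" "(path_class s m, ext_path_class s m) \<in> \<rho>"
  then show "(path_class s M, ext_path_class s M) \<in> \<rho>"
    using congruence_side_meet[of X \<rho> "path_class s m" "ext_path_class s m" "path_class s M" s]
      path_class_in[of M s] m
    unfolding fully_invariant_congruence_def side_meet_path_class[OF m] by auto
qed

text \<open>Shifting the labels by one places the path on the second vertex of a path
  with the other orientation. The substituted edge for the last label fits into the longer path
  wherever that label occurs, and in front of the path it supplies the missing vertex.\<close>

definition shift_label :: "bool \<Rightarrow> 'a \<Rightarrow> 'a" where
  "shift_label s y = (if y = cyc (2 * n - 1) then cyc (if s then 0 else 2 * n - 1)
     else if y \<in> range cyc then cyc (Suc (inv cyc y)) else y)"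

abbreviation shift_class :: "bool \<Rightarrow> 'a bitree_class \<Rightarrow> 'a bitree_class" where
  "shift_class s \<equiv> subst_class (shift_label s) (shift_label (\<not> s))"

lemma shift_label_cyc:
  assumes "cyc q \<noteq> cyc (2 * n - 1)"
  shows "shift_label s (cyc q) = cyc (Suc q)"
proof -
  \<comment> \<open>\<open>inv cyc\<close> returns just some position with this label, but the label
    of its successor is determined.\<close>
  have "cyc (inv cyc (cyc q)) = cyc q" by (rule f_inv_into_f) blast
  then have "cyc (Suc (inv cyc (cyc q))) = cyc (Suc q)" unfolding cyc_eq_iff_dvd by simp
  then show ?thesis using assms by (simp add: shift_label_def)
qed

lemma shift_label_in: "shift_label s ` X \<subseteq> X"
  using cyc_in by (auto simp: shift_label_def)

lemma rel_morphism_shift: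
  assumes "folded_graph E D"
  shows "rel_morphism X E (\<lambda>\<gamma>. class_rel E D (shift_class s \<gamma>))"
  using endomorphism_subst_class[OF shift_label_in shift_label_in] rel_morphism_class_rel[OF assms]
  unfolding rel_morphism_def endomorphism_def by metis

text \<open>A letter other than the last becomes the product of one letter with itself, so either
  orientation \<open>t\<close> may be read; the last becomes a product of two different letters and
  is read on side \<open>s\<close> only.\<close>

lemma Domain_shift_letter:
  assumes G: "folded_graph E D"
  shows "cyc q \<noteq> cyc (2 * n - 1) \<Longrightarrow>
      Domain (orient t (class_rel E D (shift_class s (letter (cyc q))))) = D (cyc (Suc q))"
    and "Domain (orient s (class_rel E D (shift_class s (letter (cyc (2 * n - 1)))))) =
      {a \<in> D (cyc 0). \<exists>c\<in>D (cyc (2 * n - 1)). (a, c) \<in> E}"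
proof -
  have E: "sym E" using G unfolding folded_graph_def by blast
  note free = letter_in_free_psl[OF cyc_in]
  note sl = subst_class_letter[OF shift_label_in shift_label_in cyc_in]
  show "Domain (orient t (class_rel E D (shift_class s (letter (cyc q))))) = D (cyc (Suc q))"
    if "cyc q \<noteq> cyc (2 * n - 1)"
  proof -
    have "shift_class s (letter (cyc q)) =
        side_meet t (letter (cyc (Suc q))) (letter (cyc (Suc q)))"
      unfolding sl shift_label_cyc[OF that] side_meet_def by simp
    then have "Domain (orient t (class_rel E D (shift_class s (letter (cyc q))))) =
        {a \<in> D (cyc (Suc q)). \<exists>d\<in>D (cyc (Suc q)). (a, d) \<in> E}"
      by (simp add: orient_side_meet[OF rel_morphism_class_rel[OF G] free free] Domain_rel_meet
        Range_orient Domain_class_rel_letter[OF G] orient_sym[OF E])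
    then show ?thesis using folded_graphD(3)[OF G] by blast
  qed
  have "shift_class s (letter (cyc (2 * n - 1))) =
      side_meet s (letter (cyc 0)) (letter (cyc (2 * n - 1)))"
    unfolding sl side_meet_def shift_label_def by simp
  then show "Domain (orient s (class_rel E D (shift_class s (letter (cyc (2 * n - 1)))))) =
      {a \<in> D (cyc 0). \<exists>c\<in>D (cyc (2 * n - 1)). (a, c) \<in> E}"
    by (simp add: orient_side_meet[OF rel_morphism_class_rel[OF G] free free] Domain_rel_meet
      Range_orient Domain_class_rel_letter[OF G] orient_sym[OF E])
qed

lemma word_walk_shift:
  assumes G: "folded_graph E D" and f: "path_walk E D M f" and m: "m < M"
  shows "word_walk E (\<lambda>\<gamma>. class_rel E D (shift_class s \<gamma>)) (\<not> s) (labels m) (\<lambda>q. f (Suc q))"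
proof -
  have E: "sym E" using G unfolding folded_graph_def by blast
  have fD: "f q \<in> D (cyc q)" if "q < M" for q using f that unfolding path_walk_def by blast
  have fE: "(f q, f (Suc q)) \<in> E" if "Suc q < M" for q using f that unfolding path_walk_def by blast
  have "f (Suc q) \<in> Domain (orient (even q = (\<not> s)) (class_rel E D (shift_class s (letter (cyc q)))))"
    if q: "q < m" for q
  proof (cases "cyc q = cyc (2 * n - 1)")
    case False
    then show ?thesis using Domain_shift_letter(1)[OF G] fD[of "Suc q"] q m by simp
  next
    case True
    then have mod: "q mod (2 * n) = 2 * n - 1" using n by (simp add: cyc_eq_iff)
    then have "odd (q mod (2 * n))" using n by simp
    \<comment> \<open>The last label sits at odd positions only, hence always on side
      \<open>s\<close>. There the substituted edge is placed on \<open>f (Suc q)\<close> and the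
      preceding vertex \<open>f q\<close> of the longer walk.\<close>
    then have "odd q" by (simp add: dvd_mod_iff)
    then have "(even q = (\<not> s)) = s" by simp
    moreover have "cyc (Suc q) = cyc 0"
      using mod n by (simp add: cyc_eq_iff mod_Suc)
    then have "f (Suc q) \<in> D (cyc 0)" using fD[of "Suc q"] q m by simp
    moreover have "f q \<in> D (cyc (2 * n - 1))" using fD[of q] q m True by simp
    moreover have "(f (Suc q), f q) \<in> E" using fE[of q] q m symD[OF E] by simp
    ultimately show ?thesis using True Domain_shift_letter(2)[OF G, of s] by auto
  qed
  moreover have "(f (Suc q), f (Suc (Suc q))) \<in> E" if "Suc q < m" for q using fE that m by simp
  ultimately show ?thesis unfolding word_walk_def by (simp add: orient_sym[OF E])
qed

text \<open>The pairs are read from the second vertex of the longer path to its first. Folding makes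
  the shifted walk start at that second vertex; \<open>P\<close> and \<open>Q\<close> carry the
  conditions for the extra vertex of the shorter and of the longer path.\<close>

lemma rel_meet_shifted_walks:
  assumes G: "folded_graph E D" and m: "2 \<le> m" "m < M"
    and PQ: "\<And>f. path_walk E D M f \<Longrightarrow> P (f 1) \<longleftrightarrow> Q (f 0)"
  shows "rel_meet E
      {(f 0, f 1) | f. word_walk E (\<lambda>\<gamma>. class_rel E D (shift_class s \<gamma>)) (\<not> s) (labels m) f \<and> P (f 0)}
      {(f 1, f 0) | f. path_walk E D M f} =
    {(f 1, f 0) | f. path_walk E D M f \<and> Q (f 0)}" (is "rel_meet E ?A ?B = ?C")
proof (intro equalityI subsetI)
  have E: "sym E" using G unfolding folded_graph_def by blast
  have edge: "(f 1, f 0) \<in> E" "f 1 \<in> D (cyc 1)" if "path_walk E D M f" for f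
    using that m symD[OF E] unfolding path_walk_def by auto
  fix p
  show "p \<in> ?C" if p: "p \<in> rel_meet E ?A ?B"
  proof -
    obtain a d where ad: "p = (a, d)" "(a, d) \<in> E" "a \<in> Domain ?A" "d \<in> Range ?B"
      using p unfolding rel_meet_def by blast
    obtain f where "a = f 0" "P (f 0)"
      "word_walk E (\<lambda>\<gamma>. class_rel E D (shift_class s \<gamma>)) (\<not> s) (labels m) f"
      using ad(3) by blast
    moreover obtain g where "d = g 0" "path_walk E D M g" using ad(4) by blast
    ultimately have fg: "p = (f 0, g 0)" "(f 0, g 0) \<in> E" "P (f 0)" "path_walk E D M g"
      "word_walk E (\<lambda>\<gamma>. class_rel E D (shift_class s \<gamma>)) (\<not> s) (labels m) f"
      using ad(1,2) by simp_all
    have "cyc 0 \<noteq> cyc (2 * n - 1)" using n by (intro cyc_neq) auto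
    moreover have "0 < m" using m by simp
    then have "f 0 \<in> Domain (orient (even (0 :: nat) = (\<not> s))
        (class_rel E D (shift_class s (letter (cyc 0)))))"
      using fg(5) unfolding word_walk_def by (metis length_labels nth_labels)
    ultimately have "f 0 \<in> D (cyc 1)" using Domain_shift_letter(1)[OF G] by simp
    then have "f 0 = g 1" using folded_graphD(2)[OF G _ _ fg(2)] edge[OF fg(4)] by blast
    then show ?thesis using fg PQ by auto
  qed
  show "p \<in> rel_meet E ?A ?B" if p: "p \<in> ?C"
  proof -
    obtain f where f: "p = (f 1, f 0)" "path_walk E D M f" "Q (f 0)" using p by blast
    have "P (f 1)" using f PQ by blast
    then have "(f 1, f 2) \<in> ?A"
      using word_walk_shift[OF G f(2) m(2), of s]
      by (intro CollectI exI[of _ "\<lambda>q. f (Suc q)"]) (simp add: numeral_2_eq_2)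
    moreover have "(f 1, f 0) \<in> ?B" using f by blast
    ultimately show ?thesis using f(1) edge(1)[OF f(2)] unfolding rel_meet_def by blast
  qed
qed

lemma orient_Not_class_rel_path:
  assumes "folded_graph E D" "2 \<le> m"
  shows "orient (\<not> s) (class_rel E D (path_class s m)) = {(f 1, f 0) | f. path_walk E D m f}"
    and "orient (\<not> s) (class_rel E D (ext_path_class s m)) =
      {(f 1, f 0) | f. path_walk E D m f \<and> (\<exists>c\<in>D (cyc (2 * n - 1)). (f 0, c) \<in> E)}"
  unfolding orient_Not orient_class_rel_path[OF assms] by auto

lemma side_meet_shift_class:
  assumes m: "2 \<le> m" "m < M"
  shows "side_meet (\<not> s) (shift_class s (path_class (\<not> s) m)) (path_class s M) = path_class s M"
    and "side_meet (\<not> s) (shift_class s (ext_path_class (\<not> s) m)) (path_class s M) = ext_path_class s M"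
proof -
  have M: "2 \<le> M" using m by simp
  note sub = subst_class_in_free_psl[OF shift_label_in shift_label_in]
  note free = sub[OF path_class_in[OF m(1), of "\<not> s"], of s "\<not> s"] path_class_in[OF M, of s]
    sub[OF ext_path_class_in[OF m(1), of "\<not> s"], of s "\<not> s"] ext_path_class_in[OF M, of s]
  show "side_meet (\<not> s) (shift_class s (path_class (\<not> s) m)) (path_class s M) = path_class s M"
  proof (rule class_rel_complete[OF side_meet_in_free_psl[OF free(1,2)] free(2)])
    fix E :: "(nat \<times> bool) rel" and D :: "'a \<Rightarrow> _"
    assume G: "folded_graph E D"
    then have E: "sym E" unfolding folded_graph_def by blast
    have "orient (\<not> s) (class_rel E D
          (side_meet (\<not> s) (shift_class s (path_class (\<not> s) m)) (path_class s M))) =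
        orient (\<not> s) (class_rel E D (path_class s M))"
      unfolding orient_side_meet[OF rel_morphism_class_rel[OF G] free(1,2)]
        orient_path_class[OF rel_morphism_shift[OF G] m(1)]
        orient_Not_class_rel_path[OF G M] orient_sym[OF E]
      using rel_meet_shifted_walks[OF G m, of "\<lambda>_. True" "\<lambda>_. True" s] by simp
    then show "class_rel E D (side_meet (\<not> s) (shift_class s (path_class (\<not> s) m)) (path_class s M)) =
        class_rel E D (path_class s M)" by (simp add: orient_eq_iff)
  qed
  show "side_meet (\<not> s) (shift_class s (ext_path_class (\<not> s) m)) (path_class s M) = ext_path_class s M"
  proof (rule class_rel_complete[OF side_meet_in_free_psl[OF free(3,2)] free(4)])
    fix E :: "(nat \<times> bool) rel" and D :: "'a \<Rightarrow> _"
    assume G: "folded_graph E D"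
    then have E: "sym E" unfolding folded_graph_def by blast
    \<comment> \<open>A neighbour of \<open>f 1\<close> in \<open>D (cyc 0)\<close> can only be
      \<open>f 0\<close>, so the substituted extra vertex hangs a vertex with the last label on the
      start of the longer path.\<close>
    have PQ: "(\<exists>c\<in>{a \<in> D (cyc 0). \<exists>c\<in>D (cyc (2 * n - 1)). (a, c) \<in> E}. (f 1, c) \<in> E) \<longleftrightarrow>
        (\<exists>c\<in>D (cyc (2 * n - 1)). (f 0, c) \<in> E)" if "path_walk E D M f" for f
    proof -
      have "f 0 \<in> D (cyc 0)" "(f 0, f 1) \<in> E" using that M unfolding path_walk_def by auto
      then show ?thesis using folded_graphD(1,2)[OF G] by blast
    qed
    have "orient (\<not> s) (class_rel E D
          (side_meet (\<not> s) (shift_class s (ext_path_class (\<not> s) m)) (path_class s M))) =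
        orient (\<not> s) (class_rel E D (ext_path_class s M))"
      unfolding orient_side_meet[OF rel_morphism_class_rel[OF G] free(3,2)]
        orient_ext_path_class[OF rel_morphism_shift[OF G] m(1)]
        orient_Not_class_rel_path[OF G M] orient_sym[OF E] not_not Domain_shift_letter(2)[OF G]
      by (rule rel_meet_shifted_walks[OF G m PQ])
    then show "class_rel E D
        (side_meet (\<not> s) (shift_class s (ext_path_class (\<not> s) m)) (path_class s M)) =
        class_rel E D (ext_path_class s M)" by (simp add: orient_eq_iff)
  qed
qed

lemma consequence_other_side:
  assumes m: "2 \<le> m" "m < M"
  shows "consequence X (path_class s M, ext_path_class s M)
    (path_class (\<not> s) m, ext_path_class (\<not> s) m)"
proof (rule consequenceI)
  fix \<rho>
  assume \<rho>: "fully_invariant_congruence X \<rho>"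
    and in\<rho>: "(path_class (\<not> s) m, ext_path_class (\<not> s) m) \<in> \<rho>"
  have "(shift_class s (path_class (\<not> s) m), shift_class s (ext_path_class (\<not> s) m)) \<in> \<rho>"
    using \<rho> in\<rho> endomorphism_subst_class[OF shift_label_in shift_label_in]
    unfolding fully_invariant_congruence_def by blast
  then show "(path_class s M, ext_path_class s M) \<in> \<rho>"
    using congruence_side_meet[of X \<rho> "shift_class s (path_class (\<not> s) m)"
        "shift_class s (ext_path_class (\<not> s) m)" "path_class s M" "\<not> s"]
      path_class_in[of M s] m \<rho>
    unfolding fully_invariant_congruence_def side_meet_shift_class[OF m] by auto
qed

section \<open>The negative direction\<close>

text \<open>Node \<open>p\<close> stands for two vertices, the vertex of the path at position \<open>p\<close> and a thorn
  attached to it; one of them is a left vertex, the other a right vertex.\<close>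

definition path_rel :: "bool \<Rightarrow> nat \<Rightarrow> nat rel" where
  "path_rel s M = {(p, q). p < M \<and> q < M \<and> (p = q \<or> even p = s \<and> (q = Suc p \<or> p = Suc q))}"

definition path_nodes :: "nat \<Rightarrow> 'a \<Rightarrow> nat set" where
  "path_nodes M y = {p. p < M \<and> cyc p = y}"

definition path_eval :: "bool \<Rightarrow> nat \<Rightarrow> 'a bitree_class \<Rightarrow> nat rel" where
  "path_eval s M \<gamma> = bip_proj (class_rel (bip_rel (path_rel s M))
     (bip_lab (path_nodes M) (path_nodes M)) \<gamma>)"

text \<open>The left root of a class has one label, and so has the right root; for an evaluation
  this confines the relation to one residue on each side. Being a condition on values alone, it
  survives composition with endomorphisms.\<close>

definition monochrome :: "nat rel set" where
  "monochrome = {R. \<exists>y z. R \<subseteq> {p. cyc p = y} \<times> {q. cyc q = z}}"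

lemma path_rel_step: "(p, q) \<in> orient t (path_rel s M) \<Longrightarrow> p < M \<and> q < M \<and> (p = q \<or> q = Suc p \<or> p = Suc q)"
  by (auto simp: path_rel_def orient_def split: if_splits)

lemma cyc_near: "cyc p = cyc q \<Longrightarrow> p \<le> q + 2 \<Longrightarrow> q \<le> p + 2 \<Longrightarrow> p = q"
  using cyc_neq[of p q] cyc_neq[of q p] n by (cases p q rule: linorder_cases) auto

lemma folded_graph_path:
  "folded_graph (bip_rel (path_rel s M)) (bip_lab (path_nodes M) (path_nodes M))"
proof (rule folded_graph_bip)
  fix y a b c
  have near: "p \<le> Suc q \<and> q \<le> Suc p" if "(p, q) \<in> path_rel s M" for p q
    using that by (auto simp: path_rel_def)
  show "a = b" if "a \<in> path_nodes M y" "b \<in> path_nodes M y" "(a, c) \<in> path_rel s M" "(b, c) \<in> path_rel s M"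
    using that(1,2) near[OF that(3)] near[OF that(4)] by (intro cyc_near) (simp_all add: path_nodes_def)
  show "a = b" if "a \<in> path_nodes M y" "b \<in> path_nodes M y" "(c, a) \<in> path_rel s M" "(c, b) \<in> path_rel s M"
    using that(1,2) near[OF that(3)] near[OF that(4)] by (intro cyc_near) (simp_all add: path_nodes_def)
qed (auto simp: path_nodes_def path_rel_def)

lemma rel_morphism_path_eval: "rel_morphism X (path_rel s M) (path_eval s M)"
  unfolding path_eval_def[abs_def] by (rule rel_morphism_bip[OF folded_graph_path])

lemma path_eval_monochrome: "path_eval s M ` free_psl X \<subseteq> monochrome"
proof (intro image_subsetI)
  fix \<gamma> assume "\<gamma> \<in> free_psl X"
  then obtain T where T: "birooted_tree T" "\<gamma> = iso_class T" using free_pslE by metis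
  have "path_eval s M \<gamma> \<subseteq> {p. cyc p = lab T (lroot T)} \<times> {q. cyc q = lab T (rroot T)}"
  proof
    fix e assume "e \<in> path_eval s M \<gamma>"
    then obtain a b f where e: "e = (a, b)" and f: "(a, True) = f (lroot T)" "(b, False) = f (rroot T)"
      "placement (bip_rel (path_rel s M)) (bip_lab (path_nodes M) (path_nodes M)) T f"
      unfolding path_eval_def T(2) class_rel_iso_class[OF T(1)] bip_proj_def
      by (auto elim!: tree_relE)
    have "a \<in> path_nodes M (lab T (lroot T))" "b \<in> path_nodes M (lab T (rroot T))"
      using placementD(1)[OF f(3) birooted_roots(1)[OF T(1)]]
        placementD(1)[OF f(3) birooted_roots(2)[OF T(1)]]
      unfolding f(1,2)[symmetric] by simp_all
    then show "e \<in> {p. cyc p = lab T (lroot T)} \<times> {q. cyc q = lab T (rroot T)}"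
      using e by (simp add: path_nodes_def)
  qed
  then show "path_eval s M \<gamma> \<in> monochrome" unfolding monochrome_def by blast
qed

lemma path_eval_letter:
  "path_eval s M (letter y) = {(a, b) \<in> path_rel s M. a \<in> path_nodes M y \<and> b \<in> path_nodes M y}"
proof -
  have "sym (bip_rel (path_rel s M))" using folded_graph_path unfolding folded_graph_def by blast
  then show ?thesis unfolding path_eval_def by (auto simp: class_rel_letter bip_proj_def)
qed

text \<open>The identity walk realises \<open>(0, 1)\<close>. The extra vertex would have to be
  placed on node 0 or 1 with the label of node \<open>2 * n - 1 \<ge> 3\<close>.\<close>

lemma path_eval_separates:
  assumes M: "2 \<le> M"
  shows "path_eval s M (path_class s M) \<noteq> path_eval s M (ext_path_class s M)"
proof -
  have "word_walk (path_rel s M) (path_eval s M) s (labels M) (\<lambda>q. q)"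
    unfolding word_walk_def path_eval_letter
  proof (intro conjI allI impI)
    fix q assume "q < length (labels M)"
    then have "(q, q) \<in> orient (even q = s) {(a, b) \<in> path_rel s M.
        a \<in> path_nodes M (labels M ! q) \<and> b \<in> path_nodes M (labels M ! q)}"
      by (simp add: orient_def path_rel_def path_nodes_def)
    then show "q \<in> Domain (orient (even q = s) {(a, b) \<in> path_rel s M.
        a \<in> path_nodes M (labels M ! q) \<and> b \<in> path_nodes M (labels M ! q)})" by blast
  qed (auto simp: orient_def path_rel_def)
  then have "(0, 1) \<in> orient s (path_eval s M (path_class s M))"
    unfolding orient_path_class[OF rel_morphism_path_eval M]
    by (intro CollectI exI[of _ "\<lambda>q. q"]) simp
  moreover have "(0, 1) \<notin> orient s (path_eval s M (ext_path_class s M))"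
  proof
    assume "(0, 1) \<in> orient s (path_eval s M (ext_path_class s M))"
    then obtain c where c: "c \<in> Domain (orient (\<not> s) (path_eval s M (letter (cyc (2 * n - 1)))))"
      "(0, c) \<in> orient s (path_rel s M)"
      unfolding orient_ext_path_class[OF rel_morphism_path_eval M] mem_Collect_eq prod.inject
      by metis
    have "cyc c = cyc (2 * n - 1)" using c(1)
      by (auto simp: path_eval_letter orient_def path_nodes_def split: if_splits)
    moreover have "c < 2" using path_rel_step[OF c(2)] by auto
    then have "c < 2 * n - 1" "2 * n - 1 < c + 2 * n" using n by linarith+
    ultimately show False using cyc_neq by blast
  qed
  ultimately show ?thesis by metis
qed

lemma path_word_walk_returns:
  assumes h: "h ` free_psl X \<subseteq> monochrome"
    and f: "word_walk (path_rel s M) h t (labels m) f"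
    and m: "2 * n < m" and M: "M < m \<or> M = m \<and> t \<noteq> s \<and> odd M"
  shows "f (2 * n) = f 0"
proof (rule ccontr)
  assume moved: "f (2 * n) \<noteq> f 0"
  have step: "(f q, f (Suc q)) \<in> orient (even q = t) (path_rel s M)" if "Suc q < m" for q
    using f that unfolding word_walk_def by simp
  have bound: "f q < M" if "q < m" for q
  proof (cases q)
    case 0
    then show ?thesis using path_rel_step[OF step[of 0]] m n by simp
  next
    case (Suc r)
    then show ?thesis using path_rel_step[OF step[of r]] that by simp
  qed
  \<comment> \<open>Positions \<open>q\<close> and \<open>q + 2 * n\<close> carry the same letter
    and, \<open>2 * n\<close> being even, lie on the same side; so both nodes come from the same
    domain of a monochrome relation.\<close>
  have "int (2 * n) dvd int (f (q + 2 * n)) - int (f q)" if q: "q + 2 * n < m" for q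
  proof -
    have "h (letter (cyc q)) \<in> monochrome" using h letter_in_free_psl[OF cyc_in] by blast
    then obtain y z where "h (letter (cyc q)) \<subseteq> {p. cyc p = y} \<times> {p. cyc p = z}"
      unfolding monochrome_def by blast
    then have y: "Domain (orient (even q = t) (h (letter (cyc q)))) \<subseteq>
        {p. cyc p = (if even q = t then y else z)}"
      by (auto simp: orient_def)
    have fq: "f q \<in> Domain (orient (even q = t) (h (letter (cyc q))))"
      "f (q + 2 * n) \<in> Domain (orient (even (q + 2 * n) = t) (h (letter (cyc (q + 2 * n)))))"
      using f q unfolding word_walk_def by (metis add_lessD1 length_labels nth_labels)+
    then have "f (q + 2 * n) \<in> Domain (orient (even q = t) (h (letter (cyc q))))"
      by (simp add: cyc_periodic)
    then have "cyc (f q) = cyc (f (q + 2 * n))"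
      using subsetD[OF y fq(1)] subsetD[OF y] by simp
    then show ?thesis unfolding cyc_eq_iff_dvd by (simp add: dvd_diff_commute)
  qed
  moreover have "\<bar>int (f (Suc q)) - int (f q)\<bar> \<le> 1" if "Suc q < m" for q
    using path_rel_step[OF step[OF that]] by auto
  ultimately have "(\<forall>q<m. int (f q) = int (f 0) + int q) \<or> (\<forall>q<m. int (f q) = int (f 0) - int q)"
    using moved m n by (intro periodic_walk_straight[where N="2 * n"]) auto
  then show False
  proof
    assume up: "\<forall>q<m. int (f q) = int (f 0) + int q"
    have m': "m - 1 < m" "1 < m" using m n by simp_all
    then have "int (f (m - 1)) = int (f 0) + int (m - 1)" using up by blast
    then have "f 0 + (m - 1) < M" using bound[of "m - 1"] m by simp
    \<comment> \<open>The lengths must be equal, and the walk fills the path from node 0. A proper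
      step out of node 0 is possible on side \<open>s\<close> only, but the walk starts on side
      \<open>t\<close>.\<close>
    then have "f 0 = 0" "M = m" "t \<noteq> s" using M by auto
    moreover have "int (f 1) = int (f 0) + int 1" using up m'(2) by blast
    then have "f 1 = f 0 + 1" by simp
    ultimately show False using step[of 0] m n
      by (cases t) (auto simp: orient_def path_rel_def)
  next
    assume down: "\<forall>q<m. int (f q) = int (f 0) - int q"
    have m': "m - 1 < m" "1 < m" using m n by simp_all
    then have "int (f (m - 1)) = int (f 0) - int (m - 1)" using down by blast
    then have "m - 1 \<le> f 0" by simp
    \<comment> \<open>Now the walk starts at node \<open>M - 1\<close>, which is even like node 0
      because \<open>M\<close> is odd, and the sides clash in the same way.\<close>
    then have "Suc (f 0) = M" "M = m" "t \<noteq> s" "odd M" using M bound[of 0] m by auto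
    moreover have "int (f 1) = int (f 0) - int 1" using down m'(2) by blast
    then have "f 0 = f 1 + 1" by simp
    ultimately show False using step[of 0] m n
      by (cases t) (auto simp: orient_def path_rel_def)
  qed
qed

lemma not_consequence_path:
  assumes m: "2 * n < m" and M2: "2 \<le> M" and M: "M < m \<or> M = m \<and> t \<noteq> s \<and> odd M"
  shows "\<not> consequence X (path_class s M, ext_path_class s M) (path_class t m, ext_path_class t m)"
proof (rule not_consequenceI[OF path_class_in ext_path_class_in rel_morphism_path_eval
      path_eval_monochrome path_eval_separates[OF M2]])
  show m2: "2 \<le> m" using m n by simp
  then show "2 \<le> m" .
  fix h assume h: "rel_morphism X (path_rel s M) h" "h ` free_psl X \<subseteq> monochrome"
  \<comment> \<open>Position \<open>2 * n - 1\<close> carries the label of the extra vertex, is odd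
    and therefore on side \<open>\<not> t\<close>, and is adjacent to
    \<open>f (2 * n) = f 0\<close>.\<close>
  have "\<exists>c\<in>Domain (orient (\<not> t) (h (letter (cyc (2 * n - 1))))). (f 0, c) \<in> orient t (path_rel s M)"
    if f: "word_walk (path_rel s M) h t (labels m) f" for f
  proof (rule bexI)
    have odd: "odd (2 * n - 1)" "Suc (2 * n - 1) = 2 * n" using n by simp_all
    show "f (2 * n - 1) \<in> Domain (orient (\<not> t) (h (letter (cyc (2 * n - 1)))))"
    proof -
      have "2 * n - 1 < m" using m by simp
      then have "f (2 * n - 1) \<in>
          Domain (orient (even (2 * n - 1) = t) (h (letter (cyc (2 * n - 1)))))"
        using f unfolding word_walk_def by (metis length_labels nth_labels)
      then show ?thesis using odd(1) by simp
    qed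
    have "Suc (2 * n - 1) < m" using m odd(2) by simp
    then have "(f (2 * n - 1), f (2 * n)) \<in> orient (even (2 * n - 1) = t) (path_rel s M)"
      using f odd(2) unfolding word_walk_def by (metis length_labels)
    then have "(f (2 * n - 1), f (2 * n)) \<in> orient (\<not> t) (path_rel s M)" using odd(1) by simp
    then show "(f 0, f (2 * n - 1)) \<in> orient t (path_rel s M)"
      unfolding path_word_walk_returns[OF h(2) f m M] orient_Not by simp
  qed
  then have "orient t (h (path_class t m)) = orient t (h (ext_path_class t m))"
    unfolding orient_path_class[OF h(1) m2] orient_ext_path_class[OF h(1) m2] by blast
  then show "h (path_class t m) = h (ext_path_class t m)" by (simp add: orient_eq_iff)
qed

lemma consequence_path_same_side_iff:
  assumes "2 * n < m" "2 * n < M"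
  shows "consequence X (path_class s M, ext_path_class s M) (path_class s m, ext_path_class s m) \<longleftrightarrow> m \<le> M"
  using consequence_same_side[of m M s] not_consequence_path[of m M s s] assms n
  by (cases "m \<le> M") auto

text \<open>Parity decides the case \<open>M = m\<close>, in which either alternative gives
  \<open>odd M\<close>.\<close>

lemma consequence_path_other_side_iff:
  assumes "2 * n < m" "2 * n < M" "odd m \<or> odd M"
  shows "consequence X (path_class s M, ext_path_class s M)
    (path_class (\<not> s) m, ext_path_class (\<not> s) m) \<longleftrightarrow> m < M"
proof
  assume "m < M"
  then show "consequence X (path_class s M, ext_path_class s M)
      (path_class (\<not> s) m, ext_path_class (\<not> s) m)"
    using consequence_other_side assms n by simp
next
  assume c: "consequence X (path_class s M, ext_path_class s M)
      (path_class (\<not> s) m, ext_path_class (\<not> s) m)"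
  have "M < m \<or> M = m \<and> (\<not> s) \<noteq> s \<and> odd M" if "\<not> m < M" using that assms(3) by auto
  then show "m < M" using not_consequence_path[OF assms(1), of M "\<not> s" s] c assms(2) n by fastforce
qed

end

theorem corollary4p8:
  fixes X :: "'a set" and x :: "nat \<Rightarrow> 'a" and n k l i j :: nat
  assumes "countable X" and "infinite X"
    and "inj_on x {1..}" and "x ` {1..} \<subseteq> X"
    and "n \<ge> 2" and "k \<ge> 1" and "l \<ge> 1"
    and "i \<in> {1..2 * n}" and "j \<in> {1..2 * n}"
  shows
    "(consequence X (alpha x n k i, beta x n k i) (alpha x n l j, beta x n l j)
        \<longleftrightarrow> 2 * n * k + i \<ge> 2 * n * l + j) \<and>
     (odd i \<and> odd j \<longrightarrow>
        (consequence X (alpha_star x n k i, beta_star x n k i) (alpha_star x n l j, beta_star x n l j)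
        \<longleftrightarrow> 2 * n * k + i \<ge> 2 * n * l + j)) \<and>
     (odd i \<longrightarrow>
        (consequence X (alpha_star x n k i, beta_star x n k i) (alpha x n l j, beta x n l j)
        \<longleftrightarrow> 2 * n * k + i > 2 * n * l + j)) \<and>
     (odd j \<longrightarrow>
        (consequence X (alpha x n k i, beta x n k i) (alpha_star x n l j, beta_star x n l j)
        \<longleftrightarrow> 2 * n * k + i > 2 * n * l + j))"
proof -
  interpret cyclic_labels X x n using assms by unfold_locales
  define M where "M = 2 * n * k + i"
  define m where "m = 2 * n * l + j"
  have "2 * n * 1 \<le> 2 * n * k" "2 * n * 1 \<le> 2 * n * l" using assms by (intro mult_le_mono2; simp)+
  then have M: "2 * n < M" and m: "2 * n < m" using assms(8,9)
    unfolding M_def m_def atLeastAtMost_iff mult_1_right by linarith+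
  have odd: "odd M = odd i" "odd m = odd j" by (simp_all add: M_def m_def)
  note same = consequence_path_same_side_iff[OF m M]
  note other = consequence_path_other_side_iff[OF m M]
  \<comment> \<open>The parameter is the orientation of the pair to be derived: \<open>same\<close>
    yields (i) for \<open>True\<close> and (ii) for \<open>False\<close>, and \<open>other\<close>
    yields (iii) for \<open>False\<close> and (iv) for \<open>True\<close>.\<close>
  show ?thesis
    unfolding alpha_eq beta_eq M_def[symmetric] m_def[symmetric]
    using same[of True] same[of False] other[of True] other[of False] odd by simp
qed

end
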